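(* Let $k$ be a field of characteristic zero, let $B$ be an affine $k$-domain, let $(D,U)$ be a nontrivial fundamental pair for $B$, and let $B=\bigoplus_{i\in\mathbb{Z}}B_i$ be the induced $\mathbb{Z}$-grading of $B$ with degree function $\deg$. Let $A=\ker D$ and $\Omega=\ker U$ and, for each $n\in\mathbb{Z}$, define $A_n=A\cap B_n$ and $\Omega_n=\Omega\cap B_n$. For each $n\ge 0$ define $\mathcal{F}_n=\ker D^{n+1}$ and $I_n=D^n(\mathcal{F}_n)$ (an ideal of $A$). (a) $A$ is affine (finitely generated as a $k$-algebra). (b) $I_n=\bigoplus_{i\ge n}A_i$ for each $n\ge 0$. In particular, $A=\bigoplus_{i\in\mathbb{N}}A_i$ is $\mathbb{N}$-graded. (c) Let $f_1,\ldots,f_r\in A$ be homogeneous such that $I_1=(f_1,\ldots,f_r)$, and set $m=\max_i\deg f_i$. Then: (i) $A=A_0[f_1,\ldots,f_r]$; (ii) given $n\ge 1$, $I_n$ is the ideal of $A$ generated by $A_n\cup A_{n+1}\cup\cdots\cup A_{n+m-1}$; (iii) given $n>m$, $I_n=\sum_{(e_1,\ldots,e_m)\in E} I_1^{e_1}\cdots I_m^{e_m}$, where $E=\{(e_1,\ldots,e_m)\in\mathbb{N}^m \mid \sum_i i\,e_i=n\}$. (d) Given $n\ge 1$, assume that $I_n=(g_1,\ldots,g_s)$ for homogeneous $g_i\in A$ and set $h_i=U^ng_i$, $1\le i\le s$. Then $\mathcal{F}_n=Ah_1+\cdots+Ah_s+\mathcal{F}_{n-1}$. (e) $B=\Omega\oplus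 DB=A\oplus UB$ as $A_0$-modules. (f) $D:B_n\to B_{n+2}$ is injective if $n\le -1$ and surjective if $n\ge -1$. (g) $B_0=A_0\oplus M$ as $A_0$-modules, where $M=DB_{-2}=UB_2$.
   Context: An affine $k$-domain is an integral domain containing $k$ that is finitely generated as a $k$-algebra. $\mathbb{N}$ denotes the non-negative integers. For a $k$-domain $B$, ${\rm LND}(B)$ is the set of locally nilpotent derivations of $B$: derivations $D$ such that for each $b\in B$ there is $n\in\mathbb{N}$ with $D^nb=0$ (these are automatically $k$-linear). Write $[D,U]=DU-UD$. A pair $(D,U)\in{\rm LND}(B)^2$ is a fundamental pair for $B$ if (1) $[D,[D,U]]=-2D$ and $[U,[D,U]]=2U$; and (2) $B=\sum_{d\in\mathbb{Z}}B_d$ where $B_d=\ker([D,U]-dI)$, $I$ being the identity operator. The pair is trivial if $D=U=0$ and nontrivial otherwise. For a fundamental pair, $B=\bigoplus_{d\in\mathbb{Z}}B_d$ is a $\mathbb{Z}$-grading of the ring $B$, called the $\mathbb{Z}$-grading induced by $(D,U)$, for which $D$ and $U$ are homogeneous with $\deg D=2$ and $\deg U=-2$. *)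

theory Defs
  imports Complex_Main
begin

text \<open>
  Rings are types of class \<^class>\<open>idom\<close>; their subrings, ideals, modules are sets.
  A \<open>k\<close>-domain is a type \<open>'b::idom\<close> with a scalar multiplication by the field \<open>'k\<close>;
  it contains \<open>k\<close> through the (automatically injective) map sending \<open>c\<close> to \<open>scale c 1\<close>.
\<close>

definition k_domain :: "('k::field \<Rightarrow> 'b::idom \<Rightarrow> 'b) \<Rightarrow> bool" where
  "k_domain scale \<longleftrightarrow> vector_space scale \<and> (\<forall>c x y. scale c (x * y) = scale c x * y)"

definition is_subring :: "'b::comm_ring_1 set \<Rightarrow> bool" where
  "is_subring S \<longleftrightarrow> 1 \<in> S \<and> (\<forall>x\<in>S. \<forall>y\<in>S. x - y \<in> S \<and> x * y \<in> S)"

definition is_subalgebra :: "('k \<Rightarrow> 'b::comm_ring_1 \<Rightarrow> 'b) \<Rightarrow> 'b set \<Rightarrow> bool" where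
  "is_subalgebra scale S \<longleftrightarrow> is_subring S \<and> (\<forall>c. \<forall>x\<in>S. scale c x \<in> S)"

definition fin_gen_algebra :: "('k \<Rightarrow> 'b::comm_ring_1 \<Rightarrow> 'b) \<Rightarrow> 'b set \<Rightarrow> bool" where
  "fin_gen_algebra scale S \<longleftrightarrow> (\<exists>G. finite G \<and> S = is_subalgebra scale hull G)"

definition adjoin :: "'b::comm_ring_1 set \<Rightarrow> 'b set \<Rightarrow> 'b set" where
  "adjoin R G = is_subring hull (R \<union> G)"

text \<open>Here \<open>R\<close> is meant to be a subring, so submodules are closed under negation.\<close>

definition is_submodule :: "'b::comm_ring_1 set \<Rightarrow> 'b set \<Rightarrow> bool" where
  "is_submodule R M \<longleftrightarrow>
     0 \<in> M \<and> (\<forall>x\<in>M. \<forall>y\<in>M. x + y \<in> M) \<and> (\<forall>a\<in>R. \<forall>x\<in>M. a * x \<in> M)"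

definition is_ideal :: "'b::comm_ring_1 set \<Rightarrow> 'b set \<Rightarrow> bool" where
  "is_ideal R J \<longleftrightarrow> J \<subseteq> R \<and> is_submodule R J"

definition ideal_gen :: "'b::comm_ring_1 set \<Rightarrow> 'b set \<Rightarrow> 'b set" where
  "ideal_gen R G = is_ideal R hull G"

definition ideal_mult :: "'b::comm_ring_1 set \<Rightarrow> 'b set \<Rightarrow> 'b set \<Rightarrow> 'b set" where
  "ideal_mult R J L = ideal_gen R {x * y | x y. x \<in> J \<and> y \<in> L}"

primrec ideal_pow :: "'b::comm_ring_1 set \<Rightarrow> 'b set \<Rightarrow> nat \<Rightarrow> 'b set" where
  "ideal_pow R J 0 = R"
| "ideal_pow R J (Suc n) = ideal_mult R (ideal_pow R J n) J"

text \<open>The product of the powers of \<open>J 1, \<dots>, J m\<close> with exponents \<open>e 1, \<dots>, e m\<close>.\<close>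

primrec ideal_monomial ::
  "'b::comm_ring_1 set \<Rightarrow> (nat \<Rightarrow> 'b set) \<Rightarrow> (nat \<Rightarrow> nat) \<Rightarrow> nat \<Rightarrow> 'b set" where
  "ideal_monomial R J e 0 = R"
| "ideal_monomial R J e (Suc m) =
     ideal_mult R (ideal_monomial R J e m) (ideal_pow R (J (Suc m)) (e (Suc m)))"

definition sum_of :: "'i set \<Rightarrow> ('i \<Rightarrow> 'b::comm_ring_1 set) \<Rightarrow> 'b set" where
  "sum_of X F = {sum f S | f S. finite S \<and> S \<subseteq> X \<and> (\<forall>i\<in>S. f i \<in> F i)}"

definition direct_sum_of ::
  "'b::comm_ring_1 set \<Rightarrow> 'b set \<Rightarrow> 'i set \<Rightarrow> ('i \<Rightarrow> 'b set) \<Rightarrow> bool" where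
  "direct_sum_of R V X F \<longleftrightarrow>
     (\<forall>i\<in>X. is_submodule R (F i)) \<and> V = sum_of X F \<and>
     (\<forall>f S. finite S \<longrightarrow> S \<subseteq> X \<longrightarrow> (\<forall>i\<in>S. f i \<in> F i) \<longrightarrow> sum f S = 0 \<longrightarrow> (\<forall>i\<in>S. f i = 0))"

definition direct_sum2 ::
  "'b::comm_ring_1 set \<Rightarrow> 'b set \<Rightarrow> 'b set \<Rightarrow> 'b set \<Rightarrow> bool" where
  "direct_sum2 R V M N \<longleftrightarrow>
     is_submodule R M \<and> is_submodule R N \<and> V = {x + y | x y. x \<in> M \<and> y \<in> N} \<and> M \<inter> N = {0}"

text \<open>Direct sums in a grading are direct sums of abelian groups, that is, over \<open>\<int>\<close>.\<close>

definition nat_graded :: "'b::comm_ring_1 set \<Rightarrow> (nat \<Rightarrow> 'b set) \<Rightarrow> bool" where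
  "nat_graded R F \<longleftrightarrow> direct_sum_of \<int> R UNIV F \<and>
     (\<forall>i j. \<forall>x\<in>F i. \<forall>y\<in>F j. x * y \<in> F (i + j))"

text \<open>Derivations are not required to be \<open>k\<close>-linear: locally nilpotent ones are so automatically.\<close>

definition derivation :: "('b::comm_ring_1 \<Rightarrow> 'b) \<Rightarrow> bool" where
  "derivation D \<longleftrightarrow>
     (\<forall>x y. D (x + y) = D x + D y) \<and> (\<forall>x y. D (x * y) = D x * y + x * D y)"

definition LND :: "('b::comm_ring_1 \<Rightarrow> 'b) set" where
  "LND = {D. derivation D \<and> (\<forall>b. \<exists>n. (D ^^ n) b = 0)}"

definition bracket :: "('b::comm_ring_1 \<Rightarrow> 'b) \<Rightarrow> ('b \<Rightarrow> 'b) \<Rightarrow> 'b \<Rightarrow> 'b" where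
  "bracket D U = (\<lambda>b. D (U b) - U (D b))"

definition Ker :: "('b::comm_ring_1 \<Rightarrow> 'b) \<Rightarrow> 'b set" where
  "Ker D = {b. D b = 0}"

definition grad_comp :: "('b::comm_ring_1 \<Rightarrow> 'b) \<Rightarrow> ('b \<Rightarrow> 'b) \<Rightarrow> int \<Rightarrow> 'b set" where
  "grad_comp D U d = Ker (\<lambda>b. bracket D U b - of_int d * b)"

definition fundamental_pair :: "('b::comm_ring_1 \<Rightarrow> 'b) \<Rightarrow> ('b \<Rightarrow> 'b) \<Rightarrow> bool" where
  "fundamental_pair D U \<longleftrightarrow> D \<in> LND \<and> U \<in> LND \<and>
     bracket D (bracket D U) = (\<lambda>b. - 2 * D b) \<and>
     bracket U (bracket D U) = (\<lambda>b. 2 * U b) \<and>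
     UNIV = sum_of UNIV (grad_comp D U)"

definition trivial_pair :: "('b::comm_ring_1 \<Rightarrow> 'b) \<Rightarrow> ('b \<Rightarrow> 'b) \<Rightarrow> bool" where
  "trivial_pair D U \<longleftrightarrow> D = (\<lambda>_. 0) \<and> U = (\<lambda>_. 0)"

text \<open>Zero counts as homogeneous. The degree below is only meaningful for nonzero homogeneous
  elements (the convention being that zero has degree minus infinity).\<close>

definition homogeneous :: "(int \<Rightarrow> 'b set) \<Rightarrow> 'b \<Rightarrow> bool" where
  "homogeneous F b \<longleftrightarrow> (\<exists>d. b \<in> F d)"

definition hdeg :: "(int \<Rightarrow> 'b set) \<Rightarrow> 'b \<Rightarrow> int" where
  "hdeg F b = (THE d. b \<in> F d)"

end

theory Submission
  imports
    Defs
    "HOL-Library.Poly_Mapping"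
    "HOL-Library.Product_Plus"
    "HOL-Computational_Algebra.Polynomial"
begin

text \<open>
The relations between \<open>D\<close>, \<open>U\<close> and their bracket are those of the Lie algebra \<open>sl\<^sub>2\<close>, so that
\<open>B\<close> is a representation in which \<open>D\<close> raises the weight by 2, \<open>U\<close> lowers it by 2, and the bracket
acts on \<open>B\<^sub>n\<close> as multiplication by \<open>n\<close>. The kernel \<open>A\<close> of \<open>D\<close> consists of the highest weight vectors.

All linear statements hold in every graded module with two such locally nilpotent operators
(locale \<open>weight_module\<close>). Nothing about irreducible representations enters: the single source
is the formula \<open>funpow_D_U\<close> for \<open>D\<^sup>j\<^sup>+\<^sup>1 U\<close>. It says that on the vectors of weight \<open>m\<close> killed by
\<open>D\<^sup>j\<^sup>+\<^sup>1\<close> the operator \<open>DU\<close> agrees with the scalar \<open>(j + 1)(m + j)\<close> up to vectors killed by \<open>D\<^sup>j\<close>.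
Hence \<open>DU\<close> is bijective in positive weights, which together with the same fact for \<open>UD\<close> in
negative weights yields the injectivity and surjectivity of \<open>D\<close>, and \<open>UD\<close> splits \<open>B\<close> into \<open>A\<close> and
the image of \<open>U\<close>. The same recursion shows that \<open>D\<^sup>n\<close> hits a nonzero highest weight vector of weight \<open>i\<close> precisely when \<open>i\<close> is at least \<open>n\<close>. So the
ideal \<open>I\<^sub>n\<close> consists of the elements of \<open>A\<close> without components of degree below \<open>n\<close>
(\<open>in_image_ideal_iff\<close>), and the statements on generators of \<open>A\<close> and of \<open>I\<^sub>n\<close> become inductions on
the degree in a graded ring, in the style of the graded Nakayama lemma.

That \<open>A\<close> is finitely generated is Hilbert's theorem on covariants. The unipotent group belonging to
\<open>D\<close> is not reductive, so there need not be an \<open>A\<close>-linear projection of \<open>B\<close> onto \<open>A\<close>. The remedy is to pass from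
\<open>A\<close> to invariants of \<open>sl\<^sub>2\<close> in \<open>B[x, y]\<close>: a highest weight vector \<open>a\<close> of weight \<open>d\<close> is the
constant coefficient of the form \<open>exp (- X U) a\<close> of degree \<open>d\<close>, written here with \<open>y = 1\<close>, which is
killed by the operators \<open>D + d X - X\<^sup>2 d/dX\<close> and \<open>U + d/dX\<close> (\<open>poly_D_covariant\<close>,
\<open>poly_U_covariant\<close>). Filter \<open>B\<close> by the length of products of finitely many homogeneous generators
whose span is stable under \<open>D\<close> and \<open>U\<close>. The associated Rees algebra of \<open>B[x, y]\<close> is finitely
generated, hence Noetherian, and so finitely many covariants generate the ideal spanned by all
covariants of positive total degree (\<open>graded_ideal_finite_basis\<close>). The coefficients in such
a representation can be replaced by elements killed by \<open>D + d X - X\<^sup>2 d/dX\<close>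
(\<open>invariant_coefficients\<close>): write each of them as \<open>s + U (D y)\<close> with \<open>s\<close> a highest weight vector; the
terms \<open>U (D y)\<close> add up to an element in the image of \<open>U\<close> and in the kernel of \<open>D\<close>, which is zero.
This takes the place of the Reynolds operator. Comparing constant coefficients and descending in
the total degree, \<open>A\<close> is generated by the constant coefficients of the chosen covariants.
\<close>

section \<open>Weight modules of raising and lowering operators\<close>

lemma last_nonzero_iterate:
  fixes d :: "'a::zero \<Rightarrow> 'a"
  assumes "(d ^^ k) x = 0" "x \<noteq> 0"
  obtains j where "(d ^^ j) x \<noteq> 0" "(d ^^ Suc j) x = 0"
proof -
  define l where "l = (LEAST k. (d ^^ k) x = 0)"
  have l: "(d ^^ l) x = 0" unfolding l_def by (rule LeastI[of _ k]) (rule assms(1))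
  then have "l \<noteq> 0" using assms(2) by (cases "l = 0") auto
  then obtain j where j: "l = Suc j" using not0_implies_Suc by blast
  have "(d ^^ j) x \<noteq> 0"
    using not_less_Least[of j "\<lambda>k. (d ^^ k) x = 0"] j unfolding l_def by simp
  then show thesis using that l j by blast
qed

text \<open>
The weight spaces \<open>M n\<close> are assumed neither to be independent nor to span, and apart from linearity
the operators are controlled on them only. This is the generality needed for the operators on
polynomials below, one of which is locally nilpotent only on polynomials of bounded degree.
\<close>

locale weight_module = vector_space scale
  for scale :: "'k::field_char_0 \<Rightarrow> 'v::ab_group_add \<Rightarrow> 'v" +
  fixes M :: "int \<Rightarrow> 'v set" and D U :: "'v \<Rightarrow> 'v"
  assumes subspace_M: "subspace (M n)"
    and linear_D: "Vector_Spaces.linear scale scale D"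
    and linear_U: "Vector_Spaces.linear scale scale U"
    and D_M: "x \<in> M n \<Longrightarrow> D x \<in> M (n + 2)"
    and U_M: "x \<in> M n \<Longrightarrow> U x \<in> M (n - 2)"
    and commutator: "x \<in> M n \<Longrightarrow> D (U x) = U (D x) + scale (of_int n) x"
    and D_nilpotent: "x \<in> M n \<Longrightarrow> \<exists>j. (D ^^ j) x = 0"
    and U_nilpotent: "x \<in> M n \<Longrightarrow> \<exists>j. (U ^^ j) x = 0"
begin

text \<open>
Exchanging the two operators and negating the weights turns every lemma about \<open>D\<close> into one
about \<open>U\<close>.
\<close>

lemma swap: "weight_module scale (\<lambda>n. M (- n)) U D"
proof (intro weight_module.intro vector_space_axioms weight_module_axioms.intro)
  fix x n
  assume x: "x \<in> M (- n)"
  show "U x \<in> M (- (n + 2))" using U_M[OF x] by (simp add: algebra_simps)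
  show "D x \<in> M (- (n - 2))" using D_M[OF x] by (simp add: algebra_simps)
  show "U (D x) = D (U x) + scale (of_int n) x"
    using commutator[OF x] by (simp add: algebra_simps)
qed (use subspace_M linear_D linear_U D_nilpotent U_nilpotent in auto)

sublocale D: Vector_Spaces.linear scale scale D by (rule linear_D)
sublocale U: Vector_Spaces.linear scale scale U by (rule linear_U)

lemma linear_funpow_D: "Vector_Spaces.linear scale scale (D ^^ j)"
proof (induction j)
  case 0
  show ?case by (simp add: id_def linear_id[unfolded id_def])
next
  case (Suc j)
  then show ?case
    using Vector_Spaces.linear_compose[OF Suc linear_D] by (simp add: comp_def)
qed

sublocale D_pow: Vector_Spaces.linear scale scale "D ^^ j" for j
  by (rule linear_funpow_D)

lemma funpow_D_M: "x \<in> M n \<Longrightarrow> (D ^^ j) x \<in> M (n + 2 * int j)"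
proof (induction j)
  case (Suc j)
  then have "D ((D ^^ j) x) \<in> M (n + 2 * int j + 2)" by (intro D_M) simp
  then show ?case by (simp add: algebra_simps)
qed simp

text \<open>
Moving \<open>U\<close> past \<open>j + 1\<close> factors \<open>D\<close> collects the weights \<open>m, m + 2, \<dots>, m + 2j\<close> of the vectors
\<open>D\<^sup>i x\<close>; they add up to \<open>(j + 1)(m + j)\<close>.
\<close>

lemma funpow_D_U:
  assumes "x \<in> M m"
  shows "(D ^^ Suc j) (U x) =
    U ((D ^^ Suc j) x) + scale (of_int ((int j + 1) * (m + int j))) ((D ^^ j) x)"
proof (induction j)
  case 0
  then show ?case using commutator[OF assms] by simp
next
  case (Suc j)
  let ?y = "(D ^^ Suc j) x"
  have "(D ^^ Suc (Suc j)) (U x) = D ((D ^^ Suc j) (U x))" by simp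
  also have "\<dots> = D (U ?y) + scale (of_int ((int j + 1) * (m + int j))) ?y"
    by (subst funpow.simps, subst comp_apply, simp only: Suc D.add D.scale)
  also have "D (U ?y) = U (D ?y) + scale (of_int (m + 2 * int (Suc j))) ?y"
    by (rule commutator[OF funpow_D_M[OF assms]])
  also have "\<dots> + scale (of_int ((int j + 1) * (m + int j))) ?y
      = U (D ?y) + scale (of_int (m + 2 * int (Suc j)) + of_int ((int j + 1) * (m + int j))) ?y"
    by (simp only: scale_left_distrib add.assoc)
  also have "(of_int (m + 2 * int (Suc j)) + of_int ((int j + 1) * (m + int j)) :: 'k)
      = of_int ((int (Suc j) + 1) * (m + int (Suc j)))"
    unfolding of_int_add[symmetric] by (simp add: algebra_simps)
  finally show ?case by simp
qed

lemma funpow_D_UD: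
  assumes x: "x \<in> M m"
  shows "(D ^^ j) (U (D x)) =
    U ((D ^^ Suc j) x) + scale (of_int (int j * (m + int j + 1))) ((D ^^ j) x)"
proof (cases j)
  case (Suc i)
  show ?thesis
    unfolding Suc using funpow_D_U[OF D_M[OF x], of i]
    by (simp add: funpow_swap1 algebra_simps)
qed simp

lemma last_nonzero_D:
  assumes "x \<in> M n" "x \<noteq> 0"
  obtains j where "(D ^^ j) x \<noteq> 0" "(D ^^ Suc j) x = 0"
  using D_nilpotent[OF assms(1)] last_nonzero_iterate assms(2) by blast

text \<open>
If \<open>D\<^sup>j x\<close> is the last nonzero iterate, then \<open>D\<^sup>j\<close> maps \<open>D (U x)\<close> to \<open>(j + 1)(m + j) D\<^sup>j x\<close>, which does
not vanish in positive weight.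
\<close>

lemma DU_injective:
  assumes x: "x \<in> M m" and m: "m \<ge> 1" and 0: "D (U x) = 0"
  shows "x = 0"
proof (rule ccontr)
  assume "x \<noteq> 0"
  then obtain j where j: "(D ^^ j) x \<noteq> 0" "(D ^^ Suc j) x = 0"
    using last_nonzero_D[OF x] by blast
  have "(D ^^ Suc j) (U x) = (D ^^ j) (D (U x))" by (simp add: funpow_swap1)
  then have "scale (of_int ((int j + 1) * (m + int j))) ((D ^^ j) x) = 0"
    using funpow_D_U[OF x, of j] j(2) 0 by (simp only: D_pow.zero U.zero add_0)
  then have "(of_int ((int j + 1) * (m + int j)) :: 'k) = 0"
    using j(1) by (simp only: scale_eq_0_iff) simp
  then show False using m by (simp only: of_int_eq_0_iff) simp
qed

text \<open>
On vectors killed by \<open>D\<^sup>j\<^sup>+\<^sup>1\<close> the operator \<open>DU\<close> is a nonzero scalar \<open>q\<close> modulo vectors killed by \<open>D\<^sup>j\<close>.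
So \<open>x\<close> differs from \<open>D (U x) / q\<close> by a vector that lies in the image by induction on \<open>j\<close>.
\<close>

lemma DU_surjective:
  assumes "x \<in> M m" and m: "m \<ge> 1"
  shows "\<exists>y \<in> M m. x = D (U y)"
proof -
  obtain j where "(D ^^ j) x = 0" using D_nilpotent[OF assms(1)] by blast
  then show ?thesis using assms(1)
  proof (induction j arbitrary: x)
    case 0
    then show ?case using subspace_0[OF subspace_M] by (intro bexI[of _ 0]) auto
  next
    case (Suc j)
    define q :: 'k where "q = of_int ((int j + 1) * (m + int j))"
    have q: "q \<noteq> 0" unfolding q_def using m by (simp only: of_int_eq_0_iff) simp
    define c where "c = D (U x) - scale q x"
    have DUx: "D (U x) \<in> M m" using D_M[OF U_M[OF Suc.prems(2)]] by simp
    have c: "c \<in> M m"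
      unfolding c_def by (intro subspace_diff subspace_scale subspace_M DUx Suc.prems(2))
    have "(D ^^ j) (D (U x)) = (D ^^ Suc j) (U x)" by (simp add: funpow_swap1)
    also have "\<dots> = scale q ((D ^^ j) x)"
      using funpow_D_U[OF Suc.prems(2), of j] Suc.prems(1) by (simp only: q_def U.zero add_0)
    finally have "(D ^^ j) c = 0" unfolding c_def D_pow.diff D_pow.scale by simp
    then obtain y where y: "y \<in> M m" "c = D (U y)" using Suc.IH[OF _ c] by blast
    have "D (U (scale (inverse q) (x - y))) = scale (inverse q) (D (U x) - D (U y))"
      by (simp add: D.scale U.scale D.diff U.diff)
    also have "\<dots> = scale (inverse q) (scale q x)" using y(2) unfolding c_def by (simp add: algebra_simps del: scale_scale)
    also have "\<dots> = x" using q by simp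
    finally show ?case
      by (intro bexI[of _ "scale (inverse q) (x - y)"] subspace_scale subspace_diff subspace_M
          Suc.prems y) simp
  qed
qed

text \<open>
The same recursion for \<open>UD\<close>, whose scalar on the layer \<open>j\<close> is \<open>j (m + j + 1)\<close>: it vanishes only for
\<open>j = 0\<close>, that is, on the highest weight vectors, which therefore remain as a complement.
\<close>

lemma highest_plus_UD:
  assumes "x \<in> M m" and m: "m \<ge> 0"
  shows "\<exists>a \<in> M m. \<exists>y \<in> M m. D a = 0 \<and> x = a + U (D y)"
proof -
  obtain j where "(D ^^ j) x = 0" using D_nilpotent[OF assms(1)] by blast
  then have "(D ^^ Suc j) x = 0" by (simp add: D.zero)
  then show ?thesis using assms(1)
  proof (induction j arbitrary: x)
    case 0
    then show ?case using subspace_0[OF subspace_M]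
      by (intro bexI[of _ x] bexI[of _ 0]) auto
  next
    case (Suc j)
    define q :: 'k where "q = of_int (int (Suc j) * (m + int (Suc j) + 1))"
    have q: "q \<noteq> 0" unfolding q_def using m by (simp only: of_int_eq_0_iff) simp
    define c where "c = U (D x) - scale q x"
    have UDx: "U (D x) \<in> M m" using U_M[OF D_M[OF Suc.prems(2)]] by simp
    have c: "c \<in> M m"
      unfolding c_def by (intro subspace_diff subspace_scale subspace_M UDx Suc.prems(2))
    have "(D ^^ Suc j) (U (D x)) = scale q ((D ^^ Suc j) x)"
      using funpow_D_UD[OF Suc.prems(2), of "Suc j"] Suc.prems(1)
      by (simp only: q_def U.zero add_0)
    then have "(D ^^ Suc j) c = 0" unfolding c_def D_pow.diff D_pow.scale by simp
    then obtain a y where y: "a \<in> M m" "y \<in> M m" "D a = 0" "c = a + U (D y)"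
      using Suc.IH[OF _ c] by blast
    have "scale q x = scale q (scale (- inverse q) a + U (D (scale (inverse q) (x - y))))"
      using q y(4) unfolding c_def
      by (simp add: scale_right_distrib D.scale U.scale D.diff U.diff algebra_simps)
    then have "x = scale (- inverse q) a + U (D (scale (inverse q) (x - y)))"
      using q by simp
    moreover have "D (scale (- inverse q) a) = 0" using y(3) by (simp only: D.scale scale_zero_right)
    ultimately show ?case
      by (intro bexI[of _ "scale (- inverse q) a"] bexI[of _ "scale (inverse q) (x - y)"]
          subspace_scale subspace_diff subspace_M Suc.prems y conjI)
  qed
qed

text \<open>
In an irreducible representation with highest weight \<open>h\<close> a vector of weight \<open>w\<close> is killed by \<open>D\<^sup>j\<close> only
if \<open>w + 2 j > h\<close>, while \<open>h \<ge> - w\<close>, so that \<open>w > - j\<close>. Without decomposing: by induction \<open>x\<close> is an eigenvector of \<open>UD\<close>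
with an eigenvalue \<open>\<le> 0\<close>, whereas the last nonzero \<open>U\<^sup>p x\<close> forces this eigenvalue to be
\<open>(p + 1)(p - w) > 0\<close>.
\<close>

lemma funpow_D_injective_low_weight:
  assumes "x \<in> M w" "w \<le> - int j" "(D ^^ j) x = 0"
  shows "x = 0"
  using assms
proof (induction j arbitrary: x)
  case (Suc j)
  interpret swap: weight_module scale "\<lambda>n. M (- n)" U D by (rule swap)
  define q where "q = int j * (w + int j + 1)"
  define c where "c = U (D x) - scale (of_int q) x"
  have UDx: "U (D x) \<in> M w" using U_M[OF D_M[OF Suc.prems(1)]] by simp
  have c: "c \<in> M w"
    unfolding c_def by (intro subspace_diff subspace_scale subspace_M UDx Suc.prems)
  have "(D ^^ j) (U (D x)) = scale (of_int q) ((D ^^ j) x)"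
    using funpow_D_UD[OF Suc.prems(1), of j] Suc.prems(3) by (simp only: q_def U.zero add_0)
  then have "(D ^^ j) c = 0" unfolding c_def D_pow.diff D_pow.scale by simp
  then have "c = 0" using Suc.IH[OF c] Suc.prems by simp
  then have UD: "U (D x) = scale (of_int q) x" unfolding c_def by simp
  show ?case
  proof (rule ccontr)
    assume "x \<noteq> 0"
    moreover have x: "x \<in> M (- (- w))" using Suc.prems by simp
    ultimately obtain p where p: "(U ^^ p) x \<noteq> 0" "(U ^^ Suc p) x = 0"
      using swap.last_nonzero_D by blast
    have "(U ^^ Suc p) (D x) = (U ^^ p) (scale (of_int q) x)"
      by (simp only: funpow_Suc_right comp_def UD)
    then have "scale (of_int q) ((U ^^ p) x)
        = scale (of_int ((int p + 1) * (- w + int p))) ((U ^^ p) x)"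
      using swap.funpow_D_U[OF x, of p] p(2) by (simp only: swap.D_pow.scale D.zero add_0)
    then have "(of_int q :: 'k) = of_int ((int p + 1) * (- w + int p))"
      using p(1) by (simp only: scale_cancel_right) simp
    then have eq: "q = (int p + 1) * (- w + int p)" by (simp only: of_int_eq_iff)
    have "q \<le> 0" unfolding q_def using Suc.prems(2) by (intro mult_nonneg_nonpos) auto
    moreover have "(int p + 1) * (- w + int p) > 0"
      using Suc.prems(2) by (intro mult_pos_pos) auto
    ultimately show False using eq by simp
  qed
qed simp

lemma D_injective_negative:
  assumes "x \<in> M m" "m \<le> -1" "D x = 0"
  shows "x = 0"
  using funpow_D_injective_low_weight[of x m 1] assms by simp

lemma D_U_highest:
  assumes a: "a \<in> M n" "D a = 0"
  shows "D ((U ^^ Suc j) a) = scale (of_int ((int j + 1) * (n - int j))) ((U ^^ j) a)"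
proof -
  interpret swap: weight_module scale "\<lambda>n. M (- n)" U D by (rule swap)
  have "0 = D ((U ^^ Suc j) a) + scale (of_int ((int j + 1) * (- n + int j))) ((U ^^ j) a)"
    using swap.funpow_D_U[of a "- n" j] a by (simp add: swap.D_pow.zero del: funpow.simps)
  also have "(int j + 1) * (- n + int j) = - ((int j + 1) * (n - int j))"
    by (simp add: algebra_simps)
  finally show ?thesis by (simp only: of_int_minus scale_minus_left) simp
qed

text \<open>
The vector \<open>U\<^sup>n\<^sup>+\<^sup>1 a\<close> is again killed by \<open>D\<close>, but its weight \<open>- n - 2\<close> is negative.
\<close>

lemma funpow_U_highest_eq_0:
  assumes a: "a \<in> M (int n)" "D a = 0"
  shows "(U ^^ Suc n) a = 0"
proof -
  interpret swap: weight_module scale "\<lambda>n. M (- n)" U D by (rule swap)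
  have "(U ^^ Suc n) a \<in> M (- (- int n + 2 * int (Suc n)))"
    by (rule swap.funpow_D_M) (use a in simp)
  then show ?thesis
    by (rule D_injective_negative) (simp_all add: D_U_highest[OF a, of n] del: funpow.simps)
qed

lemma funpow_D_U_highest:
  assumes a: "a \<in> M i" "D a = 0" and i: "int n \<le> i"
  shows "\<exists>c. c \<noteq> 0 \<and> (D ^^ n) ((U ^^ n) a) = scale c a"
  using i
proof (induction n)
  case 0
  then show ?case by (intro exI[of _ 1]) auto
next
  case (Suc n)
  then obtain c where c: "c \<noteq> 0" "(D ^^ n) ((U ^^ n) a) = scale c a" by auto
  define q :: 'k where "q = of_int ((int n + 1) * (i - int n))"
  have q: "q \<noteq> 0" unfolding q_def using Suc.prems by (simp only: of_int_eq_0_iff) simp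
  have "(D ^^ Suc n) ((U ^^ Suc n) a) = (D ^^ n) (D ((U ^^ Suc n) a))"
    by (simp only: funpow_Suc_right comp_def)
  also have "\<dots> = scale (q * c) a"
    by (simp only: D_U_highest[OF a] D_pow.scale c(2) q_def[symmetric] scale_scale)
  finally show ?case using c(1) q by (intro exI[of _ "q * c"]) auto
qed

end

section \<open>Noetherian subrings and the Hilbert basis theorem\<close>

lemma subring_0: "is_subring R \<Longrightarrow> 0 \<in> R"
  unfolding is_subring_def by (metis diff_self)

lemma subring_uminus: "is_subring R \<Longrightarrow> x \<in> R \<Longrightarrow> - x \<in> R"
  using subring_0[of R] unfolding is_subring_def by (metis diff_0)

lemma subring_add: "is_subring R \<Longrightarrow> x \<in> R \<Longrightarrow> y \<in> R \<Longrightarrow> x + y \<in> R"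
  using subring_uminus[of R y] unfolding is_subring_def by (metis diff_minus_eq_add)

lemma subring_diff: "is_subring R \<Longrightarrow> x \<in> R \<Longrightarrow> y \<in> R \<Longrightarrow> x - y \<in> R"
  and subring_mult: "is_subring R \<Longrightarrow> x \<in> R \<Longrightarrow> y \<in> R \<Longrightarrow> x * y \<in> R"
  and subring_1: "is_subring R \<Longrightarrow> 1 \<in> R"
  unfolding is_subring_def by auto

lemma subring_sum: "is_subring R \<Longrightarrow> (\<And>i. i \<in> S \<Longrightarrow> f i \<in> R) \<Longrightarrow> sum f S \<in> R"
  by (induction S rule: infinite_finite_induct) (auto intro: subring_0 subring_add)

lemma subring_power: "is_subring R \<Longrightarrow> x \<in> R \<Longrightarrow> x ^ n \<in> R"
  by (induction n) (auto intro: subring_1 subring_mult)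

lemma is_subringI:
  assumes "1 \<in> R" "\<And>x y. x \<in> R \<Longrightarrow> y \<in> R \<Longrightarrow> x - y \<in> R"
    "\<And>x y. x \<in> R \<Longrightarrow> y \<in> R \<Longrightarrow> x * y \<in> R"
  shows "is_subring R"
  using assms unfolding is_subring_def by blast

lemma subring_hull: "is_subring (is_subring hull G)"
  by (rule hull_in) (auto simp: is_subring_def)

lemma subring_adjoin: "is_subring (adjoin R G)"
  unfolding adjoin_def by (rule subring_hull)

lemma base_subset_adjoin: "R \<subseteq> adjoin R G" and gens_subset_adjoin: "G \<subseteq> adjoin R G"
  unfolding adjoin_def using hull_subset[of "R \<union> G" is_subring] by auto

lemma adjoin_minimal: "R \<subseteq> S \<Longrightarrow> G \<subseteq> S \<Longrightarrow> is_subring S \<Longrightarrow> adjoin R G \<subseteq> S"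
  unfolding adjoin_def by (intro hull_minimal) auto

lemma adjoin_insert: "adjoin R (insert x G) = adjoin (adjoin R G) {x}"
  unfolding adjoin_def using hull_Un_left[of is_subring "R \<union> G" "{x}"] by (simp add: Un_assoc)

lemma submodule_0: "is_submodule R J \<Longrightarrow> 0 \<in> J"
  and submodule_add: "is_submodule R J \<Longrightarrow> x \<in> J \<Longrightarrow> y \<in> J \<Longrightarrow> x + y \<in> J"
  and submodule_mult: "is_submodule R J \<Longrightarrow> a \<in> R \<Longrightarrow> x \<in> J \<Longrightarrow> a * x \<in> J"
  unfolding is_submodule_def by auto

lemma submodule_diff:
  assumes "is_submodule R J" "is_subring R" "x \<in> J" "y \<in> J"
  shows "x - y \<in> J"
proof -
  have "(- 1) * y \<in> J"
    using assms by (intro submodule_mult[of R] subring_uminus subring_1)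
  then show ?thesis using submodule_add[OF assms(1,3)] by fastforce
qed

lemma submodule_sum:
  "is_submodule R J \<Longrightarrow> (\<And>i. i \<in> S \<Longrightarrow> f i \<in> J) \<Longrightarrow> sum f S \<in> J"
  by (induction S rule: infinite_finite_induct) (auto intro: submodule_0 submodule_add)

lemma submodule_ideal: "is_ideal R J \<Longrightarrow> is_submodule R J"
  and ideal_subset: "is_ideal R J \<Longrightarrow> J \<subseteq> R"
  unfolding is_ideal_def by auto

lemma ideal_self: "is_subring R \<Longrightarrow> is_ideal R R"
  unfolding is_ideal_def is_submodule_def by (auto intro: subring_0 subring_add subring_mult)

lemma ideal_ideal_gen:
  assumes "is_subring R" "G \<subseteq> R"
  shows "is_ideal R (ideal_gen R G)"
proof -
  have "ideal_gen R G \<subseteq> R"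
    unfolding ideal_gen_def using assms(2) ideal_self[OF assms(1)] by (rule hull_minimal)
  moreover have "is_submodule R (ideal_gen R G)"
    unfolding ideal_gen_def hull_def is_submodule_def is_ideal_def by auto
  ultimately show ?thesis unfolding is_ideal_def by blast
qed

lemma ideal_gen_minimal: "G \<subseteq> J \<Longrightarrow> is_ideal R J \<Longrightarrow> ideal_gen R G \<subseteq> J"
  unfolding ideal_gen_def by (rule hull_minimal)

lemma subset_ideal_gen: "G \<subseteq> ideal_gen R G"
  unfolding ideal_gen_def by (rule hull_subset)

lemma ideal_gen_mono: "G \<subseteq> H \<Longrightarrow> ideal_gen R G \<subseteq> ideal_gen R H"
  unfolding ideal_gen_def by (rule hull_mono)

lemma ideal_gen_image:
  assumes R: "is_subring R" and S: "finite S" "f ` S \<subseteq> R"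
  shows "ideal_gen R (f ` S) = {\<Sum>i\<in>S. a i * f i | a. \<forall>i\<in>S. a i \<in> R}" (is "_ = ?J")
proof
  have "is_submodule R ?J"
    unfolding is_submodule_def
  proof (intro conjI ballI)
    show "0 \<in> ?J"
      by (rule CollectI, rule exI[of _ "\<lambda>_. 0"]) (simp add: subring_0[OF R])
  next
    fix x y assume "x \<in> ?J" "y \<in> ?J"
    then obtain a b where "x = (\<Sum>i\<in>S. a i * f i)" "y = (\<Sum>i\<in>S. b i * f i)"
      and "\<forall>i\<in>S. a i \<in> R" "\<forall>i\<in>S. b i \<in> R" by blast
    then show "x + y \<in> ?J"
      by (intro CollectI exI[of _ "\<lambda>i. a i + b i"])
        (simp add: sum.distrib algebra_simps subring_add[OF R])
  next
    fix c x assume "c \<in> R" "x \<in> ?J"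
    then obtain a where "x = (\<Sum>i\<in>S. a i * f i)" "\<forall>i\<in>S. a i \<in> R" by blast
    with \<open>c \<in> R\<close> show "c * x \<in> ?J"
      by (intro CollectI exI[of _ "\<lambda>i. c * a i"])
        (simp add: sum_distrib_left algebra_simps subring_mult[OF R])
  qed
  moreover have "?J \<subseteq> R"
    using S(2) by (auto intro!: subring_sum[OF R] subring_mult[OF R])
  moreover have "f ` S \<subseteq> ?J"
  proof (rule image_subsetI)
    fix i assume i: "i \<in> S"
    have "f i = (\<Sum>j\<in>S. (if j = i then 1 else 0) * f j)"
      using S(1) i by (simp add: if_distrib[of "\<lambda>c. c * _"] cong: if_cong)
    then show "f i \<in> ?J"
      by (intro CollectI exI[of _ "\<lambda>j. if j = i then 1 else 0"])
        (simp add: subring_0[OF R] subring_1[OF R])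
  qed
  ultimately show "ideal_gen R (f ` S) \<subseteq> ?J"
    by (intro ideal_gen_minimal) (auto simp: is_ideal_def)
next
  have "is_ideal R (ideal_gen R (f ` S))" using R S(2) by (rule ideal_ideal_gen)
  then have "is_submodule R (ideal_gen R (f ` S))" by (rule submodule_ideal)
  then show "?J \<subseteq> ideal_gen R (f ` S)"
    using subset_ideal_gen[of "f ` S" R]
    by (auto intro!: submodule_sum[of R] submodule_mult[of R])
qed

text \<open>
The elements that need only finitely many generators form an ideal.
\<close>

lemma ideal_gen_finite_support:
  assumes R: "is_subring R" and X: "X \<subseteq> R" and "x \<in> ideal_gen R X"
  shows "\<exists>T. T \<subseteq> X \<and> finite T \<and> x \<in> ideal_gen R T"
proof -
  let ?J = "{x \<in> R. \<exists>T. T \<subseteq> X \<and> finite T \<and> x \<in> ideal_gen R T}"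
  have sub: "is_submodule R (ideal_gen R T)" if "T \<subseteq> X" for T
    using that X by (intro submodule_ideal ideal_ideal_gen R) auto
  have "is_submodule R ?J"
    unfolding is_submodule_def
  proof (intro conjI ballI)
    show "0 \<in> ?J" using submodule_0[OF sub[of "{}"]] subring_0[OF R] by blast
  next
    fix x y assume "x \<in> ?J" "y \<in> ?J"
    then obtain T T' where T: "T \<subseteq> X" "finite T" "x \<in> ideal_gen R T"
      and T': "T' \<subseteq> X" "finite T'" "y \<in> ideal_gen R T'" and xy: "x \<in> R" "y \<in> R" by blast
    have "x \<in> ideal_gen R (T \<union> T')" "y \<in> ideal_gen R (T \<union> T')"
      using T(3) T'(3) ideal_gen_mono[of T "T \<union> T'" R] ideal_gen_mono[of T' "T \<union> T'" R] by auto
    then have "x + y \<in> ideal_gen R (T \<union> T')"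
      using T(1) T'(1) by (intro submodule_add[OF sub]) auto
    moreover have "x + y \<in> R" using R xy by (rule subring_add)
    ultimately show "x + y \<in> ?J" using T(1,2) T'(1,2)
      by (intro CollectI conjI exI[of _ "T \<union> T'"]) auto
  next
    fix a x assume a: "a \<in> R" and "x \<in> ?J"
    then obtain T where T: "T \<subseteq> X" "finite T" "x \<in> ideal_gen R T" and x: "x \<in> R" by blast
    have "a * x \<in> ideal_gen R T" using sub[OF T(1)] a T(3) by (rule submodule_mult)
    then show "a * x \<in> ?J" using T(1,2) subring_mult[OF R a x] by blast
  qed
  then have "is_ideal R ?J" unfolding is_ideal_def by auto
  moreover have "X \<subseteq> ?J"
  proof
    fix x assume "x \<in> X"
    then show "x \<in> ?J" using X subset_ideal_gen[of "{x}" R]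
      by (intro CollectI conjI exI[of _ "{x}"]) auto
  qed
  ultimately have "ideal_gen R X \<subseteq> ?J" by (rule ideal_gen_minimal[rotated])
  then show ?thesis using assms(3) by blast
qed

definition noetherian :: "'b::comm_ring_1 set \<Rightarrow> bool" where
  "noetherian R \<longleftrightarrow> is_subring R \<and>
     (\<forall>J. is_ideal R J \<longrightarrow> (\<exists>G. finite G \<and> G \<subseteq> J \<and> J = ideal_gen R G))"

lemma noetherian_finite_subset:
  assumes R: "noetherian R" and X: "X \<subseteq> R"
  shows "\<exists>T. T \<subseteq> X \<and> finite T \<and> ideal_gen R X = ideal_gen R T"
proof -
  have sR: "is_subring R" using R unfolding noetherian_def by blast
  obtain G where G: "finite G" "G \<subseteq> ideal_gen R X" "ideal_gen R X = ideal_gen R G"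
    using R ideal_ideal_gen[OF sR X] unfolding noetherian_def by blast
  have "\<forall>g\<in>G. \<exists>T. T \<subseteq> X \<and> finite T \<and> g \<in> ideal_gen R T"
    using ideal_gen_finite_support[OF sR X] G(2) by blast
  then obtain T where T: "\<And>g. g \<in> G \<Longrightarrow> T g \<subseteq> X \<and> finite (T g) \<and> g \<in> ideal_gen R (T g)"
    by metis
  let ?T = "\<Union>g\<in>G. T g"
  have TX: "?T \<subseteq> X" using T by blast
  have "G \<subseteq> ideal_gen R ?T"
  proof
    fix g assume g: "g \<in> G"
    then have "ideal_gen R (T g) \<subseteq> ideal_gen R ?T" by (intro ideal_gen_mono) auto
    then show "g \<in> ideal_gen R ?T" using T g by blast
  qed
  then have "ideal_gen R X \<subseteq> ideal_gen R ?T"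
    unfolding G(3) using TX X by (intro ideal_gen_minimal ideal_ideal_gen sR) auto
  then have "ideal_gen R X = ideal_gen R ?T" using ideal_gen_mono[OF TX, of R] by simp
  moreover have "finite ?T" using T G(1) by blast
  ultimately show ?thesis using TX by blast
qed

text \<open>
The values at \<open>x\<close> of the polynomials of degree less than \<open>n\<close> with coefficients in \<open>R\<close>. The element \<open>x\<close>
may be algebraic over \<open>R\<close>, so that neither the degree nor the coefficients of a value are determined.
\<close>

primrec low_order :: "'b::comm_ring_1 set \<Rightarrow> 'b \<Rightarrow> nat \<Rightarrow> 'b set" where
  "low_order R x 0 = {0}"
| "low_order R x (Suc n) = {c * x ^ n + p | c p. c \<in> R \<and> p \<in> low_order R x n}"

context
  fixes R :: "'b::comm_ring_1 set" and x :: 'b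
  assumes R: "is_subring R"
begin

lemma low_order_0: "0 \<in> low_order R x n"
proof (induction n)
  case (Suc n)
  then show ?case using subring_0[OF R] by (simp, intro exI[of _ 0]) simp
qed simp

lemma low_order_SucI: "c \<in> R \<Longrightarrow> p \<in> low_order R x n \<Longrightarrow> c * x ^ n + p \<in> low_order R x (Suc n)"
  by (simp only: low_order.simps) blast

lemma low_order_SucE:
  assumes "p \<in> low_order R x (Suc n)"
  obtains c q where "p = c * x ^ n + q" "c \<in> R" "q \<in> low_order R x n"
  using assms by (simp only: low_order.simps) blast

lemma low_order_diff:
  "p \<in> low_order R x n \<Longrightarrow> q \<in> low_order R x n \<Longrightarrow> p - q \<in> low_order R x n"
proof (induction n arbitrary: p q)
  case (Suc n)
  obtain c p' where p: "p = c * x ^ n + p'" "c \<in> R" "p' \<in> low_order R x n"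
    using Suc.prems(1) by (rule low_order_SucE)
  obtain d q' where q: "q = d * x ^ n + q'" "d \<in> R" "q' \<in> low_order R x n"
    using Suc.prems(2) by (rule low_order_SucE)
  have "p - q = (c - d) * x ^ n + (p' - q')" unfolding p(1) q(1) by (simp add: algebra_simps)
  then show ?case
    using low_order_SucI[OF subring_diff[OF R p(2) q(2)] Suc.IH[OF p(3) q(3)]] by simp
qed simp

lemma low_order_add:
  assumes "p \<in> low_order R x n" "q \<in> low_order R x n"
  shows "p + q \<in> low_order R x n"
  using low_order_diff[OF assms(1) low_order_diff[OF low_order_0 assms(2)]] by simp

lemma low_order_mono:
  assumes "m \<le> n"
  shows "low_order R x m \<subseteq> low_order R x n"
  using assms
proof (induction n rule: dec_induct)
  case (step n)
  have "low_order R x n \<subseteq> low_order R x (Suc n)"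
    using low_order_SucI[OF subring_0[OF R]] by (metis add_0 mult_zero_left subsetI)
  then show ?case using step.IH by blast
qed simp

lemma low_order_mult_monom:
  "p \<in> low_order R x n \<Longrightarrow> c \<in> R \<Longrightarrow> c * x ^ k * p \<in> low_order R x (n + k)"
proof (induction n arbitrary: p)
  case 0
  then show ?case using low_order_0 by simp
next
  case (Suc n)
  obtain d p' where p: "p = d * x ^ n + p'" "d \<in> R" "p' \<in> low_order R x n"
    using Suc.prems(1) by (rule low_order_SucE)
  have "c * x ^ k * p = (c * d) * x ^ (n + k) + c * x ^ k * p'"
    unfolding p(1) by (simp add: algebra_simps power_add)
  then show ?case
    using low_order_SucI[OF subring_mult[OF R Suc.prems(2) p(2)] Suc.IH[OF p(3) Suc.prems(2)]]
    by simp
qed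

lemma low_order_mult:
  "p \<in> low_order R x n \<Longrightarrow> q \<in> low_order R x m \<Longrightarrow> p * q \<in> low_order R x (n + m)"
proof (induction n arbitrary: p)
  case 0
  then show ?case using low_order_0 by simp
next
  case (Suc n)
  obtain d p' where p: "p = d * x ^ n + p'" "d \<in> R" "p' \<in> low_order R x n"
    using Suc.prems(1) by (rule low_order_SucE)
  have "p * q = d * x ^ n * q + p' * q" unfolding p(1) by (simp add: algebra_simps)
  moreover have "d * x ^ n * q \<in> low_order R x (Suc n + m)"
    using low_order_mult_monom[OF Suc.prems(2) p(2), of n] low_order_mono[of "m + n" "Suc n + m"]
    by auto
  moreover have "p' * q \<in> low_order R x (Suc n + m)"
    using Suc.IH[OF p(3) Suc.prems(2)] low_order_mono[of "n + m" "Suc n + m"] by auto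
  ultimately show ?case using low_order_add by metis
qed

lemma const_low_order: "c \<in> R \<Longrightarrow> c \<in> low_order R x (Suc 0)"
  using low_order_SucI[of c 0 0] by simp

lemma adjoin_singleton: "adjoin R {x} = (\<Union>n. low_order R x n)"
proof
  have "is_subring (\<Union>n. low_order R x n)"
  proof (rule is_subringI)
    show "1 \<in> (\<Union>n. low_order R x n)" using const_low_order[OF subring_1[OF R]] by blast
  next
    fix p q assume "p \<in> (\<Union>n. low_order R x n)" "q \<in> (\<Union>n. low_order R x n)"
    then obtain n m where p: "p \<in> low_order R x n" and q: "q \<in> low_order R x m" by blast
    then show "p * q \<in> (\<Union>n. low_order R x n)" using low_order_mult by blast
    have "p \<in> low_order R x (n + m)" "q \<in> low_order R x (n + m)"
      using p q low_order_mono[of n "n + m"] low_order_mono[of m "n + m"] by auto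
    then show "p - q \<in> (\<Union>n. low_order R x n)" using low_order_diff by blast
  qed
  moreover have "x \<in> low_order R x (Suc (Suc 0))"
    using low_order_SucI[OF subring_1[OF R] low_order_0, of 1] by simp
  ultimately show "adjoin R {x} \<subseteq> (\<Union>n. low_order R x n)"
    using const_low_order by (intro adjoin_minimal) blast+
next
  have "low_order R x n \<subseteq> adjoin R {x}" for n
  proof (induction n)
    case 0
    then show ?case using subring_0[OF subring_adjoin] by auto
  next
    case (Suc n)
    show ?case
    proof
      fix p assume "p \<in> low_order R x (Suc n)"
      then obtain c q where p: "p = c * x ^ n + q" "c \<in> R" "q \<in> low_order R x n"
        by (rule low_order_SucE)
      then have "c \<in> adjoin R {x}" "q \<in> adjoin R {x}"
        using Suc.IH base_subset_adjoin[of R "{x}"] by auto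
      then show "p \<in> adjoin R {x}"
        unfolding p(1) using gens_subset_adjoin[of "{x}" R]
        by (intro subring_add subring_mult subring_power subring_adjoin) auto
    qed
  qed
  then show "(\<Union>n. low_order R x n) \<subseteq> adjoin R {x}" by blast
qed

end

text \<open>
Hilbert's proof, for an extension \<open>R[x]\<close> inside a given ring. The ideal \<open>L n\<close> of \<open>R\<close> consists of all
\<open>c\<close> such that some element of \<open>J\<close> can be written as \<open>c x\<^sup>n\<close> plus terms of lower order. This makes sense
although such representations are not unique: an element of \<open>J\<close> is reduced by choosing any of
its representations and lowering the exponent.
\<close>

theorem Hilbert_basis_singleton:
  assumes noeth: "noetherian R"
  shows "noetherian (adjoin R {x})"
proof -
  have R: "is_subring R" using noeth unfolding noetherian_def by blast
  let ?S = "adjoin R {x}"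
  have S: "is_subring ?S" by (rule subring_adjoin)
  have xS: "x \<in> ?S" and RS: "R \<subseteq> ?S"
    using gens_subset_adjoin[of "{x}" R] base_subset_adjoin by auto
  have "\<exists>T. finite T \<and> T \<subseteq> J \<and> J = ideal_gen ?S T" if J: "is_ideal ?S J" for J
  proof -
    have sJ: "is_submodule ?S J" and JS: "J \<subseteq> ?S"
      using J submodule_ideal ideal_subset by blast+
    define L where "L n = {c \<in> R. \<exists>p\<in>low_order R x n. c * x ^ n + p \<in> J}" for n
    have in_L: "c \<in> L n" if "c \<in> R" "p \<in> low_order R x n" "c * x ^ n + p \<in> J" for c p n
      unfolding L_def using that by (intro CollectI conjI bexI[of _ p])
    have from_L: "\<exists>p. p \<in> low_order R x n \<and> c * x ^ n + p \<in> J" "c \<in> R" if "c \<in> L n" for c n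
      using that unfolding L_def by auto
    have LI: "is_ideal R (L n)" for n
      unfolding is_ideal_def is_submodule_def
    proof (intro conjI ballI)
      show "L n \<subseteq> R" unfolding L_def by blast
      show "0 \<in> L n"
        using in_L[OF subring_0[OF R] low_order_0[OF R, of x n]] submodule_0[OF sJ] by simp
    next
      fix c d assume cd: "c \<in> L n" "d \<in> L n"
      obtain p where p: "p \<in> low_order R x n" "c * x ^ n + p \<in> J" using from_L(1)[OF cd(1)] by blast
      obtain q where q: "q \<in> low_order R x n" "d * x ^ n + q \<in> J" using from_L(1)[OF cd(2)] by blast
      have "(c * x ^ n + p) + (d * x ^ n + q) \<in> J" using sJ p(2) q(2) by (rule submodule_add)
      then have "(c + d) * x ^ n + (p + q) \<in> J" by (simp add: algebra_simps)
      then show "c + d \<in> L n"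
        by (rule in_L[OF subring_add[OF R from_L(2)[OF cd(1)] from_L(2)[OF cd(2)]]
              low_order_add[OF R p(1) q(1)]])
    next
      fix a c assume a: "a \<in> R" and c: "c \<in> L n"
      obtain p where p: "p \<in> low_order R x n" "c * x ^ n + p \<in> J" using from_L(1)[OF c] by blast
      have "a * (c * x ^ n + p) \<in> J" using sJ _ p(2) by (rule submodule_mult) (use a RS in auto)
      then have "(a * c) * x ^ n + a * p \<in> J" by (simp add: algebra_simps)
      moreover have "a * p \<in> low_order R x n"
        using low_order_mult_monom[OF R p(1) a, of 0] by simp
      ultimately show "a * c \<in> L n" by (intro in_L[OF subring_mult[OF R a from_L(2)[OF c]]])
    qed
    have L_Suc: "L n \<subseteq> L (Suc n)" for n
    proof
      fix c assume c: "c \<in> L n"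
      obtain p where p: "p \<in> low_order R x n" "c * x ^ n + p \<in> J" using from_L(1)[OF c] by blast
      have "x * (c * x ^ n + p) \<in> J" using sJ xS p(2) by (rule submodule_mult)
      then have "c * x ^ Suc n + x * p \<in> J" by (simp add: algebra_simps)
      moreover have "x * p \<in> low_order R x (Suc n)"
        using low_order_mult_monom[OF R p(1) subring_1[OF R], of 1] by simp
      ultimately show "c \<in> L (Suc n)" by (intro in_L[OF from_L(2)[OF c]])
    qed
    have L_mono: "L m \<subseteq> L n" if "m \<le> n" for m n
      using lift_Suc_mono_le[of L, OF L_Suc that] .
    \<comment> \<open>The ascending chain of the ideals of leading coefficients becomes stationary.\<close>
    obtain G where G: "G \<subseteq> (\<Union>n. L n)" "finite G" "ideal_gen R (\<Union>n. L n) = ideal_gen R G"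
      using noetherian_finite_subset[OF noeth, of "\<Union>n. L n"] ideal_subset[OF LI] by blast
    have "\<exists>N. G \<subseteq> L N" using G(2,1)
    proof (induction G)
      case (insert g G)
      then obtain N n where "G \<subseteq> L N" "g \<in> L n" by auto
      then have "insert g G \<subseteq> L (max N n)"
        using L_mono[of N "max N n"] L_mono[of n "max N n"] by auto
      then show ?case by blast
    qed simp
    then obtain N where N: "G \<subseteq> L N" by blast
    have L_stationary: "L n \<subseteq> L N" for n
    proof -
      have "L n \<subseteq> ideal_gen R (\<Union>n. L n)" using subset_ideal_gen[of "\<Union>n. L n" R] by blast
      also have "\<dots> \<subseteq> L N" unfolding G(3) using N LI by (rule ideal_gen_minimal)
      finally show ?thesis .
    qed
    have "\<exists>T. finite T \<and> T \<subseteq> J \<and>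
        (\<forall>c\<in>L m. \<exists>z\<in>ideal_gen ?S T. z - c * x ^ m \<in> low_order R x m)" for m
    proof -
      obtain Gm where Gm: "finite Gm" "Gm \<subseteq> L m" "L m = ideal_gen R Gm"
        using noeth LI[of m] unfolding noetherian_def by blast
      have "\<exists>z\<in>J. z - c * x ^ m \<in> low_order R x m" if c: "c \<in> Gm" for c
      proof -
        obtain p where "p \<in> low_order R x m" "c * x ^ m + p \<in> J" using from_L(1) c Gm(2) by blast
        then show ?thesis by (intro bexI[of _ "c * x ^ m + p"]) auto
      qed
      then obtain t where t: "\<And>c. c \<in> Gm \<Longrightarrow> t c \<in> J \<and> t c - c * x ^ m \<in> low_order R x m"
        by metis
      have T: "is_submodule ?S (ideal_gen ?S (t ` Gm))"
        using t JS by (intro submodule_ideal ideal_ideal_gen S) auto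
      let ?K = "{c \<in> R. \<exists>z\<in>ideal_gen ?S (t ` Gm). z - c * x ^ m \<in> low_order R x m}"
      have "is_ideal R ?K"
        unfolding is_ideal_def is_submodule_def
      proof (intro conjI ballI)
        show "0 \<in> ?K" using subring_0[OF R] submodule_0[OF T] low_order_0[OF R]
          by (intro CollectI conjI bexI[of _ 0]) auto
      next
        fix c d assume "c \<in> ?K" "d \<in> ?K"
        then obtain y z where y: "c \<in> R" "y \<in> ideal_gen ?S (t ` Gm)" "y - c * x ^ m \<in> low_order R x m"
          and z: "d \<in> R" "z \<in> ideal_gen ?S (t ` Gm)" "z - d * x ^ m \<in> low_order R x m" by blast
        have "(y - c * x ^ m) + (z - d * x ^ m) \<in> low_order R x m"
          using R y(3) z(3) by (rule low_order_add)
        then have "(y + z) - (c + d) * x ^ m \<in> low_order R x m" by (simp add: algebra_simps)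
        then show "c + d \<in> ?K"
          by (intro CollectI conjI bexI[of _ "y + z"] submodule_add[OF T y(2) z(2)]
              subring_add[OF R y(1) z(1)])
      next
        fix a c assume a: "a \<in> R" and "c \<in> ?K"
        then obtain y where y: "c \<in> R" "y \<in> ideal_gen ?S (t ` Gm)"
          "y - c * x ^ m \<in> low_order R x m" by blast
        have "a * (y - c * x ^ m) \<in> low_order R x m"
          using low_order_mult_monom[OF R y(3) a, of 0] by simp
        then have "a * y - (a * c) * x ^ m \<in> low_order R x m" by (simp add: algebra_simps)
        moreover have "a * y \<in> ideal_gen ?S (t ` Gm)"
          using a RS by (intro submodule_mult[OF T _ y(2)]) auto
        ultimately show "a * c \<in> ?K"
          by (intro CollectI conjI bexI[of _ "a * y"] subring_mult[OF R a y(1)])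
      qed blast
      moreover have "Gm \<subseteq> ?K"
        using t subset_ideal_gen[of "t ` Gm" ?S] Gm(2) ideal_subset[OF LI[of m]] by blast
      ultimately have "L m \<subseteq> ?K" unfolding Gm(3) by (intro ideal_gen_minimal)
      then show ?thesis using t Gm(1) by (intro exI[of _ "t ` Gm"]) auto
    qed
    then obtain T where T: "\<And>m. finite (T m)" "\<And>m. T m \<subseteq> J"
      "\<And>m c. c \<in> L m \<Longrightarrow> \<exists>z\<in>ideal_gen ?S (T m). z - c * x ^ m \<in> low_order R x m"
      by metis
    let ?T = "\<Union>m\<le>N. T m"
    have TJ: "?T \<subseteq> J" using T(2) by blast
    have IT: "is_ideal ?S (ideal_gen ?S ?T)" using TJ JS by (intro ideal_ideal_gen S) auto
    have sub: "ideal_gen ?S ?T \<subseteq> J" using TJ J by (rule ideal_gen_minimal)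
    \<comment> \<open>Subtracting a multiple of an element with the same leading coefficient lowers the order.\<close>
    have "y \<in> ideal_gen ?S ?T" if "y \<in> J" "y \<in> low_order R x n" for y n
      using that
    proof (induction n arbitrary: y)
      case 0
      then show ?case using submodule_0[OF submodule_ideal[OF IT]] by simp
    next
      case (Suc n)
      obtain c p where y: "y = c * x ^ n + p" "c \<in> R" "p \<in> low_order R x n"
        using R Suc.prems(2) by (rule low_order_SucE)
      then have "c \<in> L n" using Suc.prems(1) by (intro in_L[of c p]) auto
      define m where "m = min n N"
      have "c \<in> L m" using \<open>c \<in> L n\<close> L_stationary unfolding m_def min_def by auto
      then obtain z where z: "z \<in> ideal_gen ?S (T m)" "z - c * x ^ m \<in> low_order R x m"
        using T(3) by blast
      have "T m \<subseteq> ?T" by (intro UN_upper) (simp add: m_def)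
      then have z': "z \<in> ideal_gen ?S ?T" using z(1) ideal_gen_mono[of "T m" ?T ?S] by auto
      have xz: "x ^ (n - m) * z \<in> ideal_gen ?S ?T"
        using submodule_ideal[OF IT] subring_power[OF S xS] z' by (rule submodule_mult)
      have "x ^ (n - m) * x ^ m = x ^ n" unfolding power_add[symmetric] m_def by simp
      then have "y - x ^ (n - m) * z = p - x ^ (n - m) * (z - c * x ^ m)"
        unfolding y(1) by (simp add: algebra_simps)
      moreover have "x ^ (n - m) * (z - c * x ^ m) \<in> low_order R x n"
        using low_order_mult_monom[OF R z(2) subring_1[OF R], of "n - m"]
        unfolding m_def by simp
      ultimately have "y - x ^ (n - m) * z \<in> low_order R x n"
        using low_order_diff[OF R y(3)] by simp
      moreover have "y - x ^ (n - m) * z \<in> J"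
        using sJ S Suc.prems(1) sub xz by (intro submodule_diff) auto
      ultimately have "y - x ^ (n - m) * z \<in> ideal_gen ?S ?T" by (intro Suc.IH)
      then show ?case using submodule_add[OF submodule_ideal[OF IT] _ xz] by fastforce
    qed
    moreover have "\<exists>n. y \<in> low_order R x n" if "y \<in> J" for y
      using that JS unfolding adjoin_singleton[OF R] by blast
    ultimately have "J = ideal_gen ?S ?T" using sub by blast
    then show ?thesis using TJ T(1) by (intro exI[of _ ?T]) auto
  qed
  then show ?thesis unfolding noetherian_def using S by blast
qed

corollary Hilbert_basis:
  assumes "finite G" "noetherian R"
  shows "noetherian (adjoin R G)"
  using assms
proof (induction G)
  case empty
  then have "adjoin R {} = R"
    unfolding adjoin_def noetherian_def by (simp add: hull_same)
  then show ?case using empty by simp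
next
  case (insert x G)
  then show ?case by (subst adjoin_insert) (intro Hilbert_basis_singleton)
qed

section \<open>Finite bases of ideals generated by homogeneous elements\<close>

lemma noetherian_field:
  assumes K: "is_subring K" and inv: "\<And>x. x \<in> K \<Longrightarrow> x \<noteq> 0 \<Longrightarrow> \<exists>y\<in>K. y * x = 1"
  shows "noetherian K"
  unfolding noetherian_def
proof (intro conjI K allI impI)
  fix J assume J: "is_ideal K J"
  show "\<exists>G. finite G \<and> G \<subseteq> J \<and> J = ideal_gen K G"
  proof (cases "J \<subseteq> {0}")
    case True
    then have "J = {0}" using submodule_0[OF submodule_ideal[OF J]] by blast
    then have "ideal_gen K {} \<subseteq> J" using J by (intro ideal_gen_minimal) auto
    moreover have "0 \<in> ideal_gen K {}"
      by (rule submodule_0[OF submodule_ideal[OF ideal_ideal_gen[OF K]]]) simp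
    ultimately show ?thesis using \<open>J = {0}\<close> by (intro exI[of _ "{}"]) auto
  next
    case False
    then obtain x where x: "x \<in> J" "x \<noteq> 0" by blast
    then obtain y where "y \<in> K" "y * x = 1" using inv ideal_subset[OF J] by blast
    then have J1: "1 \<in> J" using submodule_mult[OF submodule_ideal[OF J] _ x(1)] by force
    have "ideal_gen K {1} \<subseteq> J" using J1 J by (intro ideal_gen_minimal) auto
    moreover have "z \<in> ideal_gen K {1}" if "z \<in> J" for z
    proof -
      have I: "is_submodule K (ideal_gen K {1})"
        using subring_1[OF K] by (intro submodule_ideal ideal_ideal_gen K) auto
      have "z * 1 \<in> ideal_gen K {1}"
        by (rule submodule_mult[OF I]) (use that ideal_subset[OF J] subset_ideal_gen in auto)
      then show ?thesis by simp
    qed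
    ultimately show ?thesis using J1 by (intro exI[of _ "{1}"]) auto
  qed
qed

text \<open>
The homogeneous part of degree \<open>g\<close> of the algebra generated over \<open>K\<close> by the elements \<open>v\<close> with
prescribed degrees \<open>h\<close>, \<open>(h, v) \<in> \<Gamma>\<close>. The degree is only a label: the same element may occur in
different degrees, as in a Rees algebra.
\<close>

inductive graded_span :: "'c::comm_ring_1 set \<Rightarrow> ('g::ab_group_add \<times> 'c) set \<Rightarrow> 'g \<Rightarrow> 'c \<Rightarrow> bool"
  for K \<Gamma> where
  zero: "graded_span K \<Gamma> g 0"
| add: "graded_span K \<Gamma> g x \<Longrightarrow> graded_span K \<Gamma> g y \<Longrightarrow> graded_span K \<Gamma> g (x + y)"
| const: "c \<in> K \<Longrightarrow> graded_span K \<Gamma> 0 c"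
| gen: "(h, v) \<in> \<Gamma> \<Longrightarrow> graded_span K \<Gamma> g x \<Longrightarrow> graded_span K \<Gamma> (h + g) (v * x)"

lemma graded_span_const_mult:
  assumes "is_subring K" "c \<in> K" "graded_span K \<Gamma> g x"
  shows "graded_span K \<Gamma> g (c * x)"
  using assms(3)
proof induction
  case (gen h v g x)
  then show ?case using graded_span.gen[of h v \<Gamma> K g "c * x"] by (simp add: mult.left_commute)
next
  case (const d)
  then show ?case using subring_mult[OF assms(1,2)] by (intro graded_span.const)
qed (auto simp: distrib_left intro: graded_span.zero graded_span.add)

lemma graded_span_diff:
  assumes "is_subring K" "graded_span K \<Gamma> g x" "graded_span K \<Gamma> g y"
  shows "graded_span K \<Gamma> g (x - y)"
  using graded_span.add[OF assms(2)
      graded_span_const_mult[OF assms(1) subring_uminus[OF assms(1) subring_1[OF assms(1)]] assms(3)]]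
  by simp

lemma graded_span_sum:
  "(\<And>i. i \<in> S \<Longrightarrow> graded_span K \<Gamma> g (f i)) \<Longrightarrow> graded_span K \<Gamma> g (sum f S)"
  by (induction S rule: infinite_finite_induct) (auto intro: graded_span.zero graded_span.add)

lemma graded_span_mult:
  assumes K: "is_subring K" and x: "graded_span K \<Gamma> g x" and y: "graded_span K \<Gamma> h y"
  shows "graded_span K \<Gamma> (g + h) (x * y)"
  using x
proof induction
  case (gen i v g x)
  then show ?case using graded_span.gen[OF gen(1,3)] by (simp add: add.assoc mult.assoc)
next
  case (const c)
  then show ?case using graded_span_const_mult[OF K _ y] by simp
qed (auto simp: distrib_right intro: graded_span.zero graded_span.add)

lemma sum_single_lookup: "(\<Sum>k\<in>Poly_Mapping.keys r. Poly_Mapping.single k (Poly_Mapping.lookup r k)) = r"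
proof (rule poly_mapping_eqI)
  fix i
  have "Poly_Mapping.lookup (\<Sum>k\<in>Poly_Mapping.keys r. Poly_Mapping.single k (Poly_Mapping.lookup r k)) i
      = (\<Sum>k\<in>Poly_Mapping.keys r. Poly_Mapping.lookup r k when k = i)"
    unfolding lookup_sum lookup_single ..
  also have "\<dots> = Poly_Mapping.lookup r i"
    by (cases "i \<in> Poly_Mapping.keys r") (simp_all add: when_def sum.delta in_keys_iff cong: if_cong)
  finally show "Poly_Mapping.lookup (\<Sum>k\<in>Poly_Mapping.keys r. Poly_Mapping.single k (Poly_Mapping.lookup r k)) i = Poly_Mapping.lookup r i" .
qed

text \<open>
Inside the group ring of the degrees the labels become honest: there \<open>v\<close> in degree \<open>h\<close> is
represented by the monomial with exponent \<open>h\<close> and coefficient \<open>v\<close>, and \<open>graded_span\<close> describes the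
coefficients of the subalgebra generated by these monomials.
\<close>

lemma lookup_adjoin_graded_span:
  fixes r :: "'g::ab_group_add \<Rightarrow>\<^sub>0 'c::comm_ring_1"
  assumes K: "is_subring K"
    and "r \<in> adjoin (Poly_Mapping.single 0 ` K) ((\<lambda>(g, v). Poly_Mapping.single g v) ` \<Gamma>)"
  shows "graded_span K \<Gamma> k (Poly_Mapping.lookup r k)"
proof -
  let ?Q = "{r :: 'g \<Rightarrow>\<^sub>0 'c. \<forall>k. graded_span K \<Gamma> k (Poly_Mapping.lookup r k)}"
  have single: "Poly_Mapping.single g x \<in> ?Q" if "graded_span K \<Gamma> g x" for g x
    using that by (auto simp: lookup_single when_def intro: graded_span.zero)
  have "is_subring ?Q"
  proof (rule is_subringI)
    show "1 \<in> ?Q"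
      using single[OF graded_span.const[OF subring_1[OF K]]] by simp
  next
    fix r s assume rs: "r \<in> ?Q" "s \<in> ?Q"
    then show "r - s \<in> ?Q" by (auto simp: lookup_minus intro: graded_span_diff[OF K])
    have "r * s = (\<Sum>i\<in>Poly_Mapping.keys r. \<Sum>j\<in>Poly_Mapping.keys s.
        Poly_Mapping.single (i + j) (Poly_Mapping.lookup r i * Poly_Mapping.lookup s j))"
      by (subst (1) sum_single_lookup[of r, symmetric], subst (1) sum_single_lookup[of s, symmetric])
        (simp add: sum_product mult_single)
    moreover have "Poly_Mapping.single (i + j) (Poly_Mapping.lookup r i * Poly_Mapping.lookup s j) \<in> ?Q" for i j
      using rs by (intro single graded_span_mult[OF K]) auto
    ultimately show "r * s \<in> ?Q"
      by (auto simp: lookup_sum intro!: graded_span_sum)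
  qed
  moreover have "Poly_Mapping.single 0 ` K \<subseteq> ?Q"
    using single[OF graded_span.const] by blast
  moreover have "(\<lambda>(g, v). Poly_Mapping.single g v) ` \<Gamma> \<subseteq> ?Q"
  proof -
    have "Poly_Mapping.single g v \<in> ?Q" if "(g, v) \<in> \<Gamma>" for g v
      using single[OF graded_span.gen[OF that graded_span.const[OF subring_1[OF K]]]] by simp
    then show ?thesis by auto
  qed
  ultimately have "adjoin (Poly_Mapping.single 0 ` K) ((\<lambda>(g, v). Poly_Mapping.single g v) ` \<Gamma>) \<subseteq> ?Q"
    by (intro adjoin_minimal)
  then show ?thesis using assms(2) by blast
qed

lemma single_in_adjoin:
  assumes K: "is_subring K" and "graded_span K \<Gamma> g x"
  shows "Poly_Mapping.single g x
    \<in> adjoin (Poly_Mapping.single 0 ` K) ((\<lambda>(g, v). Poly_Mapping.single g v) ` \<Gamma>)"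
  using assms(2)
proof induction
  case (zero g)
  then show ?case by (simp add: subring_0[OF subring_adjoin])
next
  case (add g x y)
  then show ?case by (simp add: single_add subring_add[OF subring_adjoin])
next
  case (const c)
  then show ?case using base_subset_adjoin by fast
next
  case (gen h v g x)
  have "Poly_Mapping.single h v
      \<in> adjoin (Poly_Mapping.single 0 ` K) ((\<lambda>(g, v). Poly_Mapping.single g v) ` \<Gamma>)"
    using gens_subset_adjoin gen(1) by force
  from subring_mult[OF subring_adjoin this gen(3)] show ?case by (simp add: mult_single)
qed

text \<open>
The monomials belonging to \<open>P\<close> generate an ideal in a finitely generated, hence Noetherian
subalgebra of the group ring. Finitely many of them suffice, and a representation by them can be
read off in a single degree because the degrees form a group.
\<close>

theorem graded_ideal_finite_basis:
  fixes P :: "'g::ab_group_add \<Rightarrow> 'c::comm_ring_1 \<Rightarrow> bool"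
  assumes K: "is_subring K" and inv: "\<And>x. x \<in> K \<Longrightarrow> x \<noteq> 0 \<Longrightarrow> \<exists>y\<in>K. y * x = 1"
    and \<Gamma>: "finite \<Gamma>" and P: "\<And>g c. P g c \<Longrightarrow> graded_span K \<Gamma> g c"
  shows "\<exists>T. finite T \<and> (\<forall>t\<in>T. P (fst t) (snd t)) \<and>
    (\<forall>g c. P g c \<longrightarrow>
      (\<exists>w. (\<forall>t\<in>T. graded_span K \<Gamma> (g - fst t) (w t)) \<and> c = (\<Sum>t\<in>T. w t * snd t)))"
proof -
  define R where "R = adjoin (Poly_Mapping.single 0 ` K :: ('g \<Rightarrow>\<^sub>0 'c) set)
    ((\<lambda>(g, v). Poly_Mapping.single g v) ` \<Gamma>)"
  have R: "is_subring R" unfolding R_def by (rule subring_adjoin)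
  have K0: "is_subring (Poly_Mapping.single 0 ` K :: ('g \<Rightarrow>\<^sub>0 'c) set)"
  proof (rule is_subringI)
    show "1 \<in> (Poly_Mapping.single 0 ` K :: ('g \<Rightarrow>\<^sub>0 'c) set)"
      using imageI[OF subring_1[OF K], of "Poly_Mapping.single (0::'g)"] by simp
  next
    fix x y assume "x \<in> (Poly_Mapping.single 0 ` K :: ('g \<Rightarrow>\<^sub>0 'c) set)"
      "y \<in> (Poly_Mapping.single 0 ` K :: ('g \<Rightarrow>\<^sub>0 'c) set)"
    then obtain a b where ab: "a \<in> K" "b \<in> K"
      "x = Poly_Mapping.single 0 a" "y = Poly_Mapping.single 0 b" by blast
    show "x - y \<in> Poly_Mapping.single 0 ` K"
      using subring_diff[OF K ab(1,2)] ab(3,4) by (auto simp: single_diff[symmetric])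
    show "x * y \<in> Poly_Mapping.single 0 ` K"
      using subring_mult[OF K ab(1,2)] ab(3,4) by (auto simp: mult_single)
  qed
  have "noetherian (Poly_Mapping.single 0 ` K :: ('g \<Rightarrow>\<^sub>0 'c) set)"
  proof (rule noetherian_field[OF K0])
    fix x assume "x \<in> (Poly_Mapping.single 0 ` K :: ('g \<Rightarrow>\<^sub>0 'c) set)" "x \<noteq> 0"
    then obtain a where a: "a \<in> K" "x = Poly_Mapping.single 0 a" "a \<noteq> 0"
      by (metis imageE single_zero)
    then obtain b where b: "b \<in> K" "b * a = 1" using inv by blast
    then show "\<exists>y\<in>Poly_Mapping.single 0 ` K. y * x = 1"
      using a(2) by (intro bexI[of _ "Poly_Mapping.single 0 b"]) (auto simp: mult_single)
  qed
  then have noeth: "noetherian R" unfolding R_def using \<Gamma> by (intro Hilbert_basis) auto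
  define X where "X = {Poly_Mapping.single g c | g c. P g c}"
  have XR: "X \<subseteq> R"
  proof
    fix x assume "x \<in> X"
    then obtain g c where "x = Poly_Mapping.single g c" "P g c" unfolding X_def by auto
    then show "x \<in> R" unfolding R_def using single_in_adjoin[OF K P] by simp
  qed
  then obtain T' where T': "T' \<subseteq> X" "finite T'" "ideal_gen R X = ideal_gen R T'"
    using noetherian_finite_subset[OF noeth XR] by blast
  have "T' \<subseteq> (\<lambda>(g, c). Poly_Mapping.single g c) ` {(g, c). P g c}"
    using T'(1) unfolding X_def by auto
  then obtain T where T: "T \<subseteq> {(g, c). P g c}" "finite T"
    "T' = (\<lambda>(g, c). Poly_Mapping.single g c) ` T"
    using T'(2) by (metis finite_subset_image)
  show ?thesis
  proof (intro exI[of _ T] conjI ballI allI impI)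
    show "finite T" by (rule T(2))
    show "P (fst t) (snd t)" if "t \<in> T" for t using that T(1) by auto
    fix g c assume "P g c"
    then have "Poly_Mapping.single g c \<in> ideal_gen R T'"
      unfolding T'(3)[symmetric] using subset_ideal_gen[of X R] by (auto simp: X_def)
    moreover have "T' \<subseteq> R" using T'(1) XR by blast
    ultimately obtain a where a: "\<forall>t\<in>T. a t \<in> R"
      "Poly_Mapping.single g c = (\<Sum>t\<in>T. a t * (\<lambda>(g, c). Poly_Mapping.single g c) t)"
      unfolding T(3) using ideal_gen_image[OF R T(2)] by auto
    define w where "w t = Poly_Mapping.lookup (a t) (g - fst t)" for t
    have shift: "Poly_Mapping.lookup (r * Poly_Mapping.single h b) g = Poly_Mapping.lookup r (g - h) * b"
      for r :: "'g \<Rightarrow>\<^sub>0 'c" and h b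
    proof -
      have "r * Poly_Mapping.single h b
          = (\<Sum>i\<in>Poly_Mapping.keys r. Poly_Mapping.single (i + h) (Poly_Mapping.lookup r i * b))"
        by (subst (1) sum_single_lookup[of r, symmetric])
          (simp add: sum_distrib_right mult_single)
      then have "Poly_Mapping.lookup (r * Poly_Mapping.single h b) g
          = (\<Sum>i\<in>Poly_Mapping.keys r. Poly_Mapping.lookup r i * b when i = g - h)"
        by (simp add: lookup_sum lookup_single algebra_simps eq_diff_eq)
      also have "\<dots> = Poly_Mapping.lookup r (g - h) * b"
        by (cases "g - h \<in> Poly_Mapping.keys r") (simp_all add: when_def sum.delta in_keys_iff cong: if_cong)
      finally show ?thesis .
    qed
    have "c = Poly_Mapping.lookup (Poly_Mapping.single g c) g" by simp
    also have "\<dots> = (\<Sum>t\<in>T. w t * snd t)"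
      unfolding a(2) lookup_sum by (intro sum.cong) (auto simp: shift w_def)
    finally have "c = (\<Sum>t\<in>T. w t * snd t)" .
    moreover have "\<forall>t\<in>T. graded_span K \<Gamma> (g - fst t) (w t)"
      using a(1) lookup_adjoin_graded_span[OF K] unfolding w_def R_def by auto
    ultimately show "\<exists>w. (\<forall>t\<in>T. graded_span K \<Gamma> (g - fst t) (w t)) \<and>
        c = (\<Sum>t\<in>T. w t * snd t)" by blast
  qed
qed

section \<open>The grading of a fundamental pair\<close>

lemma derivation_add: "derivation d \<Longrightarrow> d (x + y) = d x + d y"
  and derivation_mult: "derivation d \<Longrightarrow> d (x * y) = d x * y + x * d y"
  unfolding derivation_def by auto

lemma derivation_0: "derivation d \<Longrightarrow> d 0 = 0"
  using derivation_add[of d 0 0] by simp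

lemma derivation_uminus: "derivation d \<Longrightarrow> d (- x) = - d x"
  using derivation_add[of d x "- x"] derivation_0[of d] by (simp add: eq_neg_iff_add_eq_0 add.commute)

lemma derivation_diff: "derivation d \<Longrightarrow> d (x - y) = d x - d y"
  using derivation_add[of d x "- y"] derivation_uminus[of d y] by simp

lemma derivation_1: "derivation d \<Longrightarrow> d 1 = 0"
  using derivation_mult[of d 1 1] by simp

lemma derivation_of_int: "derivation d \<Longrightarrow> d (of_int n) = 0"
proof -
  assume d: "derivation d"
  have "d (of_nat m) = 0" for m
    by (induction m) (auto simp: derivation_0[OF d] derivation_1[OF d] derivation_add[OF d])
  then show ?thesis
    by (cases n rule: int_cases) (auto simp: derivation_uminus[OF d] derivation_diff[OF d] derivation_1[OF d])
qed

lemma derivation_of_int_mult: "derivation d \<Longrightarrow> d (of_int n * x) = of_int n * d x"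
  by (simp add: derivation_mult derivation_of_int)

lemma derivation_sum: "derivation d \<Longrightarrow> d (sum f S) = (\<Sum>i\<in>S. d (f i))"
  by (induction S rule: infinite_finite_induct) (auto simp: derivation_0 derivation_add)

lemma derivation_funpow_add: "derivation d \<Longrightarrow> (d ^^ n) (x + y) = (d ^^ n) x + (d ^^ n) y"
  by (induction n) (auto simp: derivation_add)

lemma derivation_funpow_0: "derivation d \<Longrightarrow> (d ^^ n) 0 = 0"
  by (induction n) (auto simp: derivation_0)

lemma derivation_funpow_mult_constant:
  "derivation d \<Longrightarrow> d a = 0 \<Longrightarrow> (d ^^ n) (a * x) = a * (d ^^ n) x"
  by (induction n) (auto simp: derivation_mult)

text \<open>
The extreme term of the Leibniz rule; with orders of nilpotency \<open>m + 1\<close> and \<open>n + 1\<close> all other terms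
of \<open>d\<^sup>m\<^sup>+\<^sup>n (x y)\<close> vanish.
\<close>

lemma derivation_funpow_mult_top:
  assumes d: "derivation d"
  shows "(d ^^ Suc m) x = 0 \<Longrightarrow> (d ^^ Suc n) y = 0 \<Longrightarrow>
    (d ^^ (m + n)) (x * y) = of_nat ((m + n) choose m) * (d ^^ m) x * (d ^^ n) y"
proof (induction "m + n" arbitrary: m n x y)
  case 0
  then show ?case by simp
next
  case (Suc s)
  show ?case
  proof (cases "m = 0 \<or> n = 0")
    case True
    then show ?thesis
    proof
      assume "m = 0"
      then show ?thesis using Suc.prems(1) derivation_funpow_mult_constant[OF d, of x n y] by simp
    next
      assume "n = 0"
      then show ?thesis using Suc.prems(2) derivation_funpow_mult_constant[OF d, of y m x]
        by (simp add: mult.commute)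
    qed
  next
    case False
    then obtain m' n' where mn: "m = Suc m'" "n = Suc n'" by (metis not0_implies_Suc)
    have x: "(d ^^ Suc m') (d x) = 0" and y: "(d ^^ Suc n') (d y) = 0"
      using Suc.prems unfolding mn by (simp_all only: funpow_Suc_right comp_def)
    have "(d ^^ (m + n)) (x * y) = (d ^^ (m' + n)) (d x * y) + (d ^^ (m + n')) (x * d y)"
      unfolding mn by (simp add: funpow_swap1 derivation_mult[OF d] derivation_funpow_add[OF d]
          derivation_add[OF d])
    also have "(d ^^ (m' + n)) (d x * y)
        = of_nat ((m' + n) choose m') * (d ^^ m') (d x) * (d ^^ n) y"
      using Suc.hyps(2) mn by (intro Suc.hyps(1) x Suc.prems(2)) simp
    also have "(d ^^ (m + n')) (x * d y)
        = of_nat ((m + n') choose m) * (d ^^ m) x * (d ^^ n') (d y)"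
      using Suc.hyps(2) mn by (intro Suc.hyps(1) y Suc.prems(1)) simp
    also have "(d ^^ m') (d x) = (d ^^ m) x"
      unfolding mn by (simp add: funpow_swap1)
    also have "(d ^^ n') (d y) = (d ^^ n) y"
      unfolding mn by (simp add: funpow_swap1)
    finally show ?thesis unfolding mn by (simp add: algebra_simps)
  qed
qed

lemma k_domain_vector_space: "k_domain scale \<Longrightarrow> vector_space scale"
  and k_domain_scale_mult: "k_domain scale \<Longrightarrow> scale c (x * y) = scale c x * y"
  unfolding k_domain_def by auto

lemma k_domain_of_nat:
  assumes "k_domain scale"
  shows "scale (of_nat n) 1 = of_nat n"
proof -
  interpret vector_space scale using assms by (rule k_domain_vector_space)
  show ?thesis by (induction n) (auto simp: scale_left_distrib)
qed

lemma k_domain_of_int: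
  assumes "k_domain scale"
  shows "scale (of_int n) 1 = of_int n"
proof -
  interpret vector_space scale using assms by (rule k_domain_vector_space)
  show ?thesis
    by (cases n rule: int_cases2) (auto simp: k_domain_of_nat[OF assms])
qed

text \<open>
The exponent of the last nonzero iterate is additive on products in a domain of characteristic
zero, and it is zero for \<open>u v = 1\<close>. In particular \<open>d\<close> kills the base field and is linear (\<open>LND_scale\<close>).
\<close>

lemma LND_kills_units:
  fixes scale :: "'k::field_char_0 \<Rightarrow> 'b::idom \<Rightarrow> 'b"
  assumes k: "k_domain scale" and d: "d \<in> LND" and uv: "u * v = (1 :: 'b)"
  shows "d u = 0"
proof (rule ccontr)
  assume du: "d u \<noteq> 0"
  interpret vector_space scale using k by (rule k_domain_vector_space)
  have der: "derivation d" and nil: "\<And>b. \<exists>n. (d ^^ n) b = 0" using d unfolding LND_def by auto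
  have "u \<noteq> 0" "v \<noteq> 0" using uv by auto
  then obtain m n where m: "(d ^^ m) u \<noteq> 0" "(d ^^ Suc m) u = 0"
    and n: "(d ^^ n) v \<noteq> 0" "(d ^^ Suc n) v = 0"
    using last_nonzero_iterate nil by metis
  have "m \<noteq> 0" using m du by (cases m) auto
  have "(of_nat ((m + n) choose m) :: 'b) \<noteq> 0"
    using k_domain_of_nat[OF k, of "(m + n) choose m"] by (metis binomial_eq_0_iff le_add1
        not_less of_nat_eq_0_iff scale_eq_0_iff zero_neq_one)
  then have "(d ^^ (m + n)) (u * v) \<noteq> 0"
    using m n unfolding derivation_funpow_mult_top[OF der m(2) n(2)] by simp
  moreover have "(d ^^ (m + n)) 1 = 0"
    using \<open>m \<noteq> 0\<close> derivation_1[OF der] derivation_funpow_0[OF der]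
    by (cases m) (simp_all add: funpow_swap1)
  ultimately show False using uv by simp
qed

lemma LND_scale:
  fixes scale :: "'k::field_char_0 \<Rightarrow> 'b::idom \<Rightarrow> 'b"
  assumes k: "k_domain scale" and d: "d \<in> LND"
  shows "d (scale c x) = scale c (d x)"
proof -
  interpret vector_space scale using k by (rule k_domain_vector_space)
  have der: "derivation d" using d unfolding LND_def by auto
  have x: "scale c y = scale c 1 * y" for c y
    using k_domain_scale_mult[OF k, of c 1 y] by simp
  have "d (scale c 1) = 0"
  proof (cases "c = 0")
    case False
    then have "scale c 1 * scale (inverse c) 1 = 1" by (simp add: x[symmetric])
    then show ?thesis by (rule LND_kills_units[OF k d])
  qed (simp add: derivation_0[OF der])
  then show ?thesis
    by (subst x, subst (2) x) (simp add: derivation_mult[OF der])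
qed

locale sl2_domain =
  fixes scale :: "'k::field_char_0 \<Rightarrow> 'b::idom \<Rightarrow> 'b" and D U :: "'b \<Rightarrow> 'b"
  assumes k_domain: "k_domain scale" and fundamental_pair: "fundamental_pair D U"
begin

sublocale vector_space scale using k_domain by (rule k_domain_vector_space)

abbreviation B :: "int \<Rightarrow> 'b set" where "B \<equiv> grad_comp D U"

lemma scale_eq_mult: "scale c x = scale c 1 * x"
  using k_domain_scale_mult[OF k_domain, of c 1 x] by simp

lemma scale_of_int: "scale (of_int n) x = of_int n * x"
  by (subst scale_eq_mult) (simp add: k_domain_of_int[OF k_domain])

lemma of_int_eq_0: "(of_int n :: 'b) = 0 \<longleftrightarrow> n = 0"
  using k_domain_of_int[OF k_domain, of n] by (metis of_int_0 of_int_eq_0_iff scale_eq_0_iff zero_neq_one)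

lemma LND_D: "D \<in> LND" and LND_U: "U \<in> LND"
  using fundamental_pair unfolding fundamental_pair_def by auto

lemma derivation_D: "derivation D" and derivation_U: "derivation U"
  using LND_D LND_U unfolding LND_def by auto

lemmas D_add = derivation_add[OF derivation_D] and U_add = derivation_add[OF derivation_U]
  and D_mult = derivation_mult[OF derivation_D] and U_mult = derivation_mult[OF derivation_U]
  and D_0 = derivation_0[OF derivation_D] and U_0 = derivation_0[OF derivation_U]
  and D_diff = derivation_diff[OF derivation_D] and U_diff = derivation_diff[OF derivation_U]
  and D_scale = LND_scale[OF k_domain LND_D] and U_scale = LND_scale[OF k_domain LND_U]

lemma in_B_iff: "x \<in> B n \<longleftrightarrow> D (U x) - U (D x) = of_int n * x"
  unfolding grad_comp_def Ker_def bracket_def by auto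

lemma D_B: assumes "x \<in> B n" shows "D x \<in> B (n + 2)"
proof -
  have "bracket D (bracket D U) x = - 2 * D x"
    using fundamental_pair unfolding fundamental_pair_def by meson
  then have "D (of_int n * x) - (D (U (D x)) - U (D (D x))) = - 2 * D x"
    using assms unfolding in_B_iff by (simp add: bracket_def)
  then show ?thesis unfolding in_B_iff derivation_of_int_mult[OF derivation_D]
    by (simp add: algebra_simps)
qed

lemma U_B: assumes "x \<in> B n" shows "U x \<in> B (n - 2)"
proof -
  have "bracket U (bracket D U) x = 2 * U x"
    using fundamental_pair unfolding fundamental_pair_def by meson
  then have "U (of_int n * x) - (D (U (U x)) - U (D (U x))) = 2 * U x"
    using assms unfolding in_B_iff by (simp add: bracket_def)
  then show ?thesis unfolding in_B_iff derivation_of_int_mult[OF derivation_U]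
    by (simp add: algebra_simps)
qed

lemma subspace_B: "subspace (B n)"
  unfolding subspace_def
proof (intro conjI ballI allI)
  show "0 \<in> B n" unfolding in_B_iff by (simp add: D_0 U_0)
  show "x + y \<in> B n" if "x \<in> B n" "y \<in> B n" for x y
    using that unfolding in_B_iff by (simp add: D_add U_add distrib_left add_diff_add)
  show "scale c x \<in> B n" if "x \<in> B n" for c x
    using that unfolding in_B_iff
    by (simp only: D_scale U_scale scale_right_diff_distrib[symmetric])
      (simp only: scale_of_int[symmetric] scale_left_commute)
qed

sublocale weight_module scale B D U
proof (intro weight_module.intro vector_space_axioms weight_module_axioms.intro subspace_B)
  show "Vector_Spaces.linear scale scale D"
    by unfold_locales (auto simp: D_add D_scale)
  show "Vector_Spaces.linear scale scale U"
    by unfold_locales (auto simp: U_add U_scale)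
  show "\<exists>j. (D ^^ j) x = 0" "\<exists>j. (U ^^ j) x = 0" for x
    using LND_D LND_U unfolding LND_def by auto
  show "D (U x) = U (D x) + scale (of_int n) x" if "x \<in> B n" for x n
    using that unfolding in_B_iff scale_of_int by (simp add: algebra_simps)
qed (auto intro: D_B U_B)

lemma B_mult: "x \<in> B i \<Longrightarrow> y \<in> B j \<Longrightarrow> x * y \<in> B (i + j)"
proof -
  assume "x \<in> B i" "y \<in> B j"
  then have "D (U x) = U (D x) + of_int i * x" "D (U y) = U (D y) + of_int j * y"
    unfolding in_B_iff by (auto simp: algebra_simps)
  then show ?thesis unfolding in_B_iff
    by (simp add: D_mult U_mult D_add U_add algebra_simps)
qed

lemma one_B: "1 \<in> B 0"
  unfolding in_B_iff by (simp add: derivation_1[OF derivation_D] derivation_1[OF derivation_U] D_0 U_0)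

lemma scale_one_B: "scale c 1 \<in> B 0"
  using subspace_scale[OF subspace_B one_B] .

lemma grad_comp_swap: "grad_comp U D n = B (- n)"
proof -
  have "x \<in> grad_comp U D n \<longleftrightarrow> x \<in> B (- n)" for x
    unfolding grad_comp_def Ker_def bracket_def by (auto simp: algebra_simps)
  then show ?thesis by blast
qed

lemma swap_domain: "sl2_domain scale U D"
proof
  have "bracket U (bracket U D) = (\<lambda>b. - 2 * U b)"
  proof
    fix b
    have "bracket U (bracket D U) b = 2 * U b"
      using fundamental_pair unfolding fundamental_pair_def by meson
    then show "bracket U (bracket U D) b = - 2 * U b"
      by (simp add: bracket_def U_diff algebra_simps)
  qed
  moreover have "bracket D (bracket U D) = (\<lambda>b. 2 * D b)"
  proof
    fix b
    have "bracket D (bracket D U) b = - 2 * D b"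
      using fundamental_pair unfolding fundamental_pair_def by meson
    then show "bracket D (bracket U D) b = 2 * D b"
      by (simp add: bracket_def D_diff algebra_simps)
  qed
  moreover have "b \<in> sum_of UNIV (grad_comp U D)" for b
  proof -
    have "b \<in> sum_of UNIV B" using fundamental_pair unfolding fundamental_pair_def by auto
    then obtain f S where f: "finite S" "\<And>i. i \<in> S \<Longrightarrow> f i \<in> B i" "b = sum f S"
      unfolding sum_of_def by auto
    have "b = sum (\<lambda>i. f (- i)) (uminus ` S)"
      unfolding f(3) by (subst sum.reindex) auto
    then show ?thesis unfolding sum_of_def grad_comp_swap
      using f(1,2) by (intro CollectI exI[of _ "\<lambda>i. f (- i)"] exI[of _ "uminus ` S"]) auto
  qed
  ultimately show "fundamental_pair U D"
    using LND_D LND_U unfolding fundamental_pair_def by auto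
qed (rule k_domain)

text \<open>
Eigenvectors of the bracket for different integers are independent, as integers are distinct
in characteristic zero; the bracket minus \<open>s\<close> removes the summand of weight \<open>s\<close>.
\<close>

lemma B_independent:
  assumes "finite S" "\<And>i. i \<in> S \<Longrightarrow> f i \<in> B i" "sum f S = 0" "i \<in> S"
  shows "f i = 0"
  using assms
proof (induction S arbitrary: f i rule: finite_induct)
  case (insert s S)
  have E: "D (U (f i)) - U (D (f i)) = of_int i * f i" if "i \<in> insert s S" for i
    using insert.prems(1)[OF that] unfolding in_B_iff .
  have "(\<Sum>i\<in>insert s S. of_int i * f i) = (\<Sum>i\<in>insert s S. D (U (f i)) - U (D (f i)))"
    by (rule sum.cong) (use E in auto)
  also have "\<dots> = D (U (sum f (insert s S))) - U (D (sum f (insert s S)))"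
    by (simp only: sum_subtractf derivation_sum[OF derivation_D] derivation_sum[OF derivation_U])
  finally have "(\<Sum>i\<in>insert s S. of_int i * f i) - of_int s * sum f (insert s S) = 0"
    using insert.prems(2) by (simp add: D_0 U_0)
  then have "(\<Sum>i\<in>S. of_int (i - s) * f i) = 0"
    using insert.hyps by (simp add: sum_distrib_left sum_subtractf algebra_simps)
  moreover have "of_int (i - s) * f i \<in> B i" if "i \<in> S" for i
    using subspace_scale[OF subspace_B insert.prems(1)[of i], of "of_int (i - s)"] that
    unfolding scale_of_int by simp
  ultimately have "of_int (i - s) * f i = 0" if "i \<in> S" for i
    using insert.IH[of "\<lambda>i. of_int (i - s) * f i" i] that by blast
  then have S: "f i = 0" if "i \<in> S" for i
    using that insert.hyps of_int_eq_0[of "i - s"] by fastforce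
  then have "f s = 0" using insert.prems(2) insert.hyps by simp
  then show ?case using S insert.prems(3) by blast
qed simp

text \<open>
The homogeneous components of an element, chosen as a family with finite support; by
\<open>component_eqI\<close> the choice is unique.
\<close>

definition component :: "'b \<Rightarrow> int \<Rightarrow> 'b" where
  "component b = (SOME f. finite {i. f i \<noteq> 0} \<and> (\<forall>i. f i \<in> B i) \<and> b = sum f {i. f i \<noteq> 0})"

lemma zero_B: "0 \<in> B n"
  using subspace_0[OF subspace_B] .

lemma component:
  "finite {i. component b i \<noteq> 0} \<and> (\<forall>i. component b i \<in> B i) \<and>
    b = sum (component b) {i. component b i \<noteq> 0}"
proof -
  have "b \<in> sum_of UNIV B" using fundamental_pair unfolding fundamental_pair_def by auto
  then obtain f S where f: "finite S" "\<And>i. i \<in> S \<Longrightarrow> f i \<in> B i" "b = sum f S"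
    unfolding sum_of_def by auto
  define g where "g i = (if i \<in> S then f i else 0)" for i
  have "{i. g i \<noteq> 0} \<subseteq> S" unfolding g_def by auto
  moreover have "sum g {i. g i \<noteq> 0} = sum f S"
    unfolding g_def using f(1) by (intro sum.mono_neutral_cong_left) auto
  ultimately have "\<exists>f. finite {i. f i \<noteq> 0} \<and> (\<forall>i. f i \<in> B i) \<and> b = sum f {i. f i \<noteq> 0}"
    using f by (intro exI[of _ g]) (auto intro: finite_subset zero_B simp: g_def)
  then show ?thesis unfolding component_def by (rule someI_ex)
qed

lemma finite_support: "finite {i. component b i \<noteq> 0}"
  and component_B: "component b i \<in> B i"
  and sum_components: "sum (component b) {i. component b i \<noteq> 0} = b"
  using component[of b] by auto

lemma component_eqI:
  assumes S: "finite S" "\<And>i. i \<in> S \<Longrightarrow> f i \<in> B i" and b: "b = sum f S"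
  shows "component b i = (if i \<in> S then f i else 0)"
proof -
  let ?T = "S \<union> {i. component b i \<noteq> 0}"
  let ?f = "\<lambda>i. if i \<in> S then f i else 0"
  have T: "finite ?T" using S(1) finite_support by simp
  have "sum (component b) ?T = sum (component b) {i. component b i \<noteq> 0}"
    using T by (intro sum.mono_neutral_right) auto
  moreover have "sum ?f ?T = sum f S" using T by (intro sum.mono_neutral_cong_right) auto
  ultimately have "(\<Sum>i\<in>?T. component b i - ?f i) = 0"
    unfolding sum_subtractf using b by (simp add: sum_components)
  then have "component b i - ?f i = 0" if "i \<in> ?T"
    using that T S(2) component_B zero_B
    by (intro B_independent[of ?T "\<lambda>i. component b i - ?f i"] subspace_diff[OF subspace_B]) auto
  then show ?thesis by (cases "i \<in> ?T") auto
qed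

lemma component_homogeneous: "b \<in> B n \<Longrightarrow> component b i = (if i = n then b else 0)"
  using component_eqI[of "{n}" "\<lambda>_. b" b i] by simp

lemma component_0: "component 0 i = 0"
  using component_homogeneous[OF zero_B, of i i] by simp

lemma component_shift:
  assumes add: "\<And>x y. T (x + y) = T x + T y" and T: "\<And>x i. x \<in> B i \<Longrightarrow> T x \<in> B (i + j)"
  shows "component (T b) i = T (component b (i - j))"
proof -
  let ?S = "{i. component b i \<noteq> 0}"
  have T0: "T 0 = 0" using add[of 0 0] by (simp only: add_0_left add_cancel_right_right)
  have Tsum: "T (sum f S) = (\<Sum>i\<in>S. T (f i))" for f :: "int \<Rightarrow> 'b" and S
    by (induction S rule: infinite_finite_induct) (auto simp: add T0)
  have "T b = T (sum (component b) ?S)" by (simp add: sum_components)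
  also have "\<dots> = sum (\<lambda>i. T (component b (i - j))) ((\<lambda>i. i + j) ` ?S)"
    unfolding Tsum by (subst sum.reindex) (auto simp: inj_on_def)
  finally have "component (T b) i
      = (if i \<in> (\<lambda>i. i + j) ` ?S then T (component b (i - j)) else 0)"
    using finite_support component_B T by (intro component_eqI) force+
  moreover have "component b (i - j) = 0" if "i \<notin> (\<lambda>i. i + j) ` ?S"
    using that by (metis (mono_tags, lifting) diff_add_cancel imageI mem_Collect_eq)
  ultimately show ?thesis using T0 by auto
qed

lemma component_add: "component (a + b) i = component a i + component b i"
proof -
  let ?S = "{i. component a i \<noteq> 0} \<union> {i. component b i \<noteq> 0}"
  have S: "finite ?S" using finite_support by simp
  have "sum (component c) ?S = c" if "{i. component c i \<noteq> 0} \<subseteq> ?S" for c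
  proof -
    have "sum (component c) ?S = sum (component c) {i. component c i \<noteq> 0}"
      using S that by (intro sum.mono_neutral_right) auto
    then show ?thesis by (simp add: sum_components)
  qed
  then have "a + b = (\<Sum>i\<in>?S. component a i + component b i)"
    by (simp add: sum.distrib)
  then have "component (a + b) i = (if i \<in> ?S then component a i + component b i else 0)"
    using S by (intro component_eqI) (auto intro: subspace_add subspace_B component_B)
  then show ?thesis by auto
qed

lemma component_sum: "component (sum f S) i = (\<Sum>s\<in>S. component (f s) i)"
  by (induction S rule: infinite_finite_induct) (auto simp: component_0 component_add)

lemma component_D: "component (D b) i = D (component b (i - 2))"
  by (rule component_shift) (auto intro: D_add D_B)

lemma component_U: "component (U b) i = U (component b (i + 2))"
  using component_shift[of U "- 2" b i] by (auto simp: U_add intro: U_B)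

lemma component_funpow_D: "component ((D ^^ n) b) i = (D ^^ n) (component b (i - 2 * int n))"
  by (rule component_shift) (auto intro: funpow_D_M simp: D_pow.add)

lemma component_mult: "x \<in> B j \<Longrightarrow> component (x * b) i = x * component b (i - j)"
  by (rule component_shift) (auto simp: distrib_left intro: B_mult[THEN back_subst[of "\<lambda>n. _ \<in> B n"]])

lemma component_scale: "component (scale c b) i = scale c (component b i)"
  using component_mult[OF scale_one_B, of c b i] by (simp add: scale_eq_mult[symmetric])

lemma component_diff: "component (a - b) i = component a i - component b i"
  using component_add[of "a - b" b i] by simp

lemma eq_0_if_components: "(\<And>i. component b i = 0) \<Longrightarrow> b = 0"
  using sum_components[of b] by simp

lemma component_Ker_D: "D a = 0 \<Longrightarrow> D (component a i) = 0"
  using component_D[of a "i + 2"] by (simp add: component_0)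

lemma Ker_D_negative: "D a = 0 \<Longrightarrow> i < 0 \<Longrightarrow> component a i = 0"
  by (rule D_injective_negative[OF component_B]) (auto intro: component_Ker_D)

text \<open>
Elements of \<open>A\<^sub>0\<close> are invariant under both operators, so that \<open>U\<close> is linear over \<open>A\<^sub>0\<close> as well.
\<close>

lemma D_0_imp_U_0: "a \<in> B 0 \<Longrightarrow> D a = 0 \<Longrightarrow> U a = 0"
  using funpow_U_highest_eq_0[of a 0] by simp

lemma is_subring_Ker_D: "is_subring (Ker D)"
  unfolding Ker_def
  by (rule is_subringI) (auto simp: derivation_1[OF derivation_D] D_diff D_mult)

text \<open>
In weights \<open>\<ge> 0\<close> the sum is \<open>highest_plus_UD\<close>, in negative weights \<open>U\<close> alone is surjective. The
intersection is trivial because \<open>DU\<close> is injective in positive weights and \<open>D\<close> in negative ones.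
\<close>

lemma direct_sum_Ker_D_range_U: "direct_sum2 (Ker D \<inter> B 0) UNIV (Ker D) (range U)"
  unfolding direct_sum2_def
proof (intro conjI)
  show "is_submodule (Ker D \<inter> B 0) (Ker D)"
    unfolding is_submodule_def Ker_def by (auto simp: D_0 D_add D_mult)
  show sub: "is_submodule (Ker D \<inter> B 0) (range U)"
    unfolding is_submodule_def
  proof (intro conjI ballI)
    show "0 \<in> range U" using U_0 by (metis rangeI)
    show "x + y \<in> range U" if "x \<in> range U" "y \<in> range U" for x y
      using that by (auto simp: U_add[symmetric])
    fix a x assume "a \<in> Ker D \<inter> B 0" "x \<in> range U"
    then obtain y where "U a = 0" "x = U y" using D_0_imp_U_0 unfolding Ker_def by auto
    then have "a * x = U (a * y)" by (simp add: U_mult)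
    then show "a * x \<in> range U" by blast
  qed
  show "UNIV = {x + y |x y. x \<in> Ker D \<and> y \<in> range U}" (is "_ = ?V")
  proof -
    have V: "is_submodule {} ?V"
      unfolding is_submodule_def
    proof (intro conjI ballI)
      have "(0::'b) = 0 + U 0" by (simp add: U_0)
      then show "0 \<in> ?V" using D_0 unfolding Ker_def by blast
      fix v w assume "v \<in> ?V" "w \<in> ?V"
      then obtain x y x' y' where "v = x + U y" "w = x' + U y'" "D x = 0" "D x' = 0"
        unfolding Ker_def by auto
      then have "v + w = (x + x') + U (y + y')" "D (x + x') = 0"
        by (auto simp: U_add D_add algebra_simps)
      then show "v + w \<in> ?V" unfolding Ker_def by blast
    qed auto
    have "component b i \<in> ?V" for b i
    proof (cases "i \<ge> 0")
      case True
      then show ?thesis using highest_plus_UD[OF component_B[of b i]] unfolding Ker_def by blast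
    next
      case False
      interpret swap: weight_module scale "\<lambda>n. B (- n)" U D by (rule swap)
      obtain y where "component b i = U (D y)"
        using swap.DU_surjective[of "component b i" "- i"] component_B[of b i] False by auto
      then have "component b i = 0 + U (D y)" by simp
      then show ?thesis using D_0 unfolding Ker_def by blast
    qed
    then have "sum (component b) {i. component b i \<noteq> 0} \<in> ?V" for b
      by (intro submodule_sum[OF V])
    then show ?thesis unfolding sum_components by blast
  qed
  have "a = 0" if "D a = 0" "a = U x" for a x
  proof (rule eq_0_if_components)
    fix i
    show "component a i = 0"
    proof (cases "i \<ge> 0")
      case True
      have "component a i = U (component x (i + 2))"
        using that(2) component_U by simp
      moreover from this have "component x (i + 2) = 0"
        using component_Ker_D[OF that(1), of i] True
        by (intro DU_injective[OF component_B[of x "i + 2"]]) auto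
      ultimately show ?thesis by (simp add: U_0)
    next
      case False
      then show ?thesis using Ker_D_negative[OF that(1)] by simp
    qed
  qed
  then show "Ker D \<inter> range U = {0}"
    using D_0 U_0 unfolding Ker_def by (auto intro: range_eqI[of _ _ 0])
qed

lemma D_image_B: "D ` B n \<subseteq> B (n + 2)"
  using D_B by blast

lemma inj_on_D_B: "n \<le> -1 \<Longrightarrow> inj_on D (B n)"
proof (rule inj_onI)
  fix x y assume n: "n \<le> -1" and xy: "x \<in> B n" "y \<in> B n" "D x = D y"
  have "x - y = 0"
    using n xy subspace_diff[OF subspace_B xy(1,2)]
    by (intro D_injective_negative[of "x - y" n]) (auto simp: D_diff)
  then show "x = y" by simp
qed

lemma D_image_B_eq:
  assumes "n \<ge> -1"
  shows "D ` B n = B (n + 2)"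
proof
  show "B (n + 2) \<subseteq> D ` B n"
  proof
    fix x assume "x \<in> B (n + 2)"
    then obtain y where "y \<in> B (n + 2)" "x = D (U y)"
      using DU_surjective[of x "n + 2"] assms by auto
    then show "x \<in> D ` B n" using U_B[of y "n + 2"] by auto
  qed
qed (rule D_image_B)

lemma D_image_subset_U_image: "D ` B (- 2) \<subseteq> U ` B 2"
proof
  interpret swap: sl2_domain scale U D by (rule swap_domain)
  fix x assume "x \<in> D ` B (- 2)"
  then obtain y where y: "y \<in> B (- 2)" "x = D y" by blast
  then have "y \<in> U ` B 0"
    using swap.D_image_B_eq[of 0] unfolding grad_comp_swap by simp
  then obtain z where z: "z \<in> B 0" "y = U z" by blast
  then have "x = U (D z)" using y(2) unfolding in_B_iff by simp
  then show "x \<in> U ` B 2" using D_B[OF z(1)] by simp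
qed

lemma D_image_eq_U_image: "D ` B (- 2) = U ` B 2"
proof
  interpret swap: sl2_domain scale U D by (rule swap_domain)
  show "U ` B 2 \<subseteq> D ` B (- 2)"
    using swap.D_image_subset_U_image unfolding grad_comp_swap by simp
qed (rule D_image_subset_U_image)

lemma Ker_zero_swap: "Ker U \<inter> B 0 = Ker D \<inter> B 0"
proof -
  interpret swap: sl2_domain scale U D by (rule swap_domain)
  show ?thesis
    using D_0_imp_U_0 swap.D_0_imp_U_0 unfolding grad_comp_swap Ker_def by auto
qed

lemma direct_sum_Ker_U_range_D: "direct_sum2 (Ker D \<inter> B 0) UNIV (Ker U) (range D)"
proof -
  interpret swap: sl2_domain scale U D by (rule swap_domain)
  show ?thesis
    using swap.direct_sum_Ker_D_range_U unfolding grad_comp_swap by (simp add: Ker_zero_swap)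
qed

lemma direct_sum_B_0: "direct_sum2 (Ker D \<inter> B 0) (B 0) (Ker D \<inter> B 0) (D ` B (- 2))"
proof -
  note e = direct_sum_Ker_D_range_U[unfolded direct_sum2_def]
  have UB: "U ` B 2 \<subseteq> B 0" using U_B by force
  show ?thesis
    unfolding direct_sum2_def D_image_eq_U_image
  proof (intro conjI)
    show "is_submodule (Ker D \<inter> B 0) (Ker D \<inter> B 0)"
      unfolding is_submodule_def Ker_def
      using B_mult[of _ 0 _ 0] by (auto simp: D_0 D_add D_mult zero_B intro: subspace_add subspace_B)
    show "is_submodule (Ker D \<inter> B 0) (U ` B 2)"
      unfolding is_submodule_def
    proof (intro conjI ballI)
      show "0 \<in> U ` B 2" using U_0 zero_B by (metis imageI)
      fix x y assume "x \<in> U ` B 2" "y \<in> U ` B 2"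
      then obtain x' y' where "x' \<in> B 2" "y' \<in> B 2" "x + y = U (x' + y')"
        by (auto simp: U_add)
      then show "x + y \<in> U ` B 2" using subspace_add[OF subspace_B] by blast
    next
      fix a x assume a: "a \<in> Ker D \<inter> B 0" and "x \<in> U ` B 2"
      then obtain y where y: "y \<in> B 2" "U a = 0" "x = U y"
        using D_0_imp_U_0 unfolding Ker_def by auto
      then have "a * x = U (a * y)" by (simp add: U_mult)
      then show "a * x \<in> U ` B 2" using B_mult[of a 0 y 2] a y(1) by auto
    qed
    have "\<exists>a y. b = a + U y \<and> a \<in> Ker D \<inter> B 0 \<and> y \<in> B 2" if b: "b \<in> B 0" for b
    proof -
      obtain a y where "a \<in> B 0" "y \<in> B 0" "D a = 0" "b = a + U (D y)"
        using highest_plus_UD[OF b] by auto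
      then show ?thesis using D_B[of y 0] unfolding Ker_def by auto
    qed
    then show "B 0 = {x + y |x y. x \<in> Ker D \<inter> B 0 \<and> y \<in> U ` B 2}"
      using UB by (blast intro: subspace_add[OF subspace_B])
    show "Ker D \<inter> B 0 \<inter> U ` B 2 = {0}"
      using e U_0 zero_B[of 0] zero_B[of 2] by (auto intro: image_eqI[of _ _ 0])
  qed
qed

end

section \<open>The ideals of iterated images\<close>

lemma ideal_ideal_mult:
  assumes "is_subring R" "J \<subseteq> R" "L \<subseteq> R"
  shows "is_ideal R (ideal_mult R J L)"
  unfolding ideal_mult_def
  by (rule ideal_ideal_gen[OF assms(1)]) (use assms subring_mult in blast)

lemma mult_in_ideal_mult: "x \<in> J \<Longrightarrow> y \<in> L \<Longrightarrow> x * y \<in> ideal_mult R J L"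
  unfolding ideal_mult_def by (rule subsetD[OF subset_ideal_gen]) blast

lemma ideal_mult_subset:
  assumes "is_ideal R T" "\<And>x y. x \<in> J \<Longrightarrow> y \<in> L \<Longrightarrow> x * y \<in> T"
  shows "ideal_mult R J L \<subseteq> T"
  unfolding ideal_mult_def using assms by (intro ideal_gen_minimal) auto

lemma ideal_mult_times:
  assumes R: "is_subring R" and T: "is_ideal R T" and J: "J \<subseteq> R" and L: "L \<subseteq> R"
    and prod: "\<And>p q. p \<in> J \<Longrightarrow> q \<in> L \<Longrightarrow> p * q * y \<in> T" and x: "x \<in> ideal_mult R J L"
  shows "x * y \<in> T"
proof -
  let ?K = "{x \<in> R. x * y \<in> T}"
  have "is_ideal R ?K"
    unfolding is_ideal_def is_submodule_def
    using subring_0[OF R] subring_add[OF R] subring_mult[OF R] submodule_0[OF submodule_ideal[OF T]]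
      submodule_add[OF submodule_ideal[OF T]] submodule_mult[OF submodule_ideal[OF T]]
    by (auto simp: distrib_right mult.assoc)
  moreover have "{p * q | p q. p \<in> J \<and> q \<in> L} \<subseteq> ?K"
    using prod J L subring_mult[OF R] by blast
  ultimately have "ideal_mult R J L \<subseteq> ?K"
    unfolding ideal_mult_def by (intro ideal_gen_minimal)
  then show ?thesis using x by blast
qed

lemma ideal_ideal_pow:
  assumes "is_subring R" "J \<subseteq> R"
  shows "is_ideal R (ideal_pow R J n)"
proof (induction n)
  case (Suc n)
  then show ?case using ideal_ideal_mult[OF assms(1) ideal_subset[OF Suc] assms(2)] by simp
qed (use ideal_self assms in simp)

lemma ideal_ideal_monomial:
  assumes "is_subring R" "\<And>i. J i \<subseteq> R"
  shows "is_ideal R (ideal_monomial R J e n)"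
proof (induction n)
  case (Suc n)
  then show ?case
    using ideal_ideal_mult[OF assms(1) ideal_subset[OF Suc]
        ideal_subset[OF ideal_ideal_pow[OF assms]]] by simp
qed (use ideal_self assms in simp)

lemma ideal_monomial_cong:
  "(\<And>i. 1 \<le> i \<Longrightarrow> i \<le> n \<Longrightarrow> e i = e' i) \<Longrightarrow> ideal_monomial R J e n = ideal_monomial R J e' n"
  by (induction n) auto

lemma one_in_ideal_monomial_0:
  assumes "is_subring R"
  shows "1 \<in> ideal_monomial R J (\<lambda>_. 0) n"
proof (induction n)
  case (Suc n)
  then show ?case using mult_in_ideal_mult[OF Suc subring_1[OF assms], of R] by simp
qed (use subring_1[OF assms] in simp)

text \<open>
The induction is on the number of factors of the monomial: the new factor \<open>y\<close> is absorbed either by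
the last power or, using commutativity, by one of the earlier ones.
\<close>

lemma ideal_monomial_times:
  assumes R: "is_subring R" and J: "\<And>i. J i \<subseteq> R" and y: "y \<in> J k" and k: "1 \<le> k"
  shows "k \<le> n \<Longrightarrow> x \<in> ideal_monomial R J e n \<Longrightarrow>
    x * y \<in> ideal_monomial R J (e(k := Suc (e k))) n"
proof (induction n arbitrary: x)
  case 0
  then show ?case using k by simp
next
  case (Suc n)
  let ?e = "e(k := Suc (e k))"
  have mon: "is_ideal R (ideal_monomial R J e' n')" for e' n'
    using R J by (rule ideal_ideal_monomial)
  have pow: "is_ideal R (ideal_pow R (J i) n')" for i n'
    using R J by (rule ideal_ideal_pow)
  have x: "x \<in> ideal_mult R (ideal_monomial R J e n) (ideal_pow R (J (Suc n)) (e (Suc n)))"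
    using Suc.prems(2) by simp
  show ?case
  proof (cases "k = Suc n")
    case True
    have eq: "ideal_monomial R J ?e n = ideal_monomial R J e n"
      by (rule ideal_monomial_cong) (use True in simp)
    show ?thesis
    proof (rule ideal_mult_times[OF R mon ideal_subset[OF mon] ideal_subset[OF pow] _ x])
      fix p q
      assume p: "p \<in> ideal_monomial R J e n" and q: "q \<in> ideal_pow R (J (Suc n)) (e (Suc n))"
      have "q * y \<in> ideal_pow R (J (Suc n)) (?e (Suc n))"
        using mult_in_ideal_mult[OF q] y True by simp
      then have "p * (q * y) \<in> ideal_monomial R J ?e (Suc n)"
        using p eq by (simp add: mult_in_ideal_mult)
      then show "p * q * y \<in> ideal_monomial R J ?e (Suc n)" by (simp add: mult.assoc)
    qed
  next
    case False
    show ?thesis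
    proof (rule ideal_mult_times[OF R mon ideal_subset[OF mon] ideal_subset[OF pow] _ x])
      fix p q
      assume p: "p \<in> ideal_monomial R J e n" and q: "q \<in> ideal_pow R (J (Suc n)) (e (Suc n))"
      have "p * y \<in> ideal_monomial R J ?e n" using False Suc.prems(1) by (intro Suc.IH p) simp
      then have "(p * y) * q \<in> ideal_monomial R J ?e (Suc n)"
        using q False by (simp add: mult_in_ideal_mult)
      then show "p * q * y \<in> ideal_monomial R J ?e (Suc n)" by (simp add: ac_simps)
    qed
  qed
qed

lemma sum_ofI: "finite S \<Longrightarrow> S \<subseteq> X \<Longrightarrow> (\<And>i. i \<in> S \<Longrightarrow> f i \<in> F i) \<Longrightarrow> sum f S \<in> sum_of X F"
  unfolding sum_of_def by blast

lemma sum_ofD: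
  "x \<in> sum_of X F \<Longrightarrow> \<exists>f S. finite S \<and> S \<subseteq> X \<and> (\<forall>i\<in>S. f i \<in> F i) \<and> x = sum f S"
  unfolding sum_of_def by blast

lemma in_sum_of: "i \<in> X \<Longrightarrow> x \<in> F i \<Longrightarrow> x \<in> sum_of X F"
  using sum_ofI[of "{i}" X "\<lambda>_. x" F] by simp

lemma sum_of_submodule:
  assumes F: "\<And>i. i \<in> X \<Longrightarrow> is_submodule R (F i)"
  shows "is_submodule R (sum_of X F)"
  unfolding is_submodule_def
proof (intro conjI ballI)
  show "0 \<in> sum_of X F" using sum_ofI[of "{}" X "\<lambda>_. 0" F] by simp
next
  fix x y assume x: "x \<in> sum_of X F" and y: "y \<in> sum_of X F"
  obtain f S where f: "finite S" "S \<subseteq> X" "\<forall>i\<in>S. f i \<in> F i" "x = sum f S"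
    using sum_ofD[OF x] by (elim exE conjE) (rule that)
  obtain g T where g: "finite T" "T \<subseteq> X" "\<forall>i\<in>T. g i \<in> F i" "y = sum g T"
    using sum_ofD[OF y] by (elim exE conjE) (rule that)
  let ?f = "\<lambda>i. if i \<in> S then f i else 0" and ?g = "\<lambda>i. if i \<in> T then g i else 0"
  have "sum ?f (S \<union> T) = x" unfolding f(4) using f(1) g(1)
    by (intro sum.mono_neutral_cong_right) auto
  moreover have "sum ?g (S \<union> T) = y" unfolding g(4) using f(1) g(1)
    by (intro sum.mono_neutral_cong_right) auto
  ultimately have "x + y = (\<Sum>i\<in>S \<union> T. ?f i + ?g i)" by (simp add: sum.distrib)
  moreover have "?f i \<in> F i" "?g i \<in> F i" if "i \<in> S \<union> T" for i
    using that f(2,3) g(2,3) submodule_0[OF F] by auto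
  ultimately show "x + y \<in> sum_of X F"
    using f(1,2) g(1,2) submodule_add[OF F] by (simp only:) (intro sum_ofI; blast)
next
  fix a x assume a: "a \<in> R" and x: "x \<in> sum_of X F"
  from sum_ofD[OF x] obtain f S where f: "finite S" "S \<subseteq> X" "\<forall>i\<in>S. f i \<in> F i" "x = sum f S"
    by (elim exE conjE) (rule that)
  have "a * x = (\<Sum>i\<in>S. a * f i)" unfolding f(4) by (rule sum_distrib_left)
  also have "\<dots> \<in> sum_of X F"
    using f(1-3) submodule_mult[OF F a] by (intro sum_ofI) auto
  finally show "a * x \<in> sum_of X F" .
qed

definition exponents :: "int \<Rightarrow> nat \<Rightarrow> (nat \<Rightarrow> nat) set" where
  "exponents m n = {e. (\<forall>i. i \<notin> {1..nat m} \<longrightarrow> e i = 0) \<and> (\<Sum>i\<in>{1..nat m}. i * e i) = n}"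

lemma exponents_upd:
  assumes e: "e \<in> exponents m n" and k: "1 \<le> k" "k \<le> nat m"
  shows "e(k := Suc (e k)) \<in> exponents m (n + k)"
proof -
  have "(\<Sum>i\<in>{1..nat m}. i * (e(k := Suc (e k))) i)
      = (\<Sum>i\<in>{1..nat m}. i * e i + (if i = k then k else 0))"
    by (intro sum.cong) auto
  also have "\<dots> = n + k" using e k unfolding exponents_def by (simp add: sum.distrib)
  finally show ?thesis using e k unfolding exponents_def by auto
qed

context sl2_domain
begin

definition image_ideal :: "nat \<Rightarrow> 'b set" where
  "image_ideal n = (D ^^ n) ` Ker (D ^^ (n + 1))"

lemma component_times:
  "component (a * b) i = (\<Sum>j | component a j \<noteq> 0. component a j * component b (i - j))"
proof -
  have "component (a * b) i = component (sum (component a) {j. component a j \<noteq> 0} * b) i"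
    by (simp add: sum_components)
  also have "\<dots> = (\<Sum>j | component a j \<noteq> 0. component (component a j * b) i)"
    unfolding sum_distrib_right component_sum ..
  finally show ?thesis by (simp add: component_mult[OF component_B])
qed

text \<open>
If \<open>D\<^sup>n x\<close> is killed by \<open>D\<close> and has weight \<open>i < n\<close>, then \<open>x\<close> has weight \<open>i - 2 n \<le> - (n + 1)\<close> and is killed
by \<open>D\<^sup>n\<^sup>+\<^sup>1\<close>, hence vanishes. Conversely \<open>D\<^sup>n U\<^sup>n\<close> is a nonzero scalar on highest weight vectors of weight
\<open>i \<ge> n\<close>.
\<close>

lemma in_image_ideal_iff:
  "a \<in> image_ideal n \<longleftrightarrow> D a = 0 \<and> (\<forall>i < int n. component a i = 0)"
proof
  assume "a \<in> image_ideal n"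
  then obtain x where x: "a = (D ^^ n) x" "(D ^^ Suc n) x = 0"
    unfolding image_ideal_def Ker_def by auto
  then have a: "D a = 0" by simp
  have "component a i = 0" if "i < int n" for i
  proof -
    let ?y = "component x (i - 2 * int n)"
    have ai: "component a i = (D ^^ n) ?y" unfolding x(1) by (rule component_funpow_D)
    then have "(D ^^ Suc n) ?y = 0" using component_Ker_D[OF a, of i] by simp
    then have "?y = 0"
      using that by (intro funpow_D_injective_low_weight[OF component_B, of "i - 2 * int n" "Suc n"]) auto
    then show ?thesis using ai by simp
  qed
  then show "D a = 0 \<and> (\<forall>i < int n. component a i = 0)" using a by blast
next
  assume a: "D a = 0 \<and> (\<forall>i < int n. component a i = 0)"
  have "\<exists>x. (D ^^ n) x = component a i" if "component a i \<noteq> 0" for i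
  proof -
    have "D (component a i) = 0" using a component_Ker_D by blast
    moreover have "int n \<le> i" using that a by (meson not_le)
    ultimately obtain c where c: "c \<noteq> 0" "(D ^^ n) ((U ^^ n) (component a i)) = scale c (component a i)"
      using funpow_D_U_highest[OF component_B] by blast
    have "(D ^^ n) (scale (inverse c) ((U ^^ n) (component a i))) = component a i"
      unfolding D_pow.scale c(2) using c(1) by simp
    then show ?thesis by blast
  qed
  then obtain x where x: "\<And>i. component a i \<noteq> 0 \<Longrightarrow> (D ^^ n) (x i) = component a i" by metis
  have "a = (D ^^ n) (sum x {i. component a i \<noteq> 0})"
    unfolding D_pow.sum using x by (simp add: sum_components)
  then show "a \<in> image_ideal n"
    unfolding image_ideal_def Ker_def using a by auto
qed

lemma image_ideal_subset: "image_ideal n \<subseteq> Ker D"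
  unfolding Ker_def using in_image_ideal_iff by auto

lemma image_ideal_0: "image_ideal 0 = Ker D"
  using Ker_D_negative unfolding Ker_def by (auto simp: in_image_ideal_iff)

lemma homogeneous_in_image_ideal: "a \<in> Ker D \<inter> B p \<Longrightarrow> int n \<le> p \<Longrightarrow> a \<in> image_ideal n"
  unfolding in_image_ideal_iff Ker_def by (auto simp: component_homogeneous)

lemma homogeneous_in_image_idealD:
  assumes "a \<in> image_ideal n" "a \<in> B p" "a \<noteq> 0"
  shows "int n \<le> p"
proof (rule ccontr)
  assume "\<not> int n \<le> p"
  then have "component a p = 0" using assms(1) in_image_ideal_iff by auto
  then show False using component_homogeneous[OF assms(2), of p] assms(3) by simp
qed

lemma image_ideal_mult:
  assumes a: "a \<in> image_ideal m" and b: "b \<in> image_ideal n"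
  shows "a * b \<in> image_ideal (m + n)"
  unfolding in_image_ideal_iff
proof (intro conjI allI impI)
  show "D (a * b) = 0" using a b by (simp add: in_image_ideal_iff D_mult)
  fix i assume i: "i < int (m + n)"
  have "component a j * component b (i - j) = 0" if "component a j \<noteq> 0" for j
  proof -
    have "\<not> j < int m" using that a in_image_ideal_iff by blast
    then have "i - j < int n" using i by simp
    then show ?thesis using b in_image_ideal_iff by simp
  qed
  then show "component (a * b) i = 0" unfolding component_times by (intro sum.neutral) auto
qed

lemma is_ideal_image_ideal: "is_ideal (Ker D) (image_ideal n)"
  unfolding is_ideal_def is_submodule_def
proof (intro conjI ballI image_ideal_subset)
  show "0 \<in> image_ideal n" by (simp add: in_image_ideal_iff D_0 component_0)
  show "x + y \<in> image_ideal n" if "x \<in> image_ideal n" "y \<in> image_ideal n" for x y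
    using that by (simp add: in_image_ideal_iff D_add component_add)
  show "a * x \<in> image_ideal n" if "a \<in> Ker D" "x \<in> image_ideal n" for a x
    using image_ideal_mult[of a 0 x n] that unfolding image_ideal_0 by simp
qed

lemma sum_components_in:
  assumes "is_submodule R N" "\<And>i. component a i \<noteq> 0 \<Longrightarrow> component a i \<in> N"
  shows "a \<in> N"
  using submodule_sum[OF assms(1), of "{i. component a i \<noteq> 0}" "component a"] assms(2)
  by (simp add: sum_components)

lemma is_submodule_Ints: "is_submodule \<int> (Ker D \<inter> B i)"
  unfolding is_submodule_def
proof (intro conjI ballI)
  show "0 \<in> Ker D \<inter> B i" using D_0 zero_B unfolding Ker_def by auto
  show "x + y \<in> Ker D \<inter> B i" if "x \<in> Ker D \<inter> B i" "y \<in> Ker D \<inter> B i" for x y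
    using that subspace_add[OF subspace_B, of x i y] unfolding Ker_def by (auto simp: D_add)
  fix a x :: 'b assume "a \<in> \<int>" and x: "x \<in> Ker D \<inter> B i"
  then obtain n where "a = of_int n" by (auto elim: Ints_cases)
  then have "a * x = scale (of_int n) x" by (simp add: scale_of_int)
  then show "a * x \<in> Ker D \<inter> B i"
    using x subspace_scale[OF subspace_B, of x i] unfolding Ker_def by (auto simp: D_scale)
qed

lemma direct_sum_image_ideal:
  "direct_sum_of \<int> (image_ideal n) {int n..} (\<lambda>i. Ker D \<inter> B i)"
  unfolding direct_sum_of_def
proof (intro conjI ballI allI impI is_submodule_Ints)
  show "image_ideal n = sum_of {int n..} (\<lambda>i. Ker D \<inter> B i)"
  proof
    show "image_ideal n \<subseteq> sum_of {int n..} (\<lambda>i. Ker D \<inter> B i)"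
    proof
      fix a assume a: "a \<in> image_ideal n"
      then have "\<not> i < int n" if "component a i \<noteq> 0" for i
        using that in_image_ideal_iff by blast
      then have "sum (component a) {i. component a i \<noteq> 0} \<in> sum_of {int n..} (\<lambda>i. Ker D \<inter> B i)"
        using a component_Ker_D component_B finite_support
        by (intro sum_ofI) (force simp: in_image_ideal_iff Ker_def)+
      then show "a \<in> sum_of {int n..} (\<lambda>i. Ker D \<inter> B i)" by (simp add: sum_components)
    qed
    show "sum_of {int n..} (\<lambda>i. Ker D \<inter> B i) \<subseteq> image_ideal n"
    proof
      fix a assume "a \<in> sum_of {int n..} (\<lambda>i. Ker D \<inter> B i)"
      from sum_ofD[OF this] obtain f S where S: "S \<subseteq> {int n..}" "\<forall>i\<in>S. f i \<in> Ker D \<inter> B i" "a = sum f S"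
        by (elim exE conjE) (rule that)
      show "a \<in> image_ideal n"
        unfolding S(3)
        by (rule submodule_sum[OF submodule_ideal[OF is_ideal_image_ideal]])
          (rule homogeneous_in_image_ideal, use S in auto)
    qed
  qed
qed (use B_independent in blast)

lemma nat_graded_Ker_D: "nat_graded (Ker D) (\<lambda>i. Ker D \<inter> B (int i))"
  unfolding nat_graded_def direct_sum_of_def
proof (intro conjI ballI allI impI is_submodule_Ints)
  show "Ker D = sum_of UNIV (\<lambda>i. Ker D \<inter> B (int i))"
  proof
    show "Ker D \<subseteq> sum_of UNIV (\<lambda>i. Ker D \<inter> B (int i))"
    proof
      fix a assume "a \<in> Ker D"
      then have a: "D a = 0" by (simp add: Ker_def)
      show "a \<in> sum_of UNIV (\<lambda>i. Ker D \<inter> B (int i))"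
      proof (rule sum_components_in[OF sum_of_submodule[OF is_submodule_Ints]])
        fix i assume "component a i \<noteq> 0"
        then have "i = int (nat i)" using Ker_D_negative[OF a, of i] by force
        then show "component a i \<in> sum_of UNIV (\<lambda>i. Ker D \<inter> B (int i))"
          using component_Ker_D[OF a] component_B[of a i]
          by (intro in_sum_of[of "nat i"]) (auto simp: Ker_def)
      qed
    qed
    show "sum_of UNIV (\<lambda>i. Ker D \<inter> B (int i)) \<subseteq> Ker D"
      by (auto dest!: sum_ofD intro!: subring_sum[OF is_subring_Ker_D])
  qed
  fix f :: "nat \<Rightarrow> 'b" and S i
  assume S: "finite S" "\<forall>i\<in>S. f i \<in> Ker D \<inter> B (int i)" "sum f S = 0" "i \<in> S"
  have "sum (\<lambda>j. f (nat j)) (int ` S) = 0" using S(3) by (subst sum.reindex) auto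
  then have "f (nat (int i)) = 0"
    using S by (intro B_independent[of "int ` S" "\<lambda>j. f (nat j)" "int i"]) auto
  then show "f i = 0" by simp
next
  fix i j x y assume "x \<in> Ker D \<inter> B (int i)" "y \<in> Ker D \<inter> B (int j)"
  then show "x * y \<in> Ker D \<inter> B (int (i + j))"
    using B_mult[of x "int i" y "int j"] unfolding Ker_def by (auto simp: D_mult)
qed

lemma hdeg_eq: "b \<in> B d \<Longrightarrow> b \<noteq> 0 \<Longrightarrow> hdeg B b = d"
  unfolding hdeg_def
proof (rule the_equality)
  fix e assume "b \<in> B e" "b \<in> B d" "b \<noteq> 0"
  then show "e = d" using component_homogeneous[of b e d] component_homogeneous[of b d d] by metis
qed

text \<open>
The last nonzero iterate \<open>D\<^sup>j\<^sup>+\<^sup>1 x\<close> lies in the ideal. If \<open>D\<close> were zero, then so would be the bracket,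
and then \<open>U\<close>, as \<open>2 U\<close> is a bracket with it.
\<close>

lemma image_ideal_1_nonzero:
  assumes "\<not> trivial_pair D U"
  shows "\<exists>a \<in> image_ideal 1. a \<noteq> 0"
proof -
  have "\<exists>x. D x \<noteq> 0"
  proof (rule ccontr)
    assume "\<nexists>x. D x \<noteq> 0"
    then have D: "D x = 0" for x by blast
    have "U x = 0" for x
    proof -
      have "bracket U (bracket D U) x = 2 * U x"
        using fundamental_pair unfolding fundamental_pair_def by meson
      then have "of_int 2 * U x = 0" by (simp add: bracket_def D U_0)
      then show ?thesis using of_int_eq_0[of 2] by simp
    qed
    then show False using D assms unfolding trivial_pair_def by auto
  qed
  then obtain x where x: "D x \<noteq> 0" by blast
  obtain k where "(D ^^ k) (D x) = 0" using LND_D unfolding LND_def by blast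
  then obtain j where j: "(D ^^ j) (D x) \<noteq> 0" "(D ^^ Suc j) (D x) = 0"
    using x last_nonzero_iterate by blast
  then have "D ((D ^^ j) x) \<in> image_ideal 1"
    unfolding image_ideal_def Ker_def by (intro image_eqI[of _ _ "(D ^^ j) x"]) (auto simp: funpow_swap1)
  then show ?thesis using j(1) by (auto simp: funpow_swap1)
qed

text \<open>
Comparing components of degree \<open>p\<close>, the coefficients of a homogeneous element can be chosen
homogeneous of complementary degree.
\<close>

lemma homogeneous_expansion:
  assumes S: "finite S" "\<And>i. i \<in> S \<Longrightarrow> f i \<in> Ker D \<inter> B (\<delta> i)"
    and I: "image_ideal n = ideal_gen (Ker D) (f ` S)"
    and a: "a \<in> Ker D \<inter> B p" "int n \<le> p"
  shows "\<exists>c. (\<forall>i\<in>S. c i \<in> Ker D \<inter> B (p - \<delta> i)) \<and> a = (\<Sum>i\<in>S. c i * f i)"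
proof -
  have fS: "f ` S \<subseteq> Ker D" using S(2) by blast
  have "a \<in> ideal_gen (Ker D) (f ` S)"
    using homogeneous_in_image_ideal[OF a] I by simp
  then obtain c where c: "\<forall>i\<in>S. c i \<in> Ker D" "a = (\<Sum>i\<in>S. c i * f i)"
    unfolding ideal_gen_image[OF is_subring_Ker_D S(1) fS] by blast
  have "a = component a p" using a(1) component_homogeneous[of a p p] by simp
  also have "\<dots> = (\<Sum>i\<in>S. component (f i * c i) p)"
    unfolding c(2) component_sum by (simp add: mult.commute)
  also have "\<dots> = (\<Sum>i\<in>S. component (c i) (p - \<delta> i) * f i)"
    using component_mult S(2) by (intro sum.cong refl) (metis IntD2 mult.commute)
  finally show ?thesis
    using c(1) component_B component_Ker_D unfolding Ker_def
    by (intro exI[of _ "\<lambda>i. component (c i) (p - \<delta> i)"]) auto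
qed

text \<open>
The operator \<open>D\<^sup>n\<close> is \<open>A\<close>-linear with kernel \<open>\<F>\<^sub>n\<^sub>-\<^sub>1\<close>, and it maps \<open>h\<^sub>i = U\<^sup>n g\<^sub>i\<close> to a nonzero scalar
multiple of the generator \<open>g\<^sub>i\<close> of \<open>I\<^sub>n\<close>, because \<open>g\<^sub>i\<close> has degree at least \<open>n\<close>.
\<close>

lemma Ker_funpow_D_eq_span:
  assumes S: "finite S" "\<And>i. i \<in> S \<Longrightarrow> f i \<in> Ker D \<inter> B (\<delta> i)"
    and I: "image_ideal n = ideal_gen (Ker D) (f ` S)"
    and h: "\<And>i. i \<in> S \<Longrightarrow> h i = (U ^^ n) (f i)" and n: "n \<ge> 1"
  shows "Ker (D ^^ (n + 1)) =
    {(\<Sum>i\<in>S. a i * h i) + b | a b. (\<forall>i\<in>S. a i \<in> Ker D) \<and> b \<in> Ker (D ^^ (n - 1 + 1))}"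
    (is "_ = ?V")
proof
  have "\<exists>c. c \<noteq> 0 \<and> (D ^^ n) (h i) = scale c (f i)" if i: "i \<in> S" for i
  proof (cases "f i = 0")
    case True
    then show ?thesis
      using derivation_funpow_0[OF derivation_D] derivation_funpow_0[OF derivation_U] h[OF i]
      by (intro exI[of _ 1]) simp
  next
    case False
    have "f i \<in> image_ideal n" using I subset_ideal_gen[of "f ` S" "Ker D"] i by blast
    then have "int n \<le> \<delta> i" using S(2)[OF i] False homogeneous_in_image_idealD by blast
    then show ?thesis
      using S(2)[OF i] funpow_D_U_highest[of "f i" "\<delta> i" n] h[OF i] unfolding Ker_def by auto
  qed
  then obtain c where c: "\<And>i. i \<in> S \<Longrightarrow> c i \<noteq> 0 \<and> (D ^^ n) (h i) = scale (c i) (f i)" by metis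
  have sum: "(D ^^ n) (\<Sum>i\<in>S. a i * h i) = (\<Sum>i\<in>S. a i * scale (c i) (f i))"
    if "\<forall>i\<in>S. a i \<in> Ker D" for a
    unfolding D_pow.sum using that c
    by (intro sum.cong) (auto simp: derivation_funpow_mult_constant[OF derivation_D] Ker_def)
  show "?V \<subseteq> Ker (D ^^ (n + 1))"
  proof
    fix x assume "x \<in> ?V"
    then obtain a b where x: "x = (\<Sum>i\<in>S. a i * h i) + b" "\<forall>i\<in>S. a i \<in> Ker D" "(D ^^ n) b = 0"
      using n unfolding Ker_def by auto
    have "(D ^^ n) x = (\<Sum>i\<in>S. a i * scale (c i) (f i))"
      unfolding x(1) D_pow.add sum[OF x(2)] using x(3) by simp
    then have "D ((D ^^ n) x) = (\<Sum>i\<in>S. D (a i * scale (c i) (f i)))"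
      by (simp only: D.sum)
    also have "\<dots> = 0"
      using x(2) S(2) by (intro sum.neutral) (auto simp: D_mult D_scale Ker_def)
    finally show "x \<in> Ker (D ^^ (n + 1))" unfolding Ker_def by simp
  qed
  show "Ker (D ^^ (n + 1)) \<subseteq> ?V"
  proof
    fix x assume "x \<in> Ker (D ^^ (n + 1))"
    then have "(D ^^ n) x \<in> ideal_gen (Ker D) (f ` S)"
      unfolding I[symmetric] image_ideal_def by blast
    then obtain a where a: "\<forall>i\<in>S. a i \<in> Ker D" "(D ^^ n) x = (\<Sum>i\<in>S. a i * f i)"
      using S by (subst (asm) ideal_gen_image[OF is_subring_Ker_D]) auto
    define a' where "a' i = scale (inverse (c i)) (a i)" for i
    have a': "\<forall>i\<in>S. a' i \<in> Ker D"
      using a(1) unfolding a'_def Ker_def by (auto simp: D_scale)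
    have "a' i * scale (c i) (f i) = a i * f i" if "i \<in> S" for i
    proof -
      have "a' i * scale (c i) (f i) = (scale (inverse (c i)) 1 * scale (c i) 1) * (a i * f i)"
        unfolding a'_def by (subst scale_eq_mult, subst (2) scale_eq_mult) (simp add: ac_simps)
      also have "scale (inverse (c i)) 1 * scale (c i) 1 = 1"
        using c[OF that] by (simp add: scale_eq_mult[symmetric])
      finally show ?thesis by simp
    qed
    then have "(D ^^ n) (\<Sum>i\<in>S. a' i * h i) = (D ^^ n) x"
      unfolding sum[OF a'] a(2) by (intro sum.cong) auto
    then have "(D ^^ n) (x - (\<Sum>i\<in>S. a' i * h i)) = 0" unfolding D_pow.diff by simp
    moreover have "x = (\<Sum>i\<in>S. a' i * h i) + (x - (\<Sum>i\<in>S. a' i * h i))" by simp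
    ultimately show "x \<in> ?V"
      using a' n unfolding Ker_def by (intro CollectI exI conjI) auto
  qed
qed

context
  fixes S :: "'i set" and f :: "'i \<Rightarrow> 'b" and \<delta> :: "'i \<Rightarrow> int" and m :: int
  assumes S: "finite S" and f: "\<And>i. i \<in> S \<Longrightarrow> f i \<in> Ker D \<inter> B (\<delta> i)"
    and \<delta>: "\<And>i. i \<in> S \<Longrightarrow> 1 \<le> \<delta> i \<and> \<delta> i \<le> m"
    and I_1: "image_ideal 1 = ideal_gen (Ker D) (f ` S)"
begin

lemma expansion_1:
  assumes "a \<in> Ker D \<inter> B p" "1 \<le> p"
  shows "\<exists>c. (\<forall>i\<in>S. c i \<in> Ker D \<inter> B (p - \<delta> i)) \<and> a = (\<Sum>i\<in>S. c i * f i)"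
  using homogeneous_expansion[OF S f I_1 assms(1)] assms(2) by simp

text \<open>
An element of positive degree \<open>p\<close> lies in \<open>I\<^sub>1\<close>; its coefficients with respect to the generators have
degree less than \<open>p\<close>.
\<close>

lemma Ker_D_eq_adjoin: "Ker D = adjoin (Ker D \<inter> B 0) (f ` S)"
proof
  show "adjoin (Ker D \<inter> B 0) (f ` S) \<subseteq> Ker D"
    using f by (intro adjoin_minimal is_subring_Ker_D) auto
  have hom: "a \<in> adjoin (Ker D \<inter> B 0) (f ` S)" if "a \<in> Ker D \<inter> B (int p)" for a p
    using that
  proof (induction p arbitrary: a rule: less_induct)
    case (less p)
    show ?case
    proof (cases "p = 0")
      case True
      then show ?thesis
        using less.prems subsetD[OF base_subset_adjoin[of "Ker D \<inter> B 0" "f ` S"]] by auto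
    next
      case False
      then obtain c where c: "\<forall>i\<in>S. c i \<in> Ker D \<inter> B (int p - \<delta> i)" "a = (\<Sum>i\<in>S. c i * f i)"
        using expansion_1[OF less.prems] by auto
      have "c i \<in> adjoin (Ker D \<inter> B 0) (f ` S)" if i: "i \<in> S" for i
      proof (cases "\<delta> i \<le> int p")
        case True
        then have "int p - \<delta> i = int (nat (int p - \<delta> i))" by simp
        moreover have "nat (int p - \<delta> i) < p" using \<delta>[OF i] True False by linarith
        ultimately show ?thesis using less.IH c(1) i by metis
      next
        case False
        then have "c i = 0"
          using D_injective_negative[of "c i" "int p - \<delta> i"] c(1) i unfolding Ker_def by auto
        then show ?thesis by (simp add: subring_0[OF subring_adjoin])
      qed
      moreover have "f i \<in> adjoin (Ker D \<inter> B 0) (f ` S)" if "i \<in> S" for i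
        using that gens_subset_adjoin[of "f ` S"] by blast
      ultimately show ?thesis
        unfolding c(2) by (intro subring_sum subring_mult subring_adjoin)
    qed
  qed
  show "Ker D \<subseteq> adjoin (Ker D \<inter> B 0) (f ` S)"
  proof
    fix a assume "a \<in> Ker D"
    then have a: "D a = 0" by (simp add: Ker_def)
    have "component a i \<in> adjoin (Ker D \<inter> B 0) (f ` S)" if "component a i \<noteq> 0" for i
    proof -
      have "i = int (nat i)" using Ker_D_negative[OF a, of i] that by force
      then have "component a i \<in> Ker D \<inter> B (int (nat i))"
        using component_B[of a i] component_Ker_D[OF a] unfolding Ker_def by simp
      then show ?thesis by (rule hom)
    qed
    then have "sum (component a) {i. component a i \<noteq> 0} \<in> adjoin (Ker D \<inter> B 0) (f ` S)"
      by (intro subring_sum subring_adjoin) simp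
    then show "a \<in> adjoin (Ker D \<inter> B 0) (f ` S)" by (simp add: sum_components)
  qed
qed

text \<open>
In degree \<open>n + m\<close> or higher, subtracting the degree of a generator, which is at most \<open>m\<close>, does not lead
below \<open>n\<close>.
\<close>

lemma image_ideal_low_degree_generators:
  assumes n: "n \<ge> 1"
  shows "image_ideal n = ideal_gen (Ker D) (\<Union>j\<in>{int n..int n + m - 1}. Ker D \<inter> B j)"
    (is "_ = ideal_gen _ ?G")
proof
  show "ideal_gen (Ker D) ?G \<subseteq> image_ideal n"
    using homogeneous_in_image_ideal by (intro ideal_gen_minimal is_ideal_image_ideal) auto
  have G: "is_submodule (Ker D) (ideal_gen (Ker D) ?G)"
    by (intro submodule_ideal ideal_ideal_gen is_subring_Ker_D) auto
  have hom: "a \<in> ideal_gen (Ker D) ?G" if "a \<in> Ker D \<inter> B (int n + int p)" for a p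
    using that
  proof (induction p arbitrary: a rule: less_induct)
    case (less p)
    show ?case
    proof (cases "int p < m")
      case True
      then show ?thesis
        using less.prems by (intro subsetD[OF subset_ideal_gen] UN_I[of "int n + int p"]) auto
    next
      case False
      obtain c where c: "\<forall>i\<in>S. c i \<in> Ker D \<inter> B (int n + int p - \<delta> i)" "a = (\<Sum>i\<in>S. c i * f i)"
        using expansion_1[OF less.prems] n by auto
      have "f i * c i \<in> ideal_gen (Ker D) ?G" if i: "i \<in> S" for i
      proof -
        define q where "q = nat (int p - \<delta> i)"
        have q: "int n + int p - \<delta> i = int n + int q" "q < p"
          using \<delta>[OF i] False unfolding q_def by linarith+
        have "c i \<in> Ker D \<inter> B (int n + int q)" using c(1) i unfolding q(1)[symmetric] by blast
        then have "c i \<in> ideal_gen (Ker D) ?G" by (rule less.IH[OF q(2)])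
        moreover have "f i \<in> Ker D" using f[OF i] by blast
        ultimately show ?thesis by (intro submodule_mult[OF G])
      qed
      then show ?thesis unfolding c(2) by (intro submodule_sum[OF G]) (simp add: mult.commute)
    qed
  qed
  show "image_ideal n \<subseteq> ideal_gen (Ker D) ?G"
  proof
    fix a assume a: "a \<in> image_ideal n"
    show "a \<in> ideal_gen (Ker D) ?G"
    proof (rule sum_components_in[OF G])
      fix i assume "component a i \<noteq> 0"
      then have "int n \<le> i" using a in_image_ideal_iff by (metis not_le)
      then have "component a i \<in> Ker D \<inter> B (int n + int (nat (i - int n)))"
        using a component_B[of a i] component_Ker_D unfolding in_image_ideal_iff Ker_def by simp
      then show "component a i \<in> ideal_gen (Ker D) ?G" by (rule hom)
    qed
  qed
qed

lemma ideal_pow_image_ideal: "ideal_pow (Ker D) (image_ideal i) n \<subseteq> image_ideal (i * n)"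
proof (induction n)
  case 0
  then show ?case by (simp add: image_ideal_0)
next
  case (Suc n)
  show ?case
    unfolding ideal_pow.simps
  proof (rule ideal_mult_subset[OF is_ideal_image_ideal])
    fix x y assume "x \<in> ideal_pow (Ker D) (image_ideal i) n" "y \<in> image_ideal i"
    then show "x * y \<in> image_ideal (i * Suc n)"
      using image_ideal_mult[of x "i * n" y i] Suc by (auto simp: add.commute)
  qed
qed

lemma ideal_monomial_image_ideal:
  "ideal_monomial (Ker D) image_ideal e n \<subseteq> image_ideal (\<Sum>i\<in>{1..n}. i * e i)"
proof (induction n)
  case 0
  then show ?case by (simp add: image_ideal_0)
next
  case (Suc n)
  show ?case
    unfolding ideal_monomial.simps
  proof (rule ideal_mult_subset[OF is_ideal_image_ideal])
    fix x y
    assume x: "x \<in> ideal_monomial (Ker D) image_ideal e n"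
      and y: "y \<in> ideal_pow (Ker D) (image_ideal (Suc n)) (e (Suc n))"
    have "x \<in> image_ideal (\<Sum>i\<in>{1..n}. i * e i)" using x Suc by blast
    moreover have "y \<in> image_ideal (Suc n * e (Suc n))" using y ideal_pow_image_ideal by blast
    ultimately have "x * y \<in> image_ideal ((\<Sum>i\<in>{1..n}. i * e i) + Suc n * e (Suc n))"
      by (rule image_ideal_mult)
    then show "x * y \<in> image_ideal (\<Sum>i\<in>{1..Suc n}. i * e i)" by simp
  qed
qed

text \<open>
A product of generators of \<open>I\<^sub>1\<close> of total degree \<open>p \<ge> n\<close> is distributed over the ideals \<open>I\<^sub>k\<close> factor by
factor. The ideals decrease, so the factor that would exceed the total \<open>n\<close> may be regarded as
an element of the larger ideal \<open>I\<^sub>k\<close> with the exact missing index \<open>k\<close>, and what is left over is an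
element of \<open>A\<close>.
\<close>

lemma image_ideal_eq_sum_of_monomials:
  "image_ideal n = sum_of (exponents m n) (\<lambda>e. ideal_monomial (Ker D) image_ideal e (nat m))"
proof
  let ?mon = "\<lambda>e. ideal_monomial (Ker D) image_ideal e (nat m)"
  have sub: "is_submodule (Ker D) (?mon e)" for e
    by (intro submodule_ideal ideal_ideal_monomial is_subring_Ker_D image_ideal_subset)
  have J: "is_submodule (Ker D) (sum_of (exponents m n) ?mon)" for n
    by (intro sum_of_submodule sub)
  show "sum_of (exponents m n) ?mon \<subseteq> image_ideal n"
  proof
    fix x assume "x \<in> sum_of (exponents m n) ?mon"
    from sum_ofD[OF this] obtain g T where T: "T \<subseteq> exponents m n" "\<forall>e\<in>T. g e \<in> ?mon e" "x = sum g T"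
      by (elim exE conjE) (rule that)
    have "g e \<in> image_ideal n" if "e \<in> T" for e
      using T(1) T(2)[rule_format, OF that] that ideal_monomial_image_ideal[of e "nat m"]
      unfolding exponents_def by auto
    then show "x \<in> image_ideal n"
      unfolding T(3) by (intro submodule_sum[OF submodule_ideal[OF is_ideal_image_ideal]])
  qed
  have hom: "a \<in> sum_of (exponents m n) ?mon" if "a \<in> Ker D \<inter> B p" "int n \<le> p" for a n p
    using that
  proof (induction n arbitrary: a p rule: less_induct)
    case (less n)
    show ?case
    proof (cases "n = 0")
      case True
      have "(\<lambda>_. 0) \<in> exponents m 0" unfolding exponents_def by simp
      then have "1 \<in> sum_of (exponents m 0) ?mon"
        by (rule in_sum_of) (rule one_in_ideal_monomial_0[OF is_subring_Ker_D])
      then have "a * 1 \<in> sum_of (exponents m 0) ?mon"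
        using less.prems by (intro submodule_mult[OF J]) auto
      then show ?thesis using True by simp
    next
      case False
      then obtain c where c: "\<forall>i\<in>S. c i \<in> Ker D \<inter> B (p - \<delta> i)" "a = (\<Sum>i\<in>S. c i * f i)"
        using expansion_1[OF less.prems(1)] less.prems(2) by auto
      have "c i * f i \<in> sum_of (exponents m n) ?mon" if i: "i \<in> S" for i
      proof (cases "p - \<delta> i < 0")
        case True
        then have "c i = 0"
          using D_injective_negative[of "c i" "p - \<delta> i"] c(1) i unfolding Ker_def by auto
        then show ?thesis using submodule_0[OF J] by simp
      next
        case nonneg: False
        \<comment> \<open>The index with which the factor \<open>f i\<close> is counted.\<close>
        define k where "k = min (nat (\<delta> i)) n"
        have k: "1 \<le> k" "k \<le> nat m" "int k \<le> \<delta> i" "k \<le> n"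
          using \<delta>[OF i] False unfolding k_def by auto
        have fi: "f i \<in> image_ideal k" using f[OF i] k(3) by (rule homogeneous_in_image_ideal)
        have "int (n - k) \<le> p - \<delta> i" using \<delta>[OF i] nonneg less.prems(2) unfolding k_def by auto
        then have "c i \<in> sum_of (exponents m (n - k)) ?mon"
          using c(1) i k(1) False by (intro less.IH[of _ _ "p - \<delta> i"]) auto
        from sum_ofD[OF this] obtain g T where T: "T \<subseteq> exponents m (n - k)" "\<forall>e\<in>T. g e \<in> ?mon e" "c i = sum g T"
          by (elim exE conjE) (rule that)
        have "g e * f i \<in> sum_of (exponents m n) ?mon" if "e \<in> T" for e
        proof (rule in_sum_of)
          show "e(k := Suc (e k)) \<in> exponents m n"
            using exponents_upd[of e m "n - k" k] that T(1) k by auto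
          show "g e * f i \<in> ?mon (e(k := Suc (e k)))"
            using is_subring_Ker_D image_ideal_subset fi k(1,2) T(2)[rule_format, OF that]
            by (rule ideal_monomial_times)
        qed
        then show ?thesis unfolding T(3) sum_distrib_right by (intro submodule_sum[OF J])
      qed
      then show ?thesis unfolding c(2) by (intro submodule_sum[OF J])
    qed
  qed
  show "image_ideal n \<subseteq> sum_of (exponents m n) ?mon"
  proof
    fix a assume a: "a \<in> image_ideal n"
    show "a \<in> sum_of (exponents m n) ?mon"
    proof (rule sum_components_in[OF J])
      fix i assume "component a i \<noteq> 0"
      then have "int n \<le> i" using a in_image_ideal_iff by (metis not_le)
      then show "component a i \<in> sum_of (exponents m n) ?mon"
        using a component_B[of a i] component_Ker_D
        by (intro hom[of _ i]) (auto simp: in_image_ideal_iff Ker_def)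
    qed
  qed
qed

end

end

section \<open>Filtrations by homogeneous generators\<close>

lemma is_subalgebra_hull: "is_subalgebra scale (is_subalgebra scale hull G)"
  by (rule hull_in) (auto simp: is_subalgebra_def is_subring_def)

lemma map_poly_derivation_mult:
  assumes d: "derivation d"
  shows "map_poly d (p * q) = map_poly d p * q + p * map_poly d q"
  by (rule poly_eqI)
    (simp add: coeff_mult coeff_map_poly derivation_0[OF d] derivation_sum[OF d]
      derivation_mult[OF d] sum.distrib)

lemma map_poly_derivation_add:
  assumes d: "derivation d"
  shows "map_poly d (p + q) = map_poly d p + map_poly d q"
  by (rule poly_eqI) (simp add: coeff_map_poly derivation_0[OF d] derivation_add[OF d])

context sl2_domain
begin

definition scalars :: "'b set" where "scalars = range (\<lambda>c. scale c 1)"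

lemma scale_mult_one: "scale c 1 * scale e 1 = scale (c * e) 1"
  by (simp add: scale_eq_mult[symmetric])

lemma is_subring_scalars: "is_subring scalars"
  unfolding scalars_def
proof (rule is_subringI)
  show "1 \<in> range (\<lambda>c. scale c 1)" by (rule range_eqI[of _ _ 1]) simp
  fix x y assume "x \<in> range (\<lambda>c. scale c (1::'b))" "y \<in> range (\<lambda>c. scale c (1::'b))"
  then obtain a b where ab: "x = scale a 1" "y = scale b 1" by auto
  show "x - y \<in> range (\<lambda>c. scale c 1)"
    unfolding ab scale_left_diff_distrib[symmetric] by (rule rangeI)
  show "x * y \<in> range (\<lambda>c. scale c 1)" unfolding ab scale_mult_one by (rule rangeI)
qed

lemma scalars_inverse: "x \<in> scalars \<Longrightarrow> x \<noteq> 0 \<Longrightarrow> \<exists>y\<in>scalars. y * x = 1"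
proof -
  assume "x \<in> scalars" "x \<noteq> 0"
  then obtain c where c: "x = scale c 1" "c \<noteq> 0" unfolding scalars_def by auto
  have "scale (inverse c) 1 * x = 1" unfolding c(1) scale_mult_one using c(2) by simp
  then show ?thesis unfolding scalars_def by blast
qed

lemma is_subalgebra_Ker_D: "is_subalgebra scale (Ker D)"
  unfolding is_subalgebra_def using is_subring_Ker_D by (simp add: Ker_def D_scale)

definition sl2_closed :: "(int \<times> 'b) set \<Rightarrow> bool" where
  "sl2_closed V \<longleftrightarrow> (\<forall>(w, v)\<in>V. v \<in> B w \<and> D v \<in> span {u. (w + 2, u) \<in> V} \<and>
     U v \<in> span {u. (w - 2, u) \<in> V})"

lemma sl2_closed_mono:
  assumes "sl2_closed V" "(w, v) \<in> V" "V \<subseteq> V'"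
  shows "v \<in> B w \<and> D v \<in> span {u. (w + 2, u) \<in> V'} \<and> U v \<in> span {u. (w - 2, u) \<in> V'}"
proof -
  have "span {u. (i, u) \<in> V} \<subseteq> span {u. (i, u) \<in> V'}" for i
    using assms(3) by (intro span_mono) auto
  then show ?thesis using assms(1,2) unfolding sl2_closed_def by blast
qed

lemma sl2_closed_Un:
  assumes "sl2_closed V" "sl2_closed V'"
  shows "sl2_closed (V \<union> V')"
  unfolding sl2_closed_def
proof (intro ballI, clarify)
  fix w v assume "(w, v) \<in> V \<union> V'"
  then show "v \<in> B w \<and> D v \<in> span {u. (w + 2, u) \<in> V \<union> V'} \<and>
      U v \<in> span {u. (w - 2, u) \<in> V \<union> V'}"
    using sl2_closed_mono[OF assms(1), of w v "V \<union> V'"]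
      sl2_closed_mono[OF assms(2), of w v "V \<union> V'"] by blast
qed

text \<open>
For homogeneous \<open>g\<close> the finitely many nonzero vectors \<open>U\<^sup>i D\<^sup>j g\<close> span a subspace stable under \<open>D\<close> and
\<open>U\<close>; the formula for \<open>D U\<^sup>i\<close> is the one of \<open>funpow_D_U\<close> with the operators exchanged.
\<close>

lemma finite_sl2_closed_orbit:
  assumes g: "g \<in> B w"
  shows "\<exists>V. finite V \<and> sl2_closed V \<and> (w, g) \<in> V"
proof -
  obtain M where M: "(D ^^ M) g = 0" using LND_D unfolding LND_def by blast
  have Dz: "(D ^^ j) g = 0" if "M \<le> j" for j
    using that M derivation_funpow_0[OF derivation_D, of "j - M"]
    by (metis funpow_add comp_apply le_add_diff_inverse2)
  have "\<forall>j. \<exists>n. (U ^^ n) ((D ^^ j) g) = 0" using LND_U unfolding LND_def by blast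
  then obtain n where n: "\<And>j. (U ^^ n j) ((D ^^ j) g) = 0" by metis
  define N where "N = Max (n ` {..M}) + M"
  have Uz: "(U ^^ i) ((D ^^ j) g) = 0" if "N \<le> i" for i j
  proof (cases "j \<le> M")
    case True
    then have "n j \<le> Max (n ` {..M})" by (intro Max_ge) auto
    then have "n j \<le> N" unfolding N_def by simp
    then have "n j \<le> i" using that by simp
    then show ?thesis
      using n[of j] derivation_funpow_0[OF derivation_U, of "i - n j"]
      by (metis funpow_add comp_apply le_add_diff_inverse2)
  next
    case False
    then show ?thesis using Dz[of j] derivation_funpow_0[OF derivation_U] by simp
  qed
  define e where "e i j = (U ^^ i) ((D ^^ j) g)" for i j
  define V where "V = (\<lambda>(i, j). (w + 2 * int j - 2 * int i, e i j)) ` ({..N} \<times> {..N})"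
  have eB: "e i j \<in> B (w + 2 * int j - 2 * int i)" for i j
  proof -
    interpret swap: weight_module scale "\<lambda>n. B (- n)" U D by (rule swap)
    show ?thesis
      using swap.funpow_D_M[of "(D ^^ j) g" "- (w + 2 * int j)" i] funpow_D_M[OF g, of j]
      unfolding e_def by (simp add: algebra_simps)
  qed
  have e_span: "e i j \<in> span {u. (x, u) \<in> V}" if "x = w + 2 * int j - 2 * int i" for i j x
  proof (cases "i \<le> N \<and> j \<le> N")
    case True
    then have "(x, e i j) \<in> V"
      unfolding V_def that by (intro image_eqI[of _ _ "(i, j)"]) auto
    then show ?thesis by (intro span_base) simp
  next
    case False
    then have "e i j = 0"
      using Uz[of i j] Dz[of j] derivation_funpow_0[OF derivation_U] unfolding e_def N_def
      by (auto simp: not_le)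
    then show ?thesis by (simp add: span_zero)
  qed
  have "sl2_closed V"
    unfolding sl2_closed_def
  proof (clarsimp)
    fix x v assume "(x, v) \<in> V"
    then obtain i j where x: "x = w + 2 * int j - 2 * int i" and v: "v = e i j"
      unfolding V_def by auto
    have "U v = e (Suc i) j" unfolding v e_def by simp
    moreover have "e (Suc i) j \<in> span {u. (x - 2, u) \<in> V}" by (rule e_span) (simp add: x)
    moreover have "D v \<in> span {u. (x + 2, u) \<in> V}"
    proof (cases i)
      case 0
      have "e 0 (Suc j) \<in> span {u. (x + 2, u) \<in> V}" by (rule e_span) (simp add: x 0)
      then show ?thesis unfolding v 0 e_def by simp
    next
      case (Suc i')
      interpret swap: weight_module scale "\<lambda>n. B (- n)" U D by (rule swap)
      have "(D ^^ j) g \<in> B (- (- (w + 2 * int j)))" unfolding minus_minus by (rule funpow_D_M[OF g])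
      from swap.funpow_D_U[OF this, of i']
      have "e i (Suc j) = D v
          + scale (of_int ((int i' + 1) * (- (w + 2 * int j) + int i'))) (e i' j)"
        unfolding v Suc e_def by simp
      then have "D v = e i (Suc j)
          - scale (of_int ((int i' + 1) * (- (w + 2 * int j) + int i'))) (e i' j)"
        by simp
      moreover have "e i (Suc j) \<in> span {u. (x + 2, u) \<in> V}" by (rule e_span) (simp add: x)
      moreover have "e i' j \<in> span {u. (x + 2, u) \<in> V}" by (rule e_span) (simp add: x Suc)
      ultimately show ?thesis by (auto intro: span_diff span_scale)
    qed
    ultimately show "v \<in> B x \<and> D v \<in> span {u. (x + 2, u) \<in> V} \<and> U v \<in> span {u. (x - 2, u) \<in> V}"
      using eB x v by simp
  qed
  moreover have "(w, g) \<in> V" unfolding V_def e_def by (intro image_eqI[of _ _ "(0, 0)"]) auto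
  moreover have "finite V" unfolding V_def by simp
  ultimately show ?thesis by blast
qed

lemma finite_sl2_closed_superset:
  assumes "finite G" "\<And>w g. (w, g) \<in> G \<Longrightarrow> g \<in> B w"
  shows "\<exists>V. finite V \<and> sl2_closed V \<and> G \<subseteq> V"
  using assms
proof (induction G)
  case empty
  then show ?case by (intro exI[of _ "{}"]) (simp add: sl2_closed_def)
next
  case (insert x G)
  obtain V where V: "finite V" "sl2_closed V" "G \<subseteq> V" using insert.IH insert.prems by auto
  obtain w g where x: "x = (w, g)" by (cases x)
  have "g \<in> B w" by (rule insert.prems) (simp add: x)
  then obtain V' where V': "finite V'" "sl2_closed V'" "(w, g) \<in> V'"
    using finite_sl2_closed_orbit by blast
  show ?case
    using V V' sl2_closed_Un[of V V'] x by (intro exI[of _ "V \<union> V'"]) auto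
qed

lemma homogeneous_generators:
  assumes "fin_gen_algebra scale (UNIV :: 'b set)"
  shows "\<exists>V. finite V \<and> sl2_closed V \<and> (0, 1) \<in> V \<and> is_subalgebra scale hull (snd ` V) = UNIV"
proof -
  obtain G where G: "finite G" "UNIV = is_subalgebra scale hull G"
    using assms unfolding fin_gen_algebra_def by blast
  define H where "H = insert (0, 1) (\<Union>g\<in>G. (\<lambda>i. (i, component g i)) ` {i. component g i \<noteq> 0})"
  have "finite H" unfolding H_def using G(1) finite_support by simp
  moreover have "g \<in> B w" if "(w, g) \<in> H" for w g
    using that component_B one_B unfolding H_def by auto
  ultimately obtain V where V: "finite V" "sl2_closed V" "H \<subseteq> V"
    using finite_sl2_closed_superset[of H] by blast
  let ?A = "is_subalgebra scale hull (snd ` V)"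
  have A: "is_subring ?A" using is_subalgebra_hull[of scale "snd ` V"] unfolding is_subalgebra_def by blast
  have "G \<subseteq> ?A"
  proof
    fix g assume g: "g \<in> G"
    have "component g i \<in> ?A" if "component g i \<noteq> 0" for i
    proof -
      have "(i, component g i) \<in> V" using V(3) g that unfolding H_def by auto
      then have "component g i \<in> snd ` V" by force
      then show ?thesis by (rule hull_inc)
    qed
    then have "sum (component g) {i. component g i \<noteq> 0} \<in> ?A" by (intro subring_sum[OF A]) simp
    then show "g \<in> ?A" by (simp add: sum_components)
  qed
  then have "is_subalgebra scale hull G \<subseteq> ?A" by (intro hull_minimal is_subalgebra_hull)
  then have "?A = UNIV" using G(2) by auto
  then show ?thesis using V unfolding H_def by blast
qed

end

text \<open>
A finite set of homogeneous algebra generators, each with its weight, whose span is stable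
under \<open>D\<close> and \<open>U\<close>. Including \<open>1\<close> makes the filtration by word length increasing.
\<close>

locale sl2_generators = sl2_domain scale D U
  for scale :: "'k::field_char_0 \<Rightarrow> 'b::idom \<Rightarrow> 'b" and D U :: "'b \<Rightarrow> 'b" +
  fixes V :: "(int \<times> 'b) set"
  assumes finite_V: "finite V" and V: "sl2_closed V" and one_V: "(0, 1) \<in> V"
    and gen_V: "is_subalgebra scale hull (snd ` V) = UNIV"
begin

text \<open>
\<open>filt (p, w) x\<close> says that \<open>x\<close> is a combination of products of \<open>p\<close> generators of total weight \<open>w\<close>.
\<close>

abbreviation filt :: "int \<times> int \<Rightarrow> 'b \<Rightarrow> bool" where
  "filt \<equiv> graded_span scalars ((\<lambda>(w, v). ((1, w), v)) ` V)"

lemma filt_gen: "(w, v) \<in> V \<Longrightarrow> filt (p, i) x \<Longrightarrow> filt (p + 1, i + w) (v * x)"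
proof -
  assume "(w, v) \<in> V" and x: "filt (p, i) x"
  then have "((1, w), v) \<in> (\<lambda>(w, v). ((1 :: int, w), v)) ` V"
    by (intro image_eqI[of _ _ "(w, v)"]) auto
  from graded_span.gen[OF this x] show ?thesis by (simp add: add.commute)
qed

lemma filt_one: "filt (0, 0) 1"
  unfolding zero_prod_def[symmetric] by (rule graded_span.const[OF subring_1[OF is_subring_scalars]])

lemma filt_induct [consumes 1, case_names zero add const gen]:
  assumes "filt (p, w) x"
    and "\<And>p w. P p w 0"
    and "\<And>p w x y. filt (p, w) x \<Longrightarrow> P p w x \<Longrightarrow> filt (p, w) y \<Longrightarrow> P p w y \<Longrightarrow> P p w (x + y)"
    and "\<And>c. P 0 0 (scale c 1)"
    and "\<And>i v p w x. (i, v) \<in> V \<Longrightarrow> filt (p, w) x \<Longrightarrow> P p w x \<Longrightarrow> P (p + 1) (w + i) (v * x)"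
  shows "P p w x"
proof -
  have "P (fst g) (snd g) x" if "filt g x" for g x
    using that
  proof induction
    case (const c)
    then show ?case using assms(4) unfolding scalars_def by auto
  next
    case (gen h v g x)
    then show ?case using assms(5)[of "snd h" v "fst g" "snd g" x] by (auto simp: add.commute)
  qed (use assms(2,3) in auto)
  from this[OF assms(1)] show ?thesis by simp
qed

lemma filt_scale: "filt g x \<Longrightarrow> filt g (scale c x)"
  using graded_span_const_mult[OF is_subring_scalars, of "scale c 1"]
  by (subst scale_eq_mult) (auto simp: scalars_def)

lemma filt_of_int_mult: "filt g x \<Longrightarrow> filt g (of_int n * x)"
  using filt_scale[of g x "of_int n"] by (simp add: scale_of_int)

lemma filt_mult: "filt (p, w) x \<Longrightarrow> filt (q, i) y \<Longrightarrow> filt (p + q, w + i) (x * y)"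
  using graded_span_mult[OF is_subring_scalars, of _ "(p, w)" x "(q, i)" y] by simp

lemma filt_B: "filt (p, w) x \<Longrightarrow> x \<in> B w"
proof (induction rule: filt_induct)
  case (gen i v p w x)
  then have "v \<in> B i" using V unfolding sl2_closed_def by blast
  then show ?case using B_mult[OF _ gen(3)] by (simp add: add.commute)
qed (auto intro: zero_B scale_one_B subspace_add subspace_B)

text \<open>
By the Leibniz rule it suffices to know the derivation on the generators.
\<close>

lemma filt_derivation:
  assumes T: "derivation T" "\<And>c. T (scale c 1) = 0"
    and V_T: "\<And>w v. (w, v) \<in> V \<Longrightarrow> T v \<in> span {u. (w + k, u) \<in> V}"
  shows "filt (p, w) x \<Longrightarrow> filt (p, w + k) (T x)"
proof (induction rule: filt_induct)
  case (gen i v p w x)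
  have "filt (p + 1, w + i + k) (u * x)" if "u \<in> span {u. (i + k, u) \<in> V}" for u
    using that
  proof (induction rule: span_induct_alt)
    case base
    then show ?case by (simp add: graded_span.zero)
  next
    case (step c y z)
    have "filt (p + 1, w + i + k) (y * x)"
      using filt_gen[of "i + k" y p w x] gen(2) step(1) by (simp add: ac_simps)
    then have "filt (p + 1, w + i + k) (scale c y * x)"
      using filt_scale[of _ "y * x" c] by (simp add: k_domain_scale_mult[OF k_domain])
    then show ?case using step(2) by (simp add: distrib_right graded_span.add)
  qed
  then have "filt (p + 1, w + i + k) (T v * x)" using V_T gen(1) by blast
  moreover have "filt (p + 1, w + i + k) (v * T x)"
    using filt_gen[OF gen(1,3)] by (simp add: ac_simps)
  ultimately show ?case by (simp add: derivation_mult[OF T(1)] graded_span.add)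
qed (auto simp: derivation_0[OF T(1)] derivation_add[OF T(1)] T(2)
    intro: graded_span.zero graded_span.add)

lemma filt_D: "filt (p, w) x \<Longrightarrow> filt (p, w + 2) (D x)"
  by (rule filt_derivation[OF derivation_D])
    (use V in \<open>auto simp: sl2_closed_def D_scale derivation_1[OF derivation_D]\<close>)

lemma filt_U: "filt (p, w) x \<Longrightarrow> filt (p, w - 2) (U x)"
  using filt_derivation[OF derivation_U, of "- 2" p w x] V
  by (auto simp: sl2_closed_def U_scale derivation_1[OF derivation_U])

lemma filt_funpow_U: "filt (p, w) x \<Longrightarrow> filt (p, w - 2 * int j) ((U ^^ j) x)"
proof (induction j)
  case (Suc j)
  then show ?case using filt_U[of p "w - 2 * int j" "(U ^^ j) x"] by (simp add: algebra_simps)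
qed simp

lemma filt_nonpos: "filt (p, w) x \<Longrightarrow> (p < 0 \<longrightarrow> x = 0) \<and> (p = 0 \<longrightarrow> x \<in> scalars)"
proof (induction rule: filt_induct)
  case (add p w x y)
  then show ?case using subring_add[OF is_subring_scalars] by auto
next
  case (gen i v p w x)
  then show ?case using subring_0[OF is_subring_scalars] by auto
qed (use subring_0[OF is_subring_scalars] in \<open>auto simp: scalars_def\<close>)

lemma filt_mono:
  assumes "filt (p, w) x" "p \<le> q"
  shows "filt (q, w) x"
  using assms(2)
proof (induction q rule: int_ge_induct)
  case base
  show ?case by (rule assms(1))
next
  case (step q)
  then show ?case using filt_gen[OF one_V, of q w x] by simp
qed

text \<open>
The weights of products of \<open>p\<close> generators are bounded in absolute value by \<open>p\<close> times the
largest absolute value of the weight of a generator.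
\<close>

lemma filt_bounded: "\<exists>c. \<forall>p w x. filt (p, w) x \<longrightarrow> c * p < \<bar>w\<bar> \<longrightarrow> x = 0"
proof -
  define c where "c = Max ((\<lambda>(w, v). \<bar>w\<bar>) ` V)"
  have c: "\<bar>w\<bar> \<le> c" if "(w, v) \<in> V" for w v
    unfolding c_def using finite_V that by (intro Max_ge) force+
  have "c * p < \<bar>w\<bar> \<longrightarrow> x = 0" if "filt (p, w) x" for p w x
    using that
  proof (induction rule: filt_induct)
    case (gen i v p w x)
    show ?case
    proof
      assume "c * (p + 1) < \<bar>w + i\<bar>"
      then have "c * p < \<bar>w\<bar>" using c[OF gen(1)] by (simp add: algebra_simps)
      then show "v * x = 0" using gen(3) by simp
    qed
  qed auto
  then show ?thesis by blast
qed

lemma filt_sum_exhausts: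
  assumes "\<And>i. i \<in> S \<Longrightarrow> \<exists>p. filt (p, w) (f i)"
  shows "\<exists>p. filt (p, w) (sum f S)"
  using assms
proof (induction S rule: infinite_finite_induct)
  case (insert i S)
  then obtain p q where "filt (p, w) (f i)" "filt (q, w) (sum f S)" by (meson insertCI)
  then have "filt (max p q, w) (f i + sum f S)"
    using filt_mono[of p w "f i" "max p q"] filt_mono[of q w "sum f S" "max p q"]
    by (intro graded_span.add) auto
  then show ?case using insert.hyps by auto
qed (auto intro: graded_span.zero)

lemma filt_exhausts: "x \<in> B w \<Longrightarrow> \<exists>p. filt (p, w) x"
proof -
  let ?Q = "{x. \<forall>w. \<exists>p. filt (p, w) (component x w)}"
  have "is_subalgebra scale ?Q"
    unfolding is_subalgebra_def
  proof (intro conjI allI ballI is_subringI)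
    show "1 \<in> ?Q"
      using filt_one component_homogeneous[OF one_B] by (auto intro: graded_span.zero)
  next
    fix x y assume x: "x \<in> ?Q" and y: "y \<in> ?Q"
    show "x - y \<in> ?Q"
    proof (intro CollectI allI)
      fix w
      obtain p q where "filt (p, w) (component x w)" "filt (q, w) (component y w)"
        using x y by blast
      then have "filt (max p q, w) (component x w - component y w)"
        using filt_mono[of p w _ "max p q"] filt_mono[of q w _ "max p q"]
        by (intro graded_span_diff[OF is_subring_scalars]) auto
      then show "\<exists>p. filt (p, w) (component (x - y) w)" unfolding component_diff by blast
    qed
    show "x * y \<in> ?Q"
    proof (intro CollectI allI)
      fix w
      show "\<exists>p. filt (p, w) (component (x * y) w)"
        unfolding component_times
      proof (rule filt_sum_exhausts)
        fix j
        obtain p q where "filt (p, j) (component x j)" "filt (q, w - j) (component y (w - j))"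
          using x y by blast
        from filt_mult[OF this] show "\<exists>p. filt (p, w) (component x j * component y (w - j))"
          by auto
      qed
    qed
  next
    fix c x assume x: "x \<in> ?Q"
    show "scale c x \<in> ?Q"
    proof (intro CollectI allI)
      fix w
      obtain p where "filt (p, w) (component x w)" using x by blast
      from filt_scale[OF this, of c] show "\<exists>p. filt (p, w) (component (scale c x) w)"
        unfolding component_scale by blast
    qed
  qed
  moreover have "snd ` V \<subseteq> ?Q"
  proof clarify
    fix w v i assume v: "(w, v) \<in> V"
    from filt_gen[OF v filt_one] have fv: "filt (1, w) v" by simp
    then show "\<exists>p. filt (p, i) (component (snd (w, v)) i)"
      using component_homogeneous[OF filt_B[OF fv], of i] by (auto intro: graded_span.zero)
  qed
  ultimately have "is_subalgebra scale hull (snd ` V) \<subseteq> ?Q" by (intro hull_minimal)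
  then have "x \<in> ?Q" using gen_V by auto
  then obtain p where "filt (p, w) (component x w)" by blast
  moreover assume "x \<in> B w"
  then have "component x w = x" by (simp add: component_homogeneous)
  ultimately show "\<exists>p. filt (p, w) x" by auto
qed

end

section \<open>Covariants and the finite generation of the kernel\<close>

context sl2_domain
begin

text \<open>
On forms of degree \<open>d\<close> in \<open>x, y\<close> with coefficients in \<open>B\<close> the operators \<open>D + x d/dy\<close> and
\<open>U + y d/dx\<close> satisfy the relations of \<open>sl\<^sub>2\<close>, where \<open>x\<close> has weight \<open>1\<close> and \<open>y\<close> weight \<open>- 1\<close>. Setting
\<open>y = 1\<close> turns them into \<open>D + d X - X\<^sup>2 d/dX\<close> and \<open>U + d/dX\<close> on polynomials of degree at most \<open>d\<close>.
\<close>

definition poly_D :: "int \<Rightarrow> 'b poly \<Rightarrow> 'b poly" where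
  "poly_D d q = map_poly D q + [:0, of_int d:] * q - [:0, 0, 1:] * pderiv q"

definition poly_U :: "'b poly \<Rightarrow> 'b poly" where
  "poly_U q = map_poly U q + pderiv q"

lemma coeff_poly_D_0: "coeff (poly_D d q) 0 = D (coeff q 0)"
  unfolding poly_D_def by (simp add: coeff_map_poly D_0)

lemma coeff_poly_D_Suc:
  "coeff (poly_D d q) (Suc j) = D (coeff q (Suc j)) + of_int (d - int j) * coeff q j"
  unfolding poly_D_def
  by (cases j) (simp_all add: coeff_map_poly D_0 coeff_pderiv algebra_simps)

lemma coeff_poly_U: "coeff (poly_U q) j = U (coeff q j) + of_int (int j + 1) * coeff q (Suc j)"
  unfolding poly_U_def by (simp add: coeff_map_poly U_0 coeff_pderiv algebra_simps)

text \<open>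
The Leibniz rule for forms of degrees \<open>d\<close> and \<open>e\<close>.
\<close>

lemma poly_D_mult: "poly_D (d + e) (p * q) = poly_D d p * q + p * poly_D e q"
proof -
  have "[:0, of_int (d + e):] = [:0, of_int d:] + [:0, of_int e :: 'b:]" by simp
  then show ?thesis
    unfolding poly_D_def map_poly_derivation_mult[OF derivation_D] pderiv_mult
    by (simp only: algebra_simps)
qed

lemma poly_U_mult: "poly_U (p * q) = poly_U p * q + p * poly_U q"
  unfolding poly_U_def map_poly_derivation_mult[OF derivation_U] pderiv_mult
  by (simp only: algebra_simps)

lemma poly_D_add: "poly_D d (p + q) = poly_D d p + poly_D d q"
  unfolding poly_D_def map_poly_derivation_add[OF derivation_D] pderiv_add
  by (simp only: algebra_simps)

lemma poly_U_add: "poly_U (p + q) = poly_U p + poly_U q"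
  unfolding poly_U_def map_poly_derivation_add[OF derivation_U] pderiv_add
  by (simp only: algebra_simps)

lemma poly_D_0: "poly_D d 0 = 0" and poly_U_0: "poly_U 0 = 0"
  unfolding poly_D_def poly_U_def by simp_all

lemma poly_D_sum: "poly_D d (sum f S) = (\<Sum>s\<in>S. poly_D d (f s))"
  by (induction S rule: infinite_finite_induct) (simp_all add: poly_D_0 poly_D_add)

lemma poly_U_sum: "poly_U (sum f S) = (\<Sum>s\<in>S. poly_U (f s))"
  by (induction S rule: infinite_finite_induct) (simp_all add: poly_U_0 poly_U_add)

lemma poly_D_diff: "poly_D d (p - q) = poly_D d p - poly_D d q"
  using poly_D_add[of d "p - q" q] by simp

abbreviation poly_scale :: "'k \<Rightarrow> 'b poly \<Rightarrow> 'b poly" where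
  "poly_scale c \<equiv> smult (scale c 1)"

lemma coeff_poly_scale: "coeff (poly_scale c q) j = scale c (coeff q j)"
  by (simp add: scale_eq_mult[symmetric])

lemma vector_space_poly: "vector_space poly_scale"
  by unfold_locales
    (simp_all add: smult_add_right smult_add_left scale_left_distrib scale_mult_one)

lemma linear_poly_D: "Vector_Spaces.linear poly_scale poly_scale (poly_D d)"
proof -
  interpret poly: vector_space poly_scale by (rule vector_space_poly)
  have "poly_D d (poly_scale c q) = poly_scale c (poly_D d q)" for c q
  proof (rule poly_eqI)
    fix j
    show "coeff (poly_D d (poly_scale c q)) j = coeff (poly_scale c (poly_D d q)) j"
      by (cases j) (simp_all only: coeff_poly_scale coeff_poly_D_0 coeff_poly_D_Suc D_scale
          scale_right_distrib scale_of_int[symmetric] scale_left_commute)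
  qed
  then show ?thesis by unfold_locales (simp_all only: poly_D_add)
qed

lemma linear_poly_U: "Vector_Spaces.linear poly_scale poly_scale poly_U"
proof -
  interpret poly: vector_space poly_scale by (rule vector_space_poly)
  have "poly_U (poly_scale c q) = poly_scale c (poly_U q)" for c q
    by (rule poly_eqI) (simp only: coeff_poly_scale coeff_poly_U U_scale
        scale_right_distrib scale_of_int[symmetric] scale_left_commute)
  then show ?thesis by unfold_locales (simp_all only: poly_U_add)
qed

end

context sl2_generators
begin

text \<open>
Forms of degree \<open>d\<close> and weight \<open>w\<close> with coefficients in step \<open>p\<close> of the filtration: the monomial
\<open>x\<^sup>j y\<^sup>d\<^sup>-\<^sup>j\<close> has weight \<open>2 j - d\<close>.
\<close>

definition poly_piece :: "int \<Rightarrow> int \<Rightarrow> int \<Rightarrow> 'b poly set" where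
  "poly_piece p d w =
    {q. \<forall>j. filt (p, w + d - 2 * int j) (coeff q j) \<and> (d < int j \<longrightarrow> coeff q j = 0)}"

lemma poly_pieceD:
  assumes "q \<in> poly_piece p d w"
  shows "i = w + d - 2 * int j \<Longrightarrow> filt (p, i) (coeff q j)" "d < int j \<Longrightarrow> coeff q j = 0"
  using assms unfolding poly_piece_def by auto

lemma poly_pieceI:
  assumes "\<And>j. filt (p, w + d - 2 * int j) (coeff q j)" "\<And>j. d < int j \<Longrightarrow> coeff q j = 0"
  shows "q \<in> poly_piece p d w"
  using assms unfolding poly_piece_def by auto

lemma poly_D_piece:
  assumes q: "q \<in> poly_piece p d w"
  shows "poly_D d q \<in> poly_piece p d (w + 2)"
proof (rule poly_pieceI)
  fix j
  show "filt (p, w + 2 + d - 2 * int j) (coeff (poly_D d q) j)"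
  proof (cases j)
    case 0
    show ?thesis
      using filt_D[OF poly_pieceD(1)[OF q refl, of 0]]
      by (simp add: 0 coeff_poly_D_0 algebra_simps)
  next
    case (Suc i)
    have "filt (p, w + 2 + d - 2 * int j) (D (coeff q (Suc i)))"
      using filt_D[OF poly_pieceD(1)[OF q refl, of "Suc i"]] by (simp add: Suc algebra_simps)
    moreover have "filt (p, w + 2 + d - 2 * int j) (of_int (d - int i) * coeff q i)"
      by (rule filt_of_int_mult, rule poly_pieceD(1)[OF q]) (simp add: Suc)
    ultimately show ?thesis unfolding Suc coeff_poly_D_Suc by (rule graded_span.add)
  qed
  assume j: "d < int j"
  show "coeff (poly_D d q) j = 0"
  proof (cases j)
    case 0
    then show ?thesis using poly_pieceD(2)[OF q, of 0] j by (simp add: coeff_poly_D_0 D_0)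
  next
    case (Suc i)
    then have "coeff q (Suc i) = 0" using poly_pieceD(2)[OF q, of j] j by simp
    moreover have "d = int i \<or> coeff q i = 0" using poly_pieceD(2)[OF q, of i] Suc j by linarith
    ultimately show ?thesis unfolding Suc coeff_poly_D_Suc by (auto simp: D_0)
  qed
qed

lemma poly_U_piece:
  assumes q: "q \<in> poly_piece p d w"
  shows "poly_U q \<in> poly_piece p d (w - 2)"
proof (rule poly_pieceI)
  fix j
  have "filt (p, w - 2 + d - 2 * int j) (U (coeff q j))"
    using filt_U[OF poly_pieceD(1)[OF q refl, of j]] by (simp add: algebra_simps)
  moreover have "filt (p, w - 2 + d - 2 * int j) (of_int (int j + 1) * coeff q (Suc j))"
    by (rule filt_of_int_mult, rule poly_pieceD(1)[OF q]) simp
  ultimately show "filt (p, w - 2 + d - 2 * int j) (coeff (poly_U q) j)"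
    unfolding coeff_poly_U by (rule graded_span.add)
  assume "d < int j"
  then show "coeff (poly_U q) j = 0"
    using poly_pieceD(2)[OF q, of j] poly_pieceD(2)[OF q, of "Suc j"]
    by (simp add: coeff_poly_U U_0)
qed

lemma poly_commutator:
  assumes q: "q \<in> poly_piece p d w"
  shows "poly_D d (poly_U q) = poly_U (poly_D d q) + poly_scale (of_int w) q"
proof (rule poly_eqI)
  fix j
  have comm: "D (U (coeff q j)) = U (D (coeff q j)) + of_int (w + d - 2 * int j) * coeff q j" for j
    using commutator[OF filt_B[OF poly_pieceD(1)[OF q refl, of j]]] unfolding scale_of_int .
  note D_int = derivation_of_int_mult[OF derivation_D] and U_int = derivation_of_int_mult[OF derivation_U]
  show "coeff (poly_D d (poly_U q)) j = coeff (poly_U (poly_D d q) + poly_scale (of_int w) q) j"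
  proof (cases j)
    case 0
    show ?thesis
      unfolding 0 coeff_add coeff_poly_scale scale_of_int coeff_poly_D_0 coeff_poly_U
        coeff_poly_D_Suc D_add U_add D_int U_int comm
      by (simp add: algebra_simps)
  next
    case (Suc i)
    show ?thesis
      unfolding Suc coeff_add coeff_poly_scale scale_of_int coeff_poly_U
        coeff_poly_D_Suc D_add U_add D_int U_int comm
      by (simp add: algebra_simps)
  qed
qed

lemma poly_piece_bounded: "\<exists>n::nat. \<forall>w. int n < \<bar>w\<bar> \<longrightarrow> poly_piece p d w \<subseteq> {0}"
proof -
  obtain c where c: "\<And>p w x. filt (p, w) x \<Longrightarrow> c * p < \<bar>w\<bar> \<Longrightarrow> x = 0" using filt_bounded by blast
  have "q = 0" if w: "int (nat (\<bar>c * p\<bar> + \<bar>d\<bar>)) < \<bar>w\<bar>" and q: "q \<in> poly_piece p d w" for q w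
  proof (rule poly_eqI)
    fix j
    have "coeff q j = 0" if "int j \<le> d"
    proof (rule c[OF poly_pieceD(1)[OF q refl]])
      show "c * p < \<bar>w + d - 2 * int j\<bar>" using w that by linarith
    qed
    then show "coeff q j = coeff 0 j" using poly_pieceD(2)[OF q, of j] by fastforce
  qed
  then show ?thesis by blast
qed

lemma weight_module_poly: "weight_module poly_scale (poly_piece p d) (poly_D d) poly_U"
proof (intro weight_module.intro vector_space_poly weight_module_axioms.intro
    linear_poly_D linear_poly_U)
  show "module.subspace poly_scale (poly_piece p d n)" for n
  proof -
    interpret poly: vector_space poly_scale by (rule vector_space_poly)
    show ?thesis
      unfolding poly.subspace_def
    proof (intro conjI ballI allI)
      show "0 \<in> poly_piece p d n" by (rule poly_pieceI) (simp_all add: graded_span.zero)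
      fix x y assume "x \<in> poly_piece p d n" "y \<in> poly_piece p d n"
      then show "x + y \<in> poly_piece p d n"
        using poly_pieceD[of x p d n] poly_pieceD[of y p d n]
        by (intro poly_pieceI) (simp_all add: graded_span.add)
    next
      fix c x assume "x \<in> poly_piece p d n"
      then show "poly_scale c x \<in> poly_piece p d n"
        using poly_pieceD[of x p d n]
        by (intro poly_pieceI) (simp_all only: coeff_poly_scale filt_scale scale_zero_right)
    qed
  qed
  have piece_D: "((poly_D d) ^^ j) q \<in> poly_piece p d (w + 2 * int j)" if "q \<in> poly_piece p d w" for j q w
  proof (induction j)
    case (Suc j)
    then show ?case using poly_D_piece[OF Suc] by (simp add: algebra_simps)
  qed (use that in simp)
  have piece_U: "(poly_U ^^ j) q \<in> poly_piece p d (w - 2 * int j)" if "q \<in> poly_piece p d w" for j q w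
  proof (induction j)
    case (Suc j)
    then show ?case using poly_U_piece[OF Suc] by (simp add: algebra_simps)
  qed (use that in simp)
  obtain n :: nat where n: "\<And>w. int n < \<bar>w\<bar> \<Longrightarrow> poly_piece p d w \<subseteq> {0}"
    using poly_piece_bounded by blast
  show "\<exists>j. ((poly_D d) ^^ j) q = 0" "\<exists>j. (poly_U ^^ j) q = 0" if q: "q \<in> poly_piece p d w" for q w
  proof -
    let ?j = "nat (\<bar>w\<bar>) + n + 1"
    have j: "int ?j = \<bar>w\<bar> + int n + 1" by simp
    have abs: "- w \<le> \<bar>w\<bar>" "w \<le> \<bar>w\<bar>" "0 \<le> int n" "0 \<le> \<bar>w\<bar>" by simp_all
    have "int n < w + 2 * int ?j" unfolding j using abs by (simp add: algebra_simps)
    then have "int n < \<bar>w + 2 * int ?j\<bar>" by linarith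
    then show "\<exists>j. ((poly_D d) ^^ j) q = 0"
      using n[of "w + 2 * int ?j"] piece_D[OF q, of ?j] by blast
    have "int n < - (w - 2 * int ?j)" unfolding j using abs by (simp add: algebra_simps)
    then have "int n < \<bar>w - 2 * int ?j\<bar>" by linarith
    then show "\<exists>j. (poly_U ^^ j) q = 0"
      using n[of "w - 2 * int ?j"] piece_U[OF q, of ?j] by blast
  qed
qed (auto intro: poly_D_piece poly_U_piece poly_commutator)

lemma poly_piece_mult:
  assumes x: "x \<in> poly_piece p d w" and y: "y \<in> poly_piece p' d' w'"
  shows "x * y \<in> poly_piece (p + p') (d + d') (w + w')"
proof (rule poly_pieceI)
  fix j
  show "filt (p + p', w + w' + (d + d') - 2 * int j) (coeff (x * y) j)"
    unfolding coeff_mult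
  proof (rule graded_span_sum)
    fix i assume "i \<in> {..j}"
    then show "filt (p + p', w + w' + (d + d') - 2 * int j) (coeff x i * coeff y (j - i))"
      using filt_mult[OF poly_pieceD(1)[OF x refl, of i] poly_pieceD(1)[OF y refl, of "j - i"]]
      by (simp add: algebra_simps of_nat_diff)
  qed
  assume j: "d + d' < int j"
  have "coeff x i * coeff y (j - i) = 0" if "i \<le> j" for i
  proof (cases "d < int i")
    case True
    then show ?thesis using poly_pieceD(2)[OF x] by simp
  next
    case False
    then have "d' < int (j - i)" using j that by linarith
    then show ?thesis using poly_pieceD(2)[OF y] by simp
  qed
  then show "coeff (x * y) j = 0" unfolding coeff_mult by (intro sum.neutral) auto
qed

text \<open>
Generators of the Rees algebra of \<open>B[x, y]\<close> with their degrees: filtration step, degree as a form, and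
weight. The variable \<open>y\<close> is represented by \<open>1\<close>.
\<close>

abbreviation poly_gens :: "((int \<times> int \<times> int) \<times> 'b poly) set" where
  "poly_gens \<equiv> (\<lambda>(w, v). ((1, 0, w), [:v:])) ` V \<union> {((0, 1, -1), 1), ((0, 1, 1), [:0, 1:])}"

abbreviation poly_scalars :: "'b poly set" where
  "poly_scalars \<equiv> (\<lambda>c. [:c:]) ` scalars"

abbreviation poly_filt :: "int \<times> int \<times> int \<Rightarrow> 'b poly \<Rightarrow> bool" where
  "poly_filt \<equiv> graded_span poly_scalars poly_gens"

lemma is_subring_poly_scalars: "is_subring poly_scalars"
proof (rule is_subringI)
  show "1 \<in> poly_scalars" using imageI[OF subring_1[OF is_subring_scalars], of "\<lambda>c. [:c:]"]
    by (simp add: one_pCons)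
  fix x y assume "x \<in> poly_scalars" "y \<in> poly_scalars"
  then obtain a b where ab: "a \<in> scalars" "b \<in> scalars" "x = [:a:]" "y = [:b:]" by blast
  show "x - y \<in> poly_scalars"
    using imageI[OF subring_diff[OF is_subring_scalars ab(1,2)], of "\<lambda>c. [:c:]"] ab(3,4) by simp
  show "x * y \<in> poly_scalars"
    using imageI[OF subring_mult[OF is_subring_scalars ab(1,2)], of "\<lambda>c. [:c:]"] ab(3,4)
    by (simp add: mult.commute)
qed

lemma poly_scalars_inverse:
  assumes "x \<in> poly_scalars" "x \<noteq> 0"
  shows "\<exists>y\<in>poly_scalars. y * x = 1"
proof -
  obtain a where a: "a \<in> scalars" "x = [:a:]" "a \<noteq> 0" using assms by auto
  then obtain b where "b \<in> scalars" "b * a = 1" using scalars_inverse by blast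
  then show ?thesis using a(2) by (intro bexI[of _ "[:b:]"]) (auto simp: one_pCons mult.commute)
qed

lemma poly_filt_piece: "poly_filt (p, d, w) q \<Longrightarrow> q \<in> poly_piece p d w"
proof -
  have "q \<in> poly_piece (fst g) (fst (snd g)) (snd (snd g))" if "poly_filt g q" for g q
    using that
  proof induction
    case (zero g)
    then show ?case by (intro poly_pieceI) (auto intro: graded_span.zero)
  next
    case (add g x y)
    then show ?case
      by (intro poly_pieceI) (auto intro: graded_span.add poly_pieceD[OF add.IH(1)] poly_pieceD[OF add.IH(2)]
          simp: poly_pieceD(2)[OF add.IH(1)] poly_pieceD(2)[OF add.IH(2)])
  next
    case (const c)
    then obtain a where a: "a \<in> scalars" "c = [:a:]" by blast
    then have "filt (0, 0) a"
      unfolding zero_prod_def[symmetric] by (intro graded_span.const)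
    then show ?case
      by (intro poly_pieceI) (auto simp: a coeff_pCons intro: graded_span.zero split: nat.splits)
  next
    case (gen h v g x)
    have one: "1 \<in> poly_piece 0 1 (- 1)"
      using filt_one by (intro poly_pieceI) (auto simp: coeff_1 intro: graded_span.zero)
    have X: "[:0, 1:] \<in> poly_piece 0 1 1"
      using filt_one by (intro poly_pieceI)
        (auto simp: coeff_pCons intro: graded_span.zero split: nat.splits)
    have b: "[:b:] \<in> poly_piece 1 0 w" if "(w, b) \<in> V" for b w
      using filt_gen[OF that filt_one]
      by (intro poly_pieceI) (auto simp: coeff_pCons intro: graded_span.zero split: nat.splits)
    have "v \<in> poly_piece (fst h) (fst (snd h)) (snd (snd h))"
      using gen(1) one X b by auto
    from poly_piece_mult[OF this gen(3)] show ?case by simp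
  qed
  from this[of "(p, d, w)" q] show "poly_filt (p, d, w) q \<Longrightarrow> q \<in> poly_piece p d w" by simp
qed

lemma poly_filt_mult: "poly_filt (p, d, w) x \<Longrightarrow> poly_filt (p', d', w') y \<Longrightarrow>
    poly_filt (p + p', d + d', w + w') (x * y)"
  using graded_span_mult[OF is_subring_poly_scalars, of poly_gens "(p, d, w)" x "(p', d', w')" y] by simp

lemma poly_filt_monom_1: "j \<le> d \<Longrightarrow> poly_filt (0, int d, 2 * int j - int d) (monom 1 j)"
proof (induction d arbitrary: j)
  case 0
  have "poly_filt 0 1" by (rule graded_span.const[OF subring_1[OF is_subring_poly_scalars]])
  then show ?case using 0 by (simp add: zero_prod_def monom_0 one_pCons)
next
  case (Suc d)
  show ?case
  proof (cases "j = Suc d")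
    case True
    have "poly_filt ((0, 1, 1) + (0, int d, 2 * int d - int d)) ([:0, 1:] * monom 1 d)"
      by (rule graded_span.gen) (use Suc.IH[of d] in auto)
    then show ?thesis by (simp add: True monom_Suc algebra_simps)
  next
    case False
    have "poly_filt ((0, 1, - 1) + (0, int d, 2 * int j - int d)) (1 * monom 1 j)"
      by (rule graded_span.gen) (use Suc.IH[of j] Suc.prems False in auto)
    then show ?thesis by (simp add: algebra_simps)
  qed
qed

lemma poly_filt_const: "filt (p, w) b \<Longrightarrow> poly_filt (p, 0, w) [:b:]"
proof (induction rule: filt_induct)
  case (zero p w)
  then show ?case by (simp add: graded_span.zero)
next
  case (add p w x y)
  then show ?case using graded_span.add[OF add.IH] by simp
next
  case (const c)
  have "poly_filt 0 [:scale c 1:]" by (rule graded_span.const) (auto simp: scalars_def)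
  then show ?case by (simp add: zero_prod_def)
next
  case (gen i v p w x)
  have "poly_filt ((1, 0, i) + (p, 0, w)) ([:v:] * [:x:])"
    using gen(1) by (intro graded_span.gen gen(3)) force
  then show ?case by (simp add: algebra_simps)
qed

lemma poly_filt_monom:
  assumes "filt (p, w) b" "j \<le> d"
  shows "poly_filt (p, int d, w + 2 * int j - int d) (monom b j)"
proof -
  have "[:b:] * monom 1 j = monom b j" by (simp add: smult_monom)
  then show ?thesis
    using poly_filt_mult[OF poly_filt_const[OF assms(1)] poly_filt_monom_1[OF assms(2)]]
    by (simp add: add_diff_eq)
qed

text \<open>
The polynomial \<open>exp (- X U) a\<close>; the sum stops at \<open>d\<close> because \<open>U\<^sup>d\<^sup>+\<^sup>1 a = 0\<close> for a highest weight vector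
\<open>a\<close> of weight \<open>d\<close>.
\<close>

definition covariant :: "nat \<Rightarrow> 'b \<Rightarrow> 'b poly" where
  "covariant d a = (\<Sum>j\<le>d. monom (scale ((- 1) ^ j / fact j) ((U ^^ j) a)) j)"

lemma coeff_covariant:
  assumes "a \<in> B (int d)" "D a = 0"
  shows "coeff (covariant d a) j = scale ((- 1) ^ j / fact j) ((U ^^ j) a)"
proof -
  have "coeff (covariant d a) j
      = (if j \<le> d then scale ((- 1) ^ j / fact j) ((U ^^ j) a) else 0)"
    unfolding covariant_def coeff_sum by (simp add: coeff_monom cong: if_cong)
  moreover have "(U ^^ j) a = 0" if "\<not> j \<le> d"
  proof -
    have "j = (j - Suc d) + Suc d" using that by simp
    then have "(U ^^ j) a = (U ^^ (j - Suc d)) ((U ^^ Suc d) a)"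
      by (metis funpow_add comp_apply)
    then show ?thesis
      unfolding funpow_U_highest_eq_0[OF assms] by (simp add: derivation_funpow_0[OF derivation_U])
  qed
  ultimately show ?thesis by simp
qed

lemma covariant_coefficient_recursion: "of_int (int j + 1) * ((- 1) ^ Suc j / fact (Suc j)) = - ((- 1) ^ j / (fact j :: 'k))"
proof -
  have "(of_nat (Suc j) :: 'k) \<noteq> 0" by (rule of_nat_neq_0)
  moreover have "of_int (int j + 1) = (of_nat (Suc j) :: 'k)" by simp
  ultimately show ?thesis by (simp del: of_nat_Suc of_int_add)
qed

lemma poly_U_covariant:
  assumes "a \<in> B (int d)" "D a = 0"
  shows "poly_U (covariant d a) = 0"
proof (rule poly_eqI)
  fix j
  have "coeff (poly_U (covariant d a)) j
      = scale ((- 1) ^ j / fact j) ((U ^^ Suc j) a)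
        + scale (of_int (int j + 1) * ((- 1) ^ Suc j / fact (Suc j))) ((U ^^ Suc j) a)"
    by (simp only: coeff_poly_U coeff_covariant[OF assms] U_scale scale_of_int[symmetric] scale_scale)
      simp
  then show "coeff (poly_U (covariant d a)) j = coeff 0 j"
    unfolding covariant_coefficient_recursion by (simp only: scale_minus_left add.right_inverse coeff_0)
qed

lemma poly_D_covariant:
  assumes a: "a \<in> B (int d)" "D a = 0"
  shows "poly_D (int d) (covariant d a) = 0"
proof (rule poly_eqI)
  fix j
  show "coeff (poly_D (int d) (covariant d a)) j = coeff 0 j"
  proof (cases j)
    case 0
    then show ?thesis using a(2) by (simp add: coeff_poly_D_0 coeff_covariant[OF a])
  next
    case (Suc i)
    let ?c = "(- 1) ^ Suc i / fact (Suc i) :: 'k"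
    have "coeff (poly_D (int d) (covariant d a)) (Suc i)
        = scale (?c * of_int ((int i + 1) * (int d - int i))) ((U ^^ i) a)
          + scale (of_int (int d - int i) * ((- 1) ^ i / fact i)) ((U ^^ i) a)"
      by (simp only: coeff_poly_D_Suc coeff_covariant[OF a] D_scale D_U_highest[OF a]
          scale_of_int[symmetric] scale_scale)
    also have "?c * of_int ((int i + 1) * (int d - int i))
        = of_int (int d - int i) * (of_int (int i + 1) * ?c)"
      by (simp only: of_int_mult ac_simps)
    also have "\<dots> = - (of_int (int d - int i) * ((- 1) ^ i / fact i))"
      unfolding covariant_coefficient_recursion by simp
    finally show ?thesis unfolding Suc by (simp only: scale_minus_left add.left_inverse coeff_0)
  qed
qed

lemma poly_filt_covariant:
  assumes "filt (p, int d) a"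
  shows "poly_filt (p, int d, 0) (covariant d a)"
  unfolding covariant_def
proof (rule graded_span_sum)
  fix j assume "j \<in> {..d}"
  then have "poly_filt (p, int d, int d - 2 * int j + 2 * int j - int d)
      (monom (scale ((- 1) ^ j / fact j) ((U ^^ j) a)) j)"
    by (intro poly_filt_monom filt_scale filt_funpow_U assms) simp
  then show "poly_filt (p, int d, 0) (monom (scale ((- 1) ^ j / fact j) ((U ^^ j) a)) j)" by simp
qed

text \<open>
Degree zero is excluded because the descent in the proof of finite generation has to lower the total
degree \<open>p + d\<close>.
\<close>

definition positive_invariant :: "int \<times> int \<times> int \<Rightarrow> 'b poly \<Rightarrow> bool" where
  "positive_invariant = (\<lambda>(p, d, w) q. w = 0 \<and> 0 \<le> p \<and> 0 \<le> d \<and> 0 < p + d \<and>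
    poly_filt (p, d, w) q \<and> poly_D d q = 0 \<and> poly_U q = 0)"

text \<open>
The substitute for the Reynolds operator. Each coefficient is split as \<open>s + U (D y)\<close> with \<open>D s = 0\<close>.
Multiplication by an invariant commutes with both operators, so the difference of \<open>x\<close> and
\<open>\<Sum> s q\<close> is \<open>U z\<close> for an element \<open>z\<close> of weight 2 with \<open>D (U z) = 0\<close>, and hence zero.
\<close>

lemma invariant_coefficients:
  fixes deg :: "(int \<times> int \<times> int) \<times> 'b poly \<Rightarrow> int"
  defines "deg \<equiv> \<lambda>t. fst (snd (fst t))"
  assumes T: "finite T" "\<And>t. t \<in> T \<Longrightarrow> positive_invariant (fst t) (snd t)"
    and x: "poly_D d x = 0"
    and r: "\<And>t. t \<in> T \<Longrightarrow> poly_filt ((p, d, 0) - fst t) (r t)"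
    and eq: "x = (\<Sum>t\<in>T. r t * snd t)"
  shows "\<exists>s. (\<forall>t\<in>T. s t \<in> poly_piece (p - fst (fst t)) (d - deg t) 0 \<and>
      poly_D (d - deg t) (s t) = 0) \<and> x = (\<Sum>t\<in>T. s t * snd t)"
proof -
  define splits where "splits t s y \<longleftrightarrow> s \<in> poly_piece (p - fst (fst t)) (d - deg t) 0 \<and>
    y \<in> poly_piece (p - fst (fst t)) (d - deg t) 0 \<and>
    poly_D (d - deg t) s = 0 \<and> r t = s + poly_U (poly_D (d - deg t) y)" for t s y
  have "\<exists>s y. splits t s y" if t: "t \<in> T" for t
  proof -
    have "snd (snd (fst t)) = 0" using T(2)[OF t] unfolding positive_invariant_def by auto
    then have h: "fst t = (fst (fst t), deg t, 0)" unfolding deg_def by (metis prod.collapse)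
    have "(p, d, 0) - fst t = (p - fst (fst t), d - deg t, 0)" by (subst h) simp
    then have "r t \<in> poly_piece (p - fst (fst t)) (d - deg t) 0"
      using r[OF t] by (intro poly_filt_piece) simp
    then show ?thesis
      using weight_module.highest_plus_UD[OF weight_module_poly, of "r t"
          "p - fst (fst t)" "d - deg t" 0] unfolding splits_def by auto
  qed
  then obtain s y where "\<And>t. t \<in> T \<Longrightarrow> splits t (s t) (y t)" by metis
  then have sy: "\<forall>t\<in>T. s t \<in> poly_piece (p - fst (fst t)) (d - deg t) 0 \<and>
      y t \<in> poly_piece (p - fst (fst t)) (d - deg t) 0 \<and>
      poly_D (d - deg t) (s t) = 0 \<and> r t = s t + poly_U (poly_D (d - deg t) (y t))"
    unfolding splits_def by blast
  interpret poly: weight_module poly_scale "poly_piece p d" "poly_D d" poly_U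
    by (rule weight_module_poly)
  define z where "z = poly_D d (\<Sum>t\<in>T. y t * snd t)"
  have q: "snd t \<in> poly_piece (fst (fst t)) (deg t) 0" "poly_D (deg t) (snd t) = 0"
    "poly_U (snd t) = 0" if "t \<in> T" for t
    using T(2)[OF that] poly_filt_piece unfolding positive_invariant_def deg_def
    by (auto split: prod.splits)
  have Dq: "poly_D d (a * snd t) = poly_D (d - deg t) a * snd t" if "t \<in> T" for t a
    using poly_D_mult[of "d - deg t" "deg t" a "snd t"] q(2)[OF that] by simp
  have z: "poly_U z = x - (\<Sum>t\<in>T. s t * snd t)"
  proof -
    have "poly_U z = (\<Sum>t\<in>T. poly_U (poly_D (d - deg t) (y t) * snd t))"
      unfolding z_def poly_D_sum poly_U_sum using Dq by (intro sum.cong) auto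
    also have "\<dots> = (\<Sum>t\<in>T. r t * snd t - s t * snd t)"
      using sy q(3) by (intro sum.cong refl) (simp add: poly_U_mult distrib_right)
    also have "\<dots> = x - (\<Sum>t\<in>T. s t * snd t)"
      unfolding eq by (simp add: sum_subtractf)
    finally show ?thesis .
  qed
  have "poly_D d (\<Sum>t\<in>T. s t * snd t) = 0"
    unfolding poly_D_sum using Dq sy by (intro sum.neutral) auto
  then have "poly_D d (poly_U z) = 0" unfolding z poly_D_diff using x by simp
  moreover have "(\<Sum>t\<in>T. y t * snd t) \<in> poly_piece p d 0"
  proof (rule poly.subspace_sum[OF poly.subspace_M])
    fix t assume t: "t \<in> T"
    show "y t * snd t \<in> poly_piece p d 0"
      using poly_piece_mult[of "y t" "p - fst (fst t)" "d - deg t" 0 "snd t" "fst (fst t)" "deg t" 0]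
        sy t q(1)[OF t] by simp
  qed
  then have "z \<in> poly_piece p d 2" unfolding z_def using poly_D_piece by fastforce
  ultimately have "z = 0" by (intro poly.DU_injective[of z 2]) auto
  then have "x = (\<Sum>t\<in>T. s t * snd t)" using z by (simp add: poly_U_0)
  then show ?thesis using sy by (intro exI[of _ s]) auto
qed

text \<open>
The constant coefficients of a finite basis of covariants generate. A highest weight vector
\<open>a\<close> in filtration step \<open>p\<close> and of weight \<open>d\<close> is a combination of them with coefficients that are again
highest weight vectors, in smaller total degree \<open>p + d\<close>; the induction ends at the scalars.
\<close>

lemma fin_gen_Ker_D: "fin_gen_algebra scale (Ker D)"
proof -
  have fin: "finite poly_gens" using finite_V by simp
  have filt: "poly_filt h q" if "positive_invariant h q" for h q
    using that unfolding positive_invariant_def by (auto split: prod.splits)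
  have "\<exists>T. finite T \<and> (\<forall>t\<in>T. positive_invariant (fst t) (snd t)) \<and>
    (\<forall>g x. positive_invariant g x \<longrightarrow> (\<exists>r. (\<forall>t\<in>T. poly_filt (g - fst t) (r t)) \<and>
        x = (\<Sum>t\<in>T. r t * snd t)))"
  proof (rule graded_ideal_finite_basis[OF is_subring_poly_scalars _ fin])
    show "\<exists>y\<in>poly_scalars. y * x = 1" if "x \<in> poly_scalars" "x \<noteq> 0" for x
      using that by (rule poly_scalars_inverse)
  qed (rule filt)
  then obtain T where T: "finite T" "\<forall>t\<in>T. positive_invariant (fst t) (snd t)"
    "\<forall>g x. positive_invariant g x \<longrightarrow> (\<exists>r. (\<forall>t\<in>T. poly_filt (g - fst t) (r t)) \<and>
        x = (\<Sum>t\<in>T. r t * snd t))"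
    by (elim exE conjE) (rule that)
  have T_inv: "positive_invariant (fst t) (snd t)" if "t \<in> T" for t using T(2) that by blast
  define G where "G = (\<lambda>t. coeff (snd t) 0) ` T"
  let ?A = "is_subalgebra scale hull G"
  have A: "is_subalgebra scale ?A" by (rule is_subalgebra_hull)
  then have A_ring: "is_subring ?A" and A_scale: "\<And>c x. x \<in> ?A \<Longrightarrow> scale c x \<in> ?A"
    unfolding is_subalgebra_def by auto
  have "a \<in> ?A" if "filt (p, d) a" "D a = 0" for p d a
    using that
  proof (induction "nat (p + d)" arbitrary: p d a rule: less_induct)
    case less
    have aB: "a \<in> B d" using less.prems(1) by (rule filt_B)
    show ?case
    proof (cases "p < 0 \<or> d < 0")
      case True
      then have "a = 0"
        using filt_nonpos[OF less.prems(1)] D_injective_negative[OF aB _ less.prems(2)] by auto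
      then show ?thesis using subring_0[OF A_ring] by simp
    next
      case nonneg: False
      show ?thesis
      proof (cases "p + d = 0")
        case True
        then have "a \<in> scalars" using filt_nonpos[OF less.prems(1)] nonneg by auto
        then show ?thesis using A_scale[OF subring_1[OF A_ring]] unfolding scalars_def by auto
      next
        case False
        define n where "n = nat d"
        have d: "d = int n" using nonneg unfolding n_def by simp
        have a: "a \<in> B (int n)" "D a = 0" using aB less.prems(2) unfolding d by auto
        let ?x = "covariant n a"
        have "positive_invariant (p, d, 0) ?x"
          unfolding positive_invariant_def d
          using nonneg False poly_filt_covariant less.prems(1) poly_D_covariant[OF a]
            poly_U_covariant[OF a] unfolding d by auto
        from T(3)[rule_format, OF this] obtain r where r: "\<And>t. t \<in> T \<Longrightarrow> poly_filt ((p, d, 0) - fst t) (r t)"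
          "?x = (\<Sum>t\<in>T. r t * snd t)" by blast
        have "poly_D d ?x = 0" using poly_D_covariant[OF a] d by simp
        from invariant_coefficients[OF T(1) T_inv this r]
        obtain s where
          s: "\<And>t. t \<in> T \<Longrightarrow> s t \<in> poly_piece (p - fst (fst t)) (d - fst (snd (fst t))) 0"
            "\<And>t. t \<in> T \<Longrightarrow> poly_D (d - fst (snd (fst t))) (s t) = 0"
          and x: "?x = (\<Sum>t\<in>T. s t * snd t)" by blast
        have "a = coeff ?x 0" by (simp add: coeff_covariant[OF a])
        also have "\<dots> = (\<Sum>t\<in>T. coeff (s t) 0 * coeff (snd t) 0)"
          unfolding x coeff_sum by (simp add: coeff_mult)
        also have "\<dots> \<in> ?A"
        proof (intro subring_sum[OF A_ring] subring_mult[OF A_ring])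
          fix t assume t: "t \<in> T"
          have h: "0 < fst (fst t) + fst (snd (fst t))"
            using T_inv[OF t] unfolding positive_invariant_def by auto
          show "coeff (s t) 0 \<in> ?A"
          proof (rule less.hyps)
            show "nat (p - fst (fst t) + (d - fst (snd (fst t)))) < nat (p + d)"
              using h nonneg False by linarith
            show "filt (p - fst (fst t), d - fst (snd (fst t))) (coeff (s t) 0)"
              by (rule poly_pieceD(1)[OF s(1)[OF t]]) simp
            have "coeff (poly_D (d - fst (snd (fst t))) (s t)) 0 = 0"
              using s(2)[OF t] by simp
            then show "D (coeff (s t) 0) = 0" by (simp only: coeff_poly_D_0)
          qed
          show "coeff (snd t) 0 \<in> ?A"
            using t unfolding G_def by (intro hull_inc imageI)
        qed
        finally show ?thesis .
      qed
    qed
  qed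
  then have hom: "component a i \<in> ?A" if "D a = 0" for a i
    using filt_exhausts[OF component_B] component_Ker_D[OF that] by blast
  have "Ker D \<subseteq> ?A"
  proof
    fix a assume "a \<in> Ker D"
    then have "sum (component a) {i. component a i \<noteq> 0} \<in> ?A"
      using hom by (intro subring_sum[OF A_ring]) (simp add: Ker_def)
    then show "a \<in> ?A" by (simp add: sum_components)
  qed
  moreover have "?A \<subseteq> Ker D"
  proof (rule hull_minimal)
    show "is_subalgebra scale (Ker D)" by (rule is_subalgebra_Ker_D)
    show "G \<subseteq> Ker D"
    proof
      fix x assume "x \<in> G"
      then obtain t where t: "t \<in> T" "x = coeff (snd t) 0" unfolding G_def by auto
      have "poly_D (fst (snd (fst t))) (snd t) = 0"
        using T_inv[OF t(1)] unfolding positive_invariant_def by auto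
      then have "coeff (poly_D (fst (snd (fst t))) (snd t)) 0 = 0" by simp
      then show "x \<in> Ker D" unfolding t(2) Ker_def by (simp add: coeff_poly_D_0)
    qed
  qed
  moreover have "finite G" unfolding G_def using T(1) by simp
  ultimately show ?thesis unfolding fin_gen_algebra_def by blast
qed

end

section \<open>Structure of fundamental pairs\<close>

theorem theorem3p4:
  fixes scale :: "'k::field_char_0 \<Rightarrow> 'b::idom \<Rightarrow> 'b"
    and D U :: "'b \<Rightarrow> 'b"
    and B Ah :: "int \<Rightarrow> 'b set"
    and A \<Omega> :: "'b set"
    and F I :: "nat \<Rightarrow> 'b set"
  assumes "k_domain scale"
    and "fin_gen_algebra scale (UNIV :: 'b set)"
    and "fundamental_pair D U"
    and "\<not> trivial_pair D U"
    and "B = grad_comp D U"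
    and "A = Ker D"
    and "\<Omega> = Ker U"
    and "Ah = (\<lambda>n. A \<inter> B n)"
    and "F = (\<lambda>n. Ker (D ^^ (n + 1)))"
    and "I = (\<lambda>n. (D ^^ n) ` F n)"
  shows "(fin_gen_algebra scale A)
    \<and> ((\<forall>n. is_ideal A (I n) \<and> direct_sum_of \<int> (I n) {int n..} Ah) \<and>
            nat_graded A (\<lambda>i. Ah (int i)))
    \<and> (\<forall>(r::nat) (f::nat \<Rightarrow> 'b) (m::int).
              (\<forall>i\<in>{1..r}. f i \<in> A \<and> homogeneous B (f i)) \<and>
              I 1 = ideal_gen A (f ` {1..r}) \<and>
              m = Max {hdeg B (f i) | i. i \<in> {1..r} \<and> f i \<noteq> 0} \<longrightarrow>
                A = adjoin (Ah 0) (f ` {1..r}) \<and>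
                (\<forall>n\<ge>1. I n = ideal_gen A (\<Union>j\<in>{int n..int n + m - 1}. Ah j)) \<and>
                (\<forall>n. int n > m \<longrightarrow>
                   I n = sum_of {e. (\<forall>i. i \<notin> {1..nat m} \<longrightarrow> e i = 0) \<and> (\<Sum>i\<in>{1..nat m}. i * e i) = n}
                           (\<lambda>e. ideal_monomial A I e (nat m))))
    \<and> (\<forall>(n::nat) (s::nat) (g::nat \<Rightarrow> 'b) (h::nat \<Rightarrow> 'b).
              n \<ge> 1 \<and>
              (\<forall>i\<in>{1..s}. g i \<in> A \<and> homogeneous B (g i)) \<and>
              I n = ideal_gen A (g ` {1..s}) \<and>
              (\<forall>i\<in>{1..s}. h i = (U ^^ n) (g i)) \<longrightarrow>
                F n = {(\<Sum>i\<in>{1..s}. a i * h i) + b | a b. (\<forall>i\<in>{1..s}. a i \<in> A) \<and> b \<in> F (n - 1)})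
    \<and> (direct_sum2 (Ah 0) UNIV \<Omega> (range D) \<and> direct_sum2 (Ah 0) UNIV A (range U))
    \<and> (\<forall>n. D ` B n \<subseteq> B (n + 2) \<and>
              (n \<le> -1 \<longrightarrow> inj_on D (B n)) \<and> (n \<ge> -1 \<longrightarrow> D ` B n = B (n + 2)))
    \<and> (D ` B (-2) = U ` B 2 \<and> direct_sum2 (Ah 0) (B 0) (Ah 0) (D ` B (-2)))"
proof -
  interpret sl2_domain scale D U using assms(1,3) by unfold_locales
  note A = assms(6) and B = assms(5)
  have Ah: "Ah = (\<lambda>n. Ker D \<inter> grad_comp D U n)" unfolding assms(8) A B ..
  have I: "I = image_ideal" unfolding assms(9,10) by (rule ext) (simp add: image_ideal_def)
  have affine: "fin_gen_algebra scale (Ker D)"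
  proof -
    obtain V where "finite V" "sl2_closed V" "(0, 1) \<in> V" "is_subalgebra scale hull (snd ` V) = UNIV"
      using homogeneous_generators[OF assms(2)] by blast
    then interpret sl2_generators scale D U V by unfold_locales
    show ?thesis by (rule fin_gen_Ker_D)
  qed
  have generators: "Ker D = adjoin (Ah 0) (f ` {1..r}) \<and>
      (\<forall>n\<ge>1. I n = ideal_gen (Ker D) (\<Union>j\<in>{int n..int n + m - 1}. Ah j)) \<and>
      (\<forall>n. int n > m \<longrightarrow>
        I n = sum_of {e. (\<forall>i. i \<notin> {1..nat m} \<longrightarrow> e i = 0) \<and> (\<Sum>i\<in>{1..nat m}. i * e i) = n}
          (\<lambda>e. ideal_monomial (Ker D) I e (nat m)))"
    if f: "\<forall>i\<in>{1..r}. f i \<in> Ker D \<and> homogeneous (grad_comp D U) (f i)"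
      and I_1: "I 1 = ideal_gen (Ker D) (f ` {1..r})"
      and m: "m = Max {hdeg (grad_comp D U) (f i) | i. i \<in> {1..r} \<and> f i \<noteq> 0}"
    for r :: nat and f :: "nat \<Rightarrow> 'b" and m :: int
  proof -
    let ?H = "{hdeg (grad_comp D U) (f i) | i. i \<in> {1..r} \<and> f i \<noteq> 0}"
    have finite_H: "finite ?H" by simp
    \<comment> \<open>The zero element lies in all degrees; any value between 1 and \<open>m\<close> may serve as its degree.\<close>
    define \<delta> where "\<delta> i = (if f i = 0 then 1 else hdeg (grad_comp D U) (f i))" for i
    have f\<delta>: "f i \<in> Ker D \<inter> grad_comp D U (\<delta> i)" if i: "i \<in> {1..r}" for i
    proof -
      obtain d where "f i \<in> grad_comp D U d" using f i unfolding homogeneous_def by blast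
      then show ?thesis using f i hdeg_eq[of "f i" d] zero_B unfolding \<delta>_def by auto
    qed
    have I1: "image_ideal 1 = ideal_gen (Ker D) (f ` {1..r})" using I_1 unfolding I .
    have pos: "1 \<le> hdeg (grad_comp D U) (f i) \<and> hdeg (grad_comp D U) (f i) \<le> m"
      if i: "i \<in> {1..r}" "f i \<noteq> 0" for i
    proof
      have "f i \<in> image_ideal 1" unfolding I1 using subset_ideal_gen i(1) by blast
      then show "1 \<le> hdeg (grad_comp D U) (f i)"
        using homogeneous_in_image_idealD[of "f i" 1 "\<delta> i"] f\<delta>[OF i(1)] i(2) unfolding \<delta>_def by auto
      show "hdeg (grad_comp D U) (f i) \<le> m"
        unfolding m using i by (intro Max_ge finite_H) blast
    qed
    have "\<exists>i\<in>{1..r}. f i \<noteq> 0"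
    proof (rule ccontr)
      assume "\<not> (\<exists>i\<in>{1..r}. f i \<noteq> 0)"
      then have "ideal_gen (Ker D) (f ` {1..r}) \<subseteq> {0}"
        using D_0 by (intro ideal_gen_minimal) (auto simp: is_ideal_def is_submodule_def Ker_def)
      then show False using image_ideal_1_nonzero[OF assms(4)] I1 by blast
    qed
    then have "1 \<le> m" using pos by force
    then have \<delta>: "1 \<le> \<delta> i \<and> \<delta> i \<le> m" if "i \<in> {1..r}" for i
      using pos[OF that] unfolding \<delta>_def by simp
    show ?thesis
      unfolding I Ah
    proof (intro conjI allI impI)
      show "Ker D = adjoin (Ker D \<inter> grad_comp D U 0) (f ` {1..r})"
        using finite_atLeastAtMost f\<delta> \<delta> I1 by (rule Ker_D_eq_adjoin)
      fix n :: nat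
      show "image_ideal n = ideal_gen (Ker D)
          (\<Union>j\<in>{int n..int n + m - 1}. Ker D \<inter> grad_comp D U j)" if "n \<ge> 1"
        using finite_atLeastAtMost f\<delta> \<delta> I1 that by (rule image_ideal_low_degree_generators)
      have "image_ideal n = sum_of (exponents m n) (\<lambda>e. ideal_monomial (Ker D) image_ideal e (nat m))"
        using finite_atLeastAtMost f\<delta> \<delta> I1 by (rule image_ideal_eq_sum_of_monomials)
      then show "image_ideal n = sum_of
          {e. (\<forall>i. i \<notin> {1..nat m} \<longrightarrow> e i = 0) \<and> (\<Sum>i\<in>{1..nat m}. i * e i) = n}
          (\<lambda>e. ideal_monomial (Ker D) image_ideal e (nat m))"
        unfolding exponents_def .
    qed
  qed
  have spanning: "Ker (D ^^ (n + 1)) =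
      {(\<Sum>i\<in>{1..s}. a i * h i) + b | a b. (\<forall>i\<in>{1..s}. a i \<in> Ker D) \<and> b \<in> Ker (D ^^ (n - 1 + 1))}"
    if n: "n \<ge> 1" and g: "\<forall>i\<in>{1..s}. g i \<in> Ker D \<and> homogeneous (grad_comp D U) (g i)"
      and I_n: "I n = ideal_gen (Ker D) (g ` {1..s})" and h: "\<forall>i\<in>{1..s}. h i = (U ^^ n) (g i)"
    for n s :: nat and g h :: "nat \<Rightarrow> 'b"
  proof -
    have "\<forall>i\<in>{1..s}. \<exists>d. g i \<in> grad_comp D U d" using g unfolding homogeneous_def by blast
    from bchoice[OF this] obtain \<delta> where "\<forall>i\<in>{1..s}. g i \<in> grad_comp D U (\<delta> i)" by blast
    then have "g i \<in> Ker D \<inter> grad_comp D U (\<delta> i)" if "i \<in> {1..s}" for i using g that by blast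
    from Ker_funpow_D_eq_span[OF finite_atLeastAtMost this I_n[unfolded I] h[rule_format] n]
    show ?thesis .
  qed
  show ?thesis
    unfolding A B assms(7,9)
  proof (intro conjI)
    show "\<forall>n. is_ideal (Ker D) (I n) \<and> direct_sum_of \<int> (I n) {int n..} Ah"
      unfolding I Ah using is_ideal_image_ideal direct_sum_image_ideal by blast
    show "nat_graded (Ker D) (\<lambda>i. Ah (int i))" unfolding Ah by (rule nat_graded_Ker_D)
    show "direct_sum2 (Ah 0) UNIV (Ker U) (range D)" unfolding Ah by (rule direct_sum_Ker_U_range_D)
    show "direct_sum2 (Ah 0) UNIV (Ker D) (range U)" unfolding Ah by (rule direct_sum_Ker_D_range_U)
    show "\<forall>n. D ` grad_comp D U n \<subseteq> grad_comp D U (n + 2) \<and>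
        (n \<le> -1 \<longrightarrow> inj_on D (grad_comp D U n)) \<and>
        (n \<ge> -1 \<longrightarrow> D ` grad_comp D U n = grad_comp D U (n + 2))"
      by (intro allI conjI impI D_image_B inj_on_D_B D_image_B_eq)
    show "D ` grad_comp D U (- 2) = U ` grad_comp D U 2" by (rule D_image_eq_U_image)
    show "direct_sum2 (Ah 0) (grad_comp D U 0) (Ah 0) (D ` grad_comp D U (- 2))"
      unfolding Ah by (rule direct_sum_B_0)
  qed (rule affine,
      (intro allI impI, elim conjE, rule generators; assumption),
      (intro allI impI, elim conjE, rule spanning; assumption))
qed

end
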